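(* Let $n\ge 2$ and let $A\subseteq S^{n-1}$ be a measurable subset such that $\sigma_{n-1}(A)=1/2$. Let $L$ be a uniformly chosen random geodesic (great circle) on $S^{n-1}$, and let $\sigma_L$ be the uniform probability measure on $S^{n-1}\cap L$. Then $$\mathbb{P}_{L}\left(\left|\frac{\sigma_{L}(A\cap L)}{\sigma_{n-1}(A)}-1\right|\geq\frac{1}{2^{1/3}}\right)\leq \frac{1}{2^{1/3}}.$$
   Context: $S^{n-1}=\{x\in\mathbb{R}^n : |x|=1\}$ is the unit sphere and $\sigma_{n-1}$ is the rotation invariant probability measure on it. A uniformly chosen geodesic on $S^{n-1}$ is the great circle $L=S^{n-1}\cap H$, where $H$ is a random $2$-dimensional linear subspace of $\mathbb{R}^n$ distributed according to the rotation invariant probability measure on the Grassmannian $G_{n,2}$. Equivalently (in distribution), it is the great circle through a uniform random point of $S^{n-1}$ in a uniform random unit tangent direction. *)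

theory Defs
  imports "HOL-Probability.Probability"
begin

definition rotation :: "(real^'n \<Rightarrow> real^'n) \<Rightarrow> bool" where
  "rotation f \<longleftrightarrow> orthogonal_transformation f \<and> det (matrix f) = 1"

text \<open>
  Borel probability measures on a set \<open>S\<close> that are invariant under every rotation of the ambient
  space mapping \<open>S\<close> onto itself. For \<open>S\<close> the unit sphere these are all rotations; for a great circle
  \<open>S\<close> they restrict to the full group of isometries of \<open>S\<close> (if the ambient dimension is at least 3)
  or to its group of rotations (in dimension 2). In these cases there is exactly one such measure.
\<close>
definition rotation_invariant_prob_on :: "(real^'n) set \<Rightarrow> (real^'n) measure \<Rightarrow> bool" where
  "rotation_invariant_prob_on S M \<longleftrightarrow>
     prob_space M \<and> sets M = sets (restrict_space borel S) \<and>
     (\<forall>f. rotation f \<and> f ` S = S \<longrightarrow> (\<forall>B\<in>sets M. measure M (f ` B) = measure M B))"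

definition grassmannian :: "nat \<Rightarrow> (real^'n) set set" where
  "grassmannian k = {H. subspace H \<and> dim H = k}"

text \<open>
  A subspace \<open>H\<close> is identified with the matrix of the orthogonal projection onto it, which is
  \<open>closest_point H\<close>. This embeds the Grassmannian into the space of matrices, and the sigma-algebra
  below is the Borel sigma-algebra of the topology induced by this embedding.
\<close>
definition proj_matrix :: "(real^'n) set \<Rightarrow> real^'n^'n" where
  "proj_matrix H = matrix (closest_point H)"

definition grassmannian_borel :: "nat \<Rightarrow> (real^'n) set measure" where
  "grassmannian_borel k = vimage_algebra (grassmannian k) proj_matrix borel"

definition rotation_invariant_prob_grassmannian :: "nat \<Rightarrow> (real^'n) set measure \<Rightarrow> bool" where
  "rotation_invariant_prob_grassmannian k M \<longleftrightarrow>
     prob_space M \<and> sets M = sets (grassmannian_borel k) \<and>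
     (\<forall>f. rotation f \<longrightarrow> (\<forall>B\<in>sets M. measure M ((`) f ` B) = measure M B))"

definition great_circle :: "(real^'n) set \<Rightarrow> (real^'n) set" where
  "great_circle H = sphere 0 1 \<inter> H"


section \<open>Existence of the rotation invariant measures\<close>

lemma linear_borel_measurable:
  fixes f :: "'a::euclidean_space \<Rightarrow> 'b::euclidean_space"
  assumes "linear f"
  shows "continuous_on UNIV f" "f \<in> borel_measurable borel"
proof -
  show "continuous_on UNIV f"
    using assms linear_conv_bounded_linear linear_continuous_on by blast
  then show "f \<in> borel_measurable borel" by (rule borel_measurable_continuous_onI)
qed

lemma lborel_distr_orthogonal:
  fixes f :: "'a::euclidean_space \<Rightarrow> 'a"
  assumes f: "orthogonal_transformation f"
  shows "distr lborel borel f = lborel"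
proof -
  have lin: "linear f" and bij: "bij f"
    using f by (auto simp: orthogonal_transformation_linear orthogonal_transformation_bij)
  have fm [measurable]: "f \<in> borel_measurable borel"
    using lin by (rule linear_borel_measurable)
  define N where "N = distr lborel borel f"
  define B where "B = ball (0::'a) 1"
  have [measurable_cong, simp]: "sets N = sets borel" by (simp add: N_def)
  have [measurable]: "B \<in> sets borel" by (simp add: B_def)
  have Nshift: "(\<integral>\<^sup>+x. h x \<partial>N) = (\<integral>\<^sup>+x. h (x + y) \<partial>N)" if h [measurable]: "h \<in> borel_measurable borel" for h y
  proof -
    obtain z where z: "y = f z" using bij by (metis bij_pointE)
    have "(\<integral>\<^sup>+x. h x \<partial>N) = (\<integral>\<^sup>+x. h (f x) \<partial>lborel)"
      by (simp add: N_def nn_integral_distr)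
    also have "\<dots> = (\<integral>\<^sup>+x. h (f (z + x)) \<partial>lborel)"
      by (subst lborel_distr_plus[of z, symmetric]) (simp add: nn_integral_distr)
    also have "\<dots> = (\<integral>\<^sup>+x. h (x + y) \<partial>N)"
      using lin by (simp add: N_def nn_integral_distr z linear_add add.commute)
    finally show ?thesis .
  qed
  have Lshift: "(\<integral>\<^sup>+x. h x \<partial>lborel) = (\<integral>\<^sup>+x. h (y + x) \<partial>lborel)"
    if h [measurable]: "h \<in> borel_measurable borel" for h :: "'a \<Rightarrow> ennreal" and y
    by (subst lborel_distr_plus[of y, symmetric]) (simp add: nn_integral_distr)
  have vB: "f -` B = B"
    using f by (auto simp: B_def orthogonal_transformation_norm)
  have NB: "emeasure N B = emeasure lborel B"
    by (simp add: N_def emeasure_distr vB)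
  have "unit_ball_vol (real DIM('a)) \<noteq> 0"
    using unit_ball_vol_pos[of "real DIM('a)"] by linarith
  then have fB: "emeasure lborel B \<noteq> \<infinity>" "emeasure lborel B \<noteq> 0"
    using emeasure_lborel_ball_finite[of "0::'a" 1] emeasure_ball[of 1 "0::'a"]
      unit_ball_vol_pos[of "real DIM('a)"]
    by (auto simp: B_def)
  interpret N: sigma_finite_measure N
  proof (rule sigma_finite_measure_distr)
    have [measurable]: "inv f \<in> borel_measurable borel"
      using orthogonal_transformation_inv[OF f] orthogonal_transformation_linear linear_borel_measurable
      by blast
    show "inv f \<in> N \<rightarrow>\<^sub>M lborel" by simp
    have "distr N lborel (inv f) = lborel"
      using bij by (simp add: N_def distr_distr o_def bij_is_inj distr_id2)
    then show "sigma_finite_measure (distr N lborel (inv f))"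
      by (simp add: sigma_finite_lborel)
  qed
  interpret P: pair_sigma_finite N lborel ..
  have "N = lborel"
  proof (rule measure_eqI)
    fix S assume "S \<in> sets N"
    then have [measurable]: "S \<in> sets borel" by simp
    let ?I = "indicator :: 'a set \<Rightarrow> 'a \<Rightarrow> ennreal"
    have "emeasure N S * emeasure lborel B = (\<integral>\<^sup>+x. ?I S x * (\<integral>\<^sup>+y. ?I B y \<partial>lborel) \<partial>N)"
      by (simp add: nn_integral_multc)
    also have "\<dots> = (\<integral>\<^sup>+x. ?I S x * (\<integral>\<^sup>+y. ?I B (- x + y) \<partial>lborel) \<partial>N)"
      by (intro nn_integral_cong arg_cong2[where f = "(*)"] refl Lshift) simp
    also have "\<dots> = (\<integral>\<^sup>+x. (\<integral>\<^sup>+y. ?I S x * ?I B (- x + y) \<partial>lborel) \<partial>N)"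
      by (simp add: nn_integral_cmult)
    also have "\<dots> = (\<integral>\<^sup>+y. (\<integral>\<^sup>+x. ?I S x * ?I B (- x + y) \<partial>N) \<partial>lborel)"
      by (rule P.Fubini'[symmetric]) simp
    also have "\<dots> = (\<integral>\<^sup>+y. (\<integral>\<^sup>+x. ?I S (x + y) * ?I B (- x) \<partial>N) \<partial>lborel)"
    proof (rule nn_integral_cong)
      fix y
      show "(\<integral>\<^sup>+x. ?I S x * ?I B (- x + y) \<partial>N) = (\<integral>\<^sup>+x. ?I S (x + y) * ?I B (- x) \<partial>N)"
        by (subst Nshift[where y = y]) auto
    qed
    also have "\<dots> = (\<integral>\<^sup>+x. (\<integral>\<^sup>+y. ?I S (x + y) * ?I B (- x) \<partial>lborel) \<partial>N)"
      by (rule P.Fubini') simp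
    also have "\<dots> = (\<integral>\<^sup>+x. (\<integral>\<^sup>+y. ?I S (x + y) \<partial>lborel) * ?I B x \<partial>N)"
      by (simp add: nn_integral_multc B_def indicator_def)
    also have "\<dots> = emeasure lborel S * emeasure lborel B"
      by (subst Lshift[of "?I S", symmetric]) (simp_all add: nn_integral_cmult NB)
    finally show "emeasure N S = emeasure lborel S"
      using fB by (auto simp: mult.commute[of _ "emeasure lborel B"] ennreal_mult_cancel_left)
  qed simp
  then show ?thesis by (simp add: N_def)
qed

lemma distr_uniform_measure_invariant:
  fixes D :: "'a::euclidean_space set"
  assumes D: "open D" "bounded D" "D \<noteq> {}" and T [measurable]: "T \<in> borel \<rightarrow>\<^sub>M G"
  defines "M \<equiv> distr (uniform_measure lborel D) G T"
  shows "prob_space M"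
    and "\<lbrakk>orthogonal_transformation g; g ` D = D; \<And>x. x \<in> D \<Longrightarrow> T (g x) = F (T x);
          inj_on F (space G); B \<in> sets G; F ` B \<in> sets G\<rbrakk> \<Longrightarrow> measure M (F ` B) = measure M B"
proof -
  have [measurable]: "D \<in> sets borel" using D by simp
  have "\<not> negligible D" using D open_not_negligible by blast
  then have D0: "emeasure lborel D \<noteq> 0"
    by (auto simp: negligible_iff_null_sets null_sets_def)
  have Dfin: "emeasure lborel D \<noteq> \<infinity>"
    using emeasure_bounded_finite[OF D(2)] by auto
  have Tm: "T \<in> uniform_measure lborel D \<rightarrow>\<^sub>M G"
    by simp
  show "prob_space M"
    unfolding M_def using D0 Dfin Tm
    by (intro prob_space.prob_space_distr prob_space_uniform_measure) auto
  assume g: "orthogonal_transformation g" "g ` D = D" "\<And>x. x \<in> D \<Longrightarrow> T (g x) = F (T x)"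
    and F: "inj_on F (space G)" and B: "B \<in> sets G" "F ` B \<in> sets G"
  have gm [measurable]: "g \<in> borel_measurable borel"
    using g(1) orthogonal_transformation_linear linear_borel_measurable by blast
  have inj: "inj g" using g(1) by (rule orthogonal_transformation_inj)
  have TG: "T x \<in> space G" for x using measurable_space[OF T, of x] by simp
  have M: "emeasure M C = emeasure lborel (D \<inter> T -` C) / emeasure lborel D" if "C \<in> sets G" for C
    unfolding M_def using that measurable_sets[OF T that]
    by (subst emeasure_distr[OF Tm]) (auto simp: emeasure_uniform_measure)
  have S: "D \<inter> T -` (F ` B) \<in> sets borel"
    using measurable_sets[OF T B(2)] by simp
  have "g x \<in> D \<longleftrightarrow> x \<in> D" for x
    using g(2) inj by (metis inj_image_mem_iff)
  moreover have "F (T x) \<in> F ` B \<longleftrightarrow> T x \<in> B" for x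
    using inj_on_image_mem_iff[OF F TG] sets.sets_into_space[OF B(1)] by blast
  ultimately have *: "g -` (D \<inter> T -` (F ` B)) = D \<inter> T -` B"
    using g(3) by (intro set_eqI) (metis IntD1 IntD2 IntI vimageE vimageI2)
  have "emeasure lborel (D \<inter> T -` (F ` B)) = emeasure (distr lborel borel g) (D \<inter> T -` (F ` B))"
    by (simp add: lborel_distr_orthogonal[OF g(1)])
  also have "\<dots> = emeasure lborel (D \<inter> T -` B)"
    using S by (simp add: emeasure_distr * del: vimage_Int)
  finally show "measure M (F ` B) = measure M B"
    by (simp add: measure_def M B)
qed

lemma closest_point_subspace_eqI:
  fixes H :: "'a::euclidean_space set"
  assumes H: "subspace H" "p \<in> H" and orth: "\<And>h. h \<in> H \<Longrightarrow> (v - p) \<bullet> h = 0"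
  shows "closest_point H v = p"
proof (rule closest_point_unique[symmetric])
  show "\<forall>z\<in>H. dist v p \<le> dist v z"
  proof
    fix z assume "z \<in> H"
    then have "(v - p) \<bullet> (p - z) = 0"
      using H orth by (simp add: subspace_diff)
    then have "(norm (v - z))\<^sup>2 = (norm (v - p))\<^sup>2 + (norm (p - z))\<^sup>2"
      using norm_add_Pythagorean[of "v - p" "p - z"] by (simp add: orthogonal_def)
    then have "(norm (v - p))\<^sup>2 \<le> (norm (v - z))\<^sup>2" by simp
    then show "dist v p \<le> dist v z" by (simp add: dist_norm power2_le_iff_abs_le)
  qed
qed (use H in \<open>auto simp: subspace_imp_convex closed_subspace\<close>)

lemma closest_point_subspace:
  fixes H :: "'a::euclidean_space set"
  assumes H: "subspace H"
  shows "closest_point H v \<in> H" "h \<in> H \<Longrightarrow> (v - closest_point H v) \<bullet> h = 0"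
proof -
  obtain y z where yz: "y \<in> span H" "\<And>w. w \<in> span H \<Longrightarrow> orthogonal z w" "v = y + z"
    using orthogonal_subspace_decomp_exists[of H v] by metis
  have sp: "span H = H" using H by (simp add: span_eq_iff)
  then have "closest_point H v = y"
    using yz[unfolded sp] by (intro closest_point_subspace_eqI H) (auto simp: orthogonal_def)
  then show "closest_point H v \<in> H" "h \<in> H \<Longrightarrow> (v - closest_point H v) \<bullet> h = 0"
    using yz[unfolded sp] by (auto simp: orthogonal_def)
qed

lemma linear_closest_point:
  fixes H :: "'a::euclidean_space set"
  assumes H: "subspace H"
  shows "linear (closest_point H)"
proof (rule linearI)
  fix x y :: 'a and c :: real
  show "closest_point H (x + y) = closest_point H x + closest_point H y"
    using closest_point_subspace(1)[OF H] closest_point_subspace(2)[OF H, of _ x]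
      closest_point_subspace(2)[OF H, of _ y]
    by (intro closest_point_subspace_eqI H subspace_add) (auto simp: inner_diff_left inner_add_left)
  show "closest_point H (c *\<^sub>R x) = c *\<^sub>R closest_point H x"
    using closest_point_subspace(1)[OF H] closest_point_subspace(2)[OF H, of _ x]
    by (intro closest_point_subspace_eqI H subspace_scale) (auto simp: inner_diff_left)
qed

lemma closest_point_orthogonal_image:
  fixes f :: "'a::euclidean_space \<Rightarrow> 'a"
  assumes f: "orthogonal_transformation f" and H: "subspace H"
  shows "closest_point (f ` H) (f v) = f (closest_point H v)"
proof (rule closest_point_subspace_eqI)
  have lin: "linear f" using f by (rule orthogonal_transformation_linear)
  show "subspace (f ` H)" using lin H by (rule linear_subspace_image)
  show "f (closest_point H v) \<in> f ` H" using closest_point_subspace[OF H] by blast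
  fix h assume "h \<in> f ` H"
  then obtain k where "k \<in> H" "h = f k" by blast
  then show "(f v - f (closest_point H v)) \<bullet> h = 0"
    using closest_point_subspace(2)[OF H, of k v] f lin
    by (metis linear_diff orthogonal_transformation_def)
qed

lemma rotation_invariant_prob_on_sphere_exists:
  fixes H :: "(real^'n) set"
  assumes H: "subspace H" "H \<noteq> {0}"
  shows "\<exists>M. rotation_invariant_prob_on (sphere 0 1 \<inter> H) M"
proof -
  let ?S = "sphere 0 1 \<inter> H"
  obtain q where q: "q \<in> H" "q \<noteq> 0" using H subspace_0 by blast
  define p where "p = q /\<^sub>R norm q"
  have p: "p \<in> ?S" using q H by (auto simp: p_def subspace_scale)
  let ?P = "closest_point H"
  define D where "D = {x \<in> ball 0 1. ?P x \<noteq> 0}"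
  define T where "T x = (if ?P x = 0 then p else ?P x /\<^sub>R norm (?P x))" for x
  have contP: "continuous_on UNIV ?P"
    using linear_closest_point[OF H(1)] by (rule linear_borel_measurable)
  then have Pm [measurable]: "?P \<in> borel_measurable borel"
    by (rule borel_measurable_continuous_onI)
  have D: "open D" "bounded D" "D \<noteq> {}"
  proof -
    have "D = ball 0 1 \<inter> ?P -` (- {0})" by (auto simp: D_def)
    then show "open D" using contP by (auto intro!: open_Int open_vimage)
    show "bounded D" by (rule bounded_subset[of "ball 0 1"]) (auto simp: D_def)
    have "?P (p /\<^sub>R 2) = p /\<^sub>R 2"
      using p H by (intro closest_point_self) (auto simp: subspace_scale)
    then have "p /\<^sub>R 2 \<in> D" using p by (auto simp: D_def)
    then show "D \<noteq> {}" by blast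
  qed
  have TS: "T x \<in> ?S" for x
    using p closest_point_subspace(1)[OF H(1)] H by (auto simp: T_def subspace_scale)
  have Tm: "T \<in> borel \<rightarrow>\<^sub>M restrict_space borel ?S"
    using TS by (intro measurable_restrict_space2) (auto simp: T_def[abs_def])
  define M where "M = distr (uniform_measure lborel D) (restrict_space borel ?S) T"
  have "measure M (f ` B) = measure M B"
    if f: "rotation f" "f ` ?S = ?S" and B: "B \<in> sets M" for f B
    unfolding M_def
  proof (rule distr_uniform_measure_invariant(2)[OF D Tm])
    show o: "orthogonal_transformation f" using f by (simp add: rotation_def)
    have lin: "linear f" using o by (rule orthogonal_transformation_linear)
    have inj: "inj f" using o by (rule orthogonal_transformation_inj)
    have sub: "f ` H \<subseteq> H"
    proof
      fix y assume "y \<in> f ` H"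
      then obtain x where x: "x \<in> H" "y = f x" by blast
      show "y \<in> H"
      proof (cases "x = 0")
        case True
        then show ?thesis using x lin H by (simp add: linear_0 subspace_0)
      next
        case False
        then have "x /\<^sub>R norm x \<in> ?S" using x H by (auto simp: subspace_scale)
        then have "f (x /\<^sub>R norm x) \<in> H" using f(2) by blast
        then have "norm x *\<^sub>R f (x /\<^sub>R norm x) \<in> H" using H by (simp add: subspace_scale)
        then show ?thesis using False lin x by (simp add: linear_cmul)
      qed
    qed
    have fH: "f ` H = H"
    proof (rule subspace_dim_equal)
      show "subspace (f ` H)" using lin H by (simp add: linear_subspace_image)
      show "dim H \<le> dim (f ` H)"
        using lin inj by (simp add: dim_image_eq inj_on_subset)
    qed (use H sub in auto)
    have Pf: "?P (f x) = f (?P x)" for x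
      using closest_point_orthogonal_image[OF o H(1), of x] by (simp add: fH)
    have f0: "f y = 0 \<longleftrightarrow> y = 0" and fn: "norm (f y) = norm y" for y
      using o by (metis norm_eq_zero orthogonal_transformation_norm)+
    show "f ` D = D"
    proof (intro equalityI subsetI)
      fix y assume "y \<in> D"
      moreover obtain x where "y = f x" using o by (metis orthogonal_transformation_surj surjD)
      ultimately show "y \<in> f ` D" by (auto simp: D_def Pf f0 fn)
    qed (auto simp: D_def Pf f0 fn)
    show "T (f x) = f (T x)" if "x \<in> D" for x
      using that lin by (simp add: T_def D_def Pf f0 fn linear_cmul)
    show "inj_on f (space (restrict_space borel ?S))" using inj by (rule inj_on_subset) simp
    show B': "B \<in> sets (restrict_space borel ?S)" using B by (simp add: M_def)
    have Sb: "?S \<in> sets borel"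
      using closed_subspace[OF H(1)] by (intro borel_closed closed_Int) auto
    then have "B \<in> sets borel" "B \<subseteq> ?S"
      using B' by (auto simp: sets_restrict_space_iff)
    moreover have "f ` B = inv f -` B"
      using o by (simp add: bij_vimage_eq_inv_image orthogonal_transformation_bij bij_imp_bij_inv inv_inv_eq)
    moreover have "inv f \<in> borel_measurable borel"
      using orthogonal_transformation_inv[OF o] orthogonal_transformation_linear linear_borel_measurable
      by blast
    ultimately have "f ` B \<in> sets borel" using measurable_sets[of "inv f" borel borel B] by simp
    then show "f ` B \<in> sets (restrict_space borel ?S)"
      using Sb f(2) \<open>B \<subseteq> ?S\<close> by (auto simp: sets_restrict_space_iff)
  qed
  moreover have "prob_space M"
    unfolding M_def by (rule distr_uniform_measure_invariant(1)[OF D Tm])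
  ultimately show ?thesis
    unfolding rotation_invariant_prob_on_def by (intro exI[of _ M]) (auto simp: M_def)
qed

lemma proj_matrix_orthogonal_image:
  fixes f :: "real^'n \<Rightarrow> real^'n"
  assumes f: "orthogonal_transformation f" and H: "subspace H"
  shows "proj_matrix (f ` H) = matrix f ** proj_matrix H ** matrix (inv f)"
proof -
  have lin: "linear f" "linear (inv f)" "linear (closest_point H)"
    using f orthogonal_transformation_inv[OF f] H
    by (auto simp: orthogonal_transformation_linear linear_closest_point)
  have "closest_point (f ` H) = (f \<circ> closest_point H) \<circ> inv f"
  proof
    fix v
    have "v = f (inv f v)" using f by (simp add: orthogonal_transformation_surj surj_f_inv_f)
    then show "closest_point (f ` H) v = ((f \<circ> closest_point H) \<circ> inv f) v"
      using closest_point_orthogonal_image[OF f H, of "inv f v"] by simp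
  qed
  then show ?thesis
    using lin by (simp add: proj_matrix_def matrix_compose linear_compose)
qed

lemma orthogonal_image_measurable_grassmannian:
  fixes f :: "real^'n \<Rightarrow> real^'n"
  assumes f: "orthogonal_transformation f"
  shows "(`) f \<in> grassmannian_borel k \<rightarrow>\<^sub>M grassmannian_borel k"
  unfolding grassmannian_borel_def
proof (rule measurable_vimage_algebra2)
  let ?G = "vimage_algebra (grassmannian k) proj_matrix borel"
  have lin: "linear f" using f by (rule orthogonal_transformation_linear)
  have inj: "inj f" using f by (rule orthogonal_transformation_inj)
  show "(`) f \<in> space ?G \<rightarrow> grassmannian k"
    using lin inj by (auto simp: grassmannian_def linear_subspace_image dim_image_eq inj_on_subset)
  have "linear (\<lambda>A. matrix f ** A ** matrix (inv f))"
    by (rule linearI)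
      (simp_all add: vec_eq_iff matrix_matrix_mult_def sum.distrib sum_distrib_left sum_distrib_right
        algebra_simps)
  then have [measurable]: "(\<lambda>A. matrix f ** A ** matrix (inv f)) \<in> borel_measurable borel"
    by (rule linear_borel_measurable)
  have [measurable]: "proj_matrix \<in> ?G \<rightarrow>\<^sub>M borel"
    by (rule measurable_vimage_algebra1) simp
  have "(\<lambda>H. matrix f ** proj_matrix H ** matrix (inv f)) \<in> ?G \<rightarrow>\<^sub>M borel"
    by measurable
  then show "(\<lambda>H. proj_matrix (f ` H)) \<in> ?G \<rightarrow>\<^sub>M borel"
    by (rule measurable_cong[THEN iffD1, rotated])
      (simp add: grassmannian_def proj_matrix_orthogonal_image[OF f])
qed

lemma borel_measurable_vec_lambda:
  fixes F :: "'a \<Rightarrow> 'i::finite \<Rightarrow> 'b::euclidean_space"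
  assumes "\<And>i. (\<lambda>w. F w i) \<in> borel_measurable M"
  shows "(\<lambda>w. \<chi> i. F w i) \<in> borel_measurable M"
  using assms
  by (subst borel_measurable_euclidean_space)
    (auto simp: Basis_vec_def inner_axis intro!: borel_measurable_inner)

lemma rotation_invariant_prob_grassmannian_2_exists:
  assumes n: "CARD('n) \<ge> 2"
  shows "\<exists>M :: (real^'n) set measure. rotation_invariant_prob_grassmannian 2 M"
proof -
  let ?G = "grassmannian_borel 2 :: (real^'n) set measure"
  define z where "z x y = y - ((y \<bullet> x) / (x \<bullet> x)) *\<^sub>R x" for x y :: "real^'n"
  define ok where "ok w = (fst w \<noteq> 0 \<and> z (fst w) (snd w) \<noteq> 0)" for w :: "(real^'n) \<times> (real^'n)"
  define D where "D = {w \<in> ball 0 1. ok w}"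
  have orth: "z x y \<bullet> x = 0" "x \<bullet> z x y = 0" for x y
    by (simp_all add: z_def inner_diff_left inner_diff_right inner_commute[of x y])
  have span: "span {x, z x y} = span {x, y}" for x y
  proof (rule span_eq[THEN iffD2], intro conjI)
    show "{x, z x y} \<subseteq> span {x, y}"
      unfolding z_def by (auto intro: span_diff span_scale span_base)
    have "y = z x y + ((y \<bullet> x) / (x \<bullet> x)) *\<^sub>R x" by (simp add: z_def)
    moreover have "z x y + ((y \<bullet> x) / (x \<bullet> x)) *\<^sub>R x \<in> span {x, z x y}"
      by (intro span_add span_scale span_base) auto
    ultimately show "{x, y} \<subseteq> span {x, z x y}" by (auto intro: span_base)
  qed
  have sub2: "span {x, y} \<in> grassmannian 2" if "ok (x, y)" for x y
  proof -
    have ne: "x \<noteq> z x y" using that orth[of x y] by (auto simp: ok_def)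
    have "pairwise orthogonal {x, z x y}"
      using orth by (auto simp: pairwise_def orthogonal_def)
    then have "independent {x, z x y}"
      using that by (intro pairwise_orthogonal_independent) (auto simp: ok_def)
    then have "dim (span {x, z x y}) = 2"
      using ne by (simp add: dim_eq_card_independent)
    then show ?thesis by (simp add: grassmannian_def span)
  qed
  have opn: "open {w. ok w}"
  proof -
    have 1: "open {w :: (real^'n) \<times> (real^'n). fst w \<noteq> 0}"
      by (intro open_Collect_neq continuous_intros)
    have "{w. ok w} = {w. fst w \<noteq> 0} \<inter> (\<lambda>w. z (fst w) (snd w)) -` (- {0})"
      by (auto simp: ok_def)
    also have "open \<dots>"
      using 1 unfolding z_def
      by (intro continuous_open_preimage) (auto intro!: continuous_intros)
    finally show ?thesis .
  qed
  obtain i j :: 'n where ij: "i \<noteq> j"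
    using n by (metis card_2_iff' ex_card UNIV_I)
  have ok0: "ok (c *\<^sub>R axis i 1, c *\<^sub>R axis j 1)" if "c \<noteq> 0" for c
    using that ij by (simp add: ok_def z_def inner_axis_axis axis_eq_0_iff)
  have D: "open D" "bounded D" "D \<noteq> {}"
  proof -
    have "D = ball 0 1 \<inter> {w. ok w}" by (auto simp: D_def)
    then show "open D" using opn by auto
    show "bounded D" by (rule bounded_subset[of "ball 0 1"]) (auto simp: D_def)
    have "((1/2) *\<^sub>R axis i 1, (1/2) *\<^sub>R axis j 1) \<in> D"
      using ok0[of "1/2"]
      by (auto simp: D_def norm_Pair power2_eq_square real_sqrt_lt_1_iff)
    then show "D \<noteq> {}" by blast
  qed
  define T where "T w = (if ok w then span {fst w, snd w} else span {axis i 1, axis j (1::real)})"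
    for w :: "(real^'n) \<times> (real^'n)"
  have TG: "T w \<in> grassmannian 2" for w
    using sub2[of "fst w" "snd w"] sub2[of "axis i 1" "axis j 1"] ok0[of 1] by (auto simp: T_def)
  have zm [measurable]: "(\<lambda>w. z (fst w) (snd w)) \<in> borel_measurable borel"
    unfolding z_def borel_prod[symmetric] by measurable
  have okm [measurable]: "Measurable.pred borel ok"
    using opn by (simp add: pred_def)
  define Q where "Q w v = (v \<bullet> fst w / (fst w \<bullet> fst w)) *\<^sub>R fst w
      + (v \<bullet> z (fst w) (snd w) / (z (fst w) (snd w) \<bullet> z (fst w) (snd w))) *\<^sub>R z (fst w) (snd w)"
    for w :: "(real^'n) \<times> (real^'n)" and v
  have Q': "closest_point (span {fst w, z (fst w) (snd w)}) v = Q w v" if "ok w" for w v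
  proof (rule closest_point_subspace_eqI)
    let ?x = "fst w" and ?z = "z (fst w) (snd w)"
    show "Q w v \<in> span {?x, ?z}"
      unfolding Q_def by (intro span_add span_scale span_base) auto
    fix h assume "h \<in> span {?x, ?z}"
    moreover have "orthogonal (v - Q w v) y" if "y \<in> {?x, ?z}" for y
      using that \<open>ok w\<close> orth
      by (auto simp: orthogonal_def Q_def ok_def inner_diff_left inner_add_left)
    ultimately show "(v - Q w v) \<bullet> h = 0"
      using orthogonal_to_span[of h "{?x, ?z}" "v - Q w v"] by (simp add: orthogonal_def)
  qed simp
  have Q: "closest_point (span {fst w, snd w}) v = Q w v" if "ok w" for w v
    using Q'[OF that, of v] by (simp only: span)
  have [measurable]: "fst \<in> borel_measurable (borel :: ((real^'n) \<times> (real^'n)) measure)"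
    by (intro borel_measurable_continuous_onI continuous_intros)
  have Tm: "T \<in> borel \<rightarrow>\<^sub>M ?G"
    unfolding grassmannian_borel_def
  proof (rule measurable_vimage_algebra2)
    show "T \<in> space borel \<rightarrow> grassmannian 2" using TG by auto
    have "(\<lambda>w. if ok w then matrix (Q w) else proj_matrix (span {axis i 1, axis j 1}))
        \<in> borel_measurable borel"
    proof -
      note [measurable] = measurable_compose[OF _ borel_measurable_nth]
      have "(\<lambda>w. matrix (Q w)) \<in> borel_measurable borel"
        unfolding matrix_def
        by (intro borel_measurable_vec_lambda) (simp add: Q_def)
      then show ?thesis by measurable
    qed
    also have "(\<lambda>w. if ok w then matrix (Q w) else proj_matrix (span {axis i 1, axis j 1}))
        = (\<lambda>w. proj_matrix (T w))"
      using Q by (auto simp: T_def proj_matrix_def fun_eq_iff intro!: arg_cong[where f = matrix])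
    finally show "(\<lambda>w. proj_matrix (T w)) \<in> borel \<rightarrow>\<^sub>M borel" .
  qed
  define M where "M = distr (uniform_measure lborel D) ?G T"
  have "measure M ((`) f ` B) = measure M B" if f: "rotation f" and B: "B \<in> sets M" for f B
    unfolding M_def
  proof (rule distr_uniform_measure_invariant(2)[OF D Tm])
    have o: "orthogonal_transformation f" using f by (simp add: rotation_def)
    have lin: "linear f" using o by (rule orthogonal_transformation_linear)
    have inj: "inj f" using o by (rule orthogonal_transformation_inj)
    let ?g = "map_prod f f"
    show og: "orthogonal_transformation ?g"
      using o lin
      by (auto simp: orthogonal_transformation_def linear_iff inner_prod_def)
    have f0: "f y = 0 \<longleftrightarrow> y = 0" and fi: "f x \<bullet> f y = x \<bullet> y" for x y
      using o by (metis norm_eq_zero orthogonal_transformation_norm, simp add: orthogonal_transformation_def)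
    have zf: "z (f x) (f y) = f (z x y)" for x y
      using lin by (simp add: z_def fi linear_diff linear_cmul)
    have okg: "ok (?g w) = ok w" for w
      by (simp add: ok_def zf f0)
    have gn: "norm (?g w) = norm w" for w
      using og by (rule orthogonal_transformation_norm)
    show "?g ` D = D"
    proof
      show "?g ` D \<subseteq> D" by (rule image_subsetI) (simp add: D_def okg gn)
      show "D \<subseteq> ?g ` D"
      proof
        fix y assume y: "y \<in> D"
        obtain w where w: "y = ?g w" using og by (metis orthogonal_transformation_surj surjD)
        then have "w \<in> D" using y by (simp add: D_def okg gn)
        then show "y \<in> ?g ` D" unfolding w by (rule imageI)
      qed
    qed
    show "T (?g w) = f ` T w" if "w \<in> D" for w
      using that linear_span_image[OF lin, of "{fst w, snd w}"] by (simp add: T_def D_def okg)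
    show "inj_on ((`) f) (space ?G)"
      using inj by (auto simp: inj_on_def inj_image_eq_iff)
    show B': "B \<in> sets ?G" using B by (simp add: M_def)
    note oi = orthogonal_transformation_inv[OF o]
    have iff: "inv f ` f ` H = H" "f ` inv f ` H = H" for H
      using inj orthogonal_transformation_surj[OF o] by (simp_all add: image_f_inv_f image_inv_f_f)
    have "(`) f ` B = (`) (inv f) -` B \<inter> space ?G"
    proof (intro equalityI subsetI)
      fix K assume "K \<in> (`) f ` B"
      then show "K \<in> (`) (inv f) -` B \<inter> space ?G"
        using sets.sets_into_space[OF B'] iff
          measurable_space[OF orthogonal_image_measurable_grassmannian[OF o, of 2]] by auto
    next
      fix K assume "K \<in> (`) (inv f) -` B \<inter> space ?G"
      then show "K \<in> (`) f ` B" using iff(2)[of K] by (metis IntD1 imageI vimageD)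
    qed
    then show "(`) f ` B \<in> sets ?G"
      using measurable_sets[OF orthogonal_image_measurable_grassmannian[OF oi] B'] by simp
  qed
  moreover have "prob_space M"
    unfolding M_def by (rule distr_uniform_measure_invariant(1)[OF D Tm])
  ultimately show ?thesis
    unfolding rotation_invariant_prob_grassmannian_def by (intro exI[of _ M]) (auto simp: M_def)
qed

end

theory Submission
  imports Defs
begin

text \<open>
  Let \<open>X(H)\<close> be the proportion of the great circle \<open>S \<inter> H\<close> that lies in \<open>A\<close>. Put \<open>t = 2\<close> to the power
  \<open>-1/3\<close>, so that \<open>t\<^sup>3 = 1/2\<close>. By Chebyshev's inequality the probability that \<open>2 X - 1\<close> is at least \<open>t\<close>
  in absolute value is at most the second moment of \<open>2 X - 1\<close> divided by \<open>t\<^sup>2\<close>, and this is at most \<open>t\<close>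
  as soon as the second moment is at most \<open>1/2\<close> (\<open>circle_mean_second_moment\<close>).

  The second moment is the value at \<open>f = 2 * indicator A - 1\<close> of the quadratic form
  \<open>circle_form f f\<close>, the expectation of the squared mean of \<open>f\<close> over a random great circle. This is
  \<open>\<langle>f, T f\<rangle>\<close> for the operator \<open>T\<close> that replaces the value at \<open>x\<close> by the average over a random great circle
  through \<open>x\<close>. Since \<open>f\<close> has mean \<open>0\<close> and norm \<open>1\<close>, it is enough that \<open>T\<close> has no eigenvalue above \<open>1/2\<close>
  apart from the eigenvalue \<open>1\<close> on the constants. The classical eigenspaces are the spherical
  harmonics, but their theory can be avoided by working with the powers \<open>(x \<bullet> u) ^ m\<close>.

  Odd powers have mean \<open>0\<close> on every great circle. For an even power, the mean over \<open>S \<inter> H\<close> is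
  \<open>\<gamma> k * |P u| ^ (2 * k)\<close>, where \<open>P\<close> is the projection onto \<open>H\<close> and \<open>\<gamma> k\<close> is the mean of the
  \<open>2 k\<close>-th power of the cosine. If \<open>x\<close>, \<open>v\<close> is an orthonormal basis of \<open>H\<close>, then
  \<open>|P u|\<^sup>2 = (x \<bullet> u)\<^sup>2 + (v \<bullet> u)\<^sup>2\<close>. Given \<open>x\<close>, the direction \<open>v\<close> is uniform on the sphere of the orthogonal
  complement of \<open>x\<close>, so averaging over \<open>v\<close> turns \<open>|P u| ^ (2 * k)\<close> into a polynomial of degree \<open>k\<close> in
  \<open>(x \<bullet> u)\<^sup>2\<close> (\<open>circle_form_even_power\<close>). Thus \<open>T\<close> is triangular on the even powers of \<open>x \<bullet> u\<close>. The diagonal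
  entry at \<open>k\<close> is \<open>\<gamma> k\<close> times the expectation of \<open>(1 - s\<^sup>2) ^ k\<close>, where \<open>s\<close> is a coordinate of \<open>v\<close>. It is
  strictly decreasing in \<open>k\<close> if the dimension is at least 3, equals \<open>1\<close> for \<open>k = 0\<close>, and is at most
  \<open>\<gamma> 1 = 1/2\<close> for \<open>k > 0\<close>. As the diagonal entries are distinct, every power of \<open>x \<bullet> u\<close> is a finite sum of
  eigenfunctions (\<open>eigen_decomposable_inner_power\<close>), and eigenfunctions for different eigenvalues are
  orthogonal because the form is symmetric. This gives
  \<open>circle_form p p \<le> (mean of p)\<^sup>2 + 1/2 * \<parallel>p\<parallel>\<^sup>2\<close> for all linear combinations \<open>p\<close> of such powers. They are
  dense in the square norm, because by the Stone-Weierstrass theorem already the span of the functions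
  \<open>exp (x \<bullet> u)\<close> is, so the inequality holds for \<open>f\<close>. In dimension 2 there is only one plane and
  \<open>X = 1/2\<close>.

  The measures are given by their invariance only. They are made explicit by a uniqueness theorem
  (\<open>invariant_prob_unique\<close>): two probability measures that are invariant under a transitive group of
  isometries agree. So the uniform distribution on \<open>S \<inter> H\<close> is that of \<open>P z / |P z|\<close> with \<open>z\<close>
  uniform in a ball, which also makes all means measurable in \<open>H\<close>. In the same way, choosing first
  a random plane and then a random orthonormal basis in it has the same effect as choosing a random
  orthonormal pair (\<open>frame_law\<close>).
\<close>

section \<open>Uniqueness of invariant measures\<close>

text \<open>
  Countably many balls of radius \<open>r/2\<close> cover the space. If balls of radius \<open>r\<close> centred in \<open>X\<close> were
  null sets, then so would be each of those small balls that meet \<open>X\<close>, and hence \<open>X\<close>.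
\<close>

lemma uniformly_distributed_ball_pos:
  fixes N :: "'a::{second_countable_topology, metric_space} measure"
  assumes N: "prob_space N" "sets N = sets borel" "AE x in N. x \<in> X"
    and unif: "\<And>x y r. x \<in> X \<Longrightarrow> y \<in> X \<Longrightarrow> emeasure N (ball x r) = emeasure N (ball y r)"
    and x: "x \<in> X" and r: "r > 0"
  shows "emeasure N (ball x r) > 0"
proof (rule ccontr)
  assume "\<not> ?thesis"
  then have null: "emeasure N (ball y r) = 0" if "y \<in> X" for y
    using unif[OF x that, of r] by simp
  obtain D :: "'a set" where D: "countable D" "\<And>W. open W \<Longrightarrow> W \<noteq> {} \<Longrightarrow> \<exists>d\<in>D. d \<in> W"
    using countable_dense_exists[where 'a = 'a] by metis
  interpret prob_space N by fact
  have "AE y in N. y \<notin> ball d (r/2) \<or> y \<notin> X" if "d \<in> D" for d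
  proof (cases "\<exists>y\<in>X. y \<in> ball d (r/2)")
    case True
    then obtain y where y: "y \<in> X" "dist d y < r/2" by auto
    have "ball d (r/2) \<subseteq> ball y r"
    proof
      fix z assume "z \<in> ball d (r/2)"
      then show "z \<in> ball y r"
        using y(2) dist_triangle[of y z d] by (simp add: dist_commute)
    qed
    moreover have "ball y r \<in> null_sets N"
      using null[OF y(1)] N(2) by (auto simp: null_sets_def)
    moreover have "ball d (r/2) \<in> sets N"
      using N(2) by simp
    ultimately have "ball d (r/2) \<in> null_sets N"
      using null_sets_subset by blast
    then have "AE z in N. z \<notin> ball d (r/2)"
      by (rule AE_not_in)
    then show ?thesis by (rule eventually_mono) simp
  next
    case False
    then show ?thesis by (intro AE_I2) blast
  qed
  then have "AE y in N. \<forall>d\<in>D. y \<notin> ball d (r/2) \<or> y \<notin> X"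
    using D(1) by (intro AE_ball_countable')
  with N(3) have "AE y in N. False"
  proof eventually_elim
    case (elim y)
    obtain d where "d \<in> D" "d \<in> ball y (r/2)" using D(2)[of "ball y (r/2)"] r by auto
    then show ?case using elim by (auto simp: dist_commute)
  qed
  then show False by simp
qed

text \<open>
  Both sides estimate the \<open>M \<Otimes> N\<close>-measure of the pairs \<open>(x, y)\<close> at distance less than \<open>r\<close>: on the left
  only those with the whole ball around \<open>x\<close> inside \<open>W\<close> are counted, on the right all those with
  \<open>y \<in> W\<close>. Fubini's theorem and the uniformity of the measure of balls evaluate the two integrals.
\<close>

lemma uniformly_distributed_compare:
  fixes M N :: "'a::{second_countable_topology, metric_space} measure"
  assumes M: "prob_space M" "sets M = sets borel" "AE x in M. x \<in> X"
    and N: "prob_space N" "sets N = sets borel" "AE x in N. x \<in> X"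
    and unifM: "\<And>x y r. x \<in> X \<Longrightarrow> y \<in> X \<Longrightarrow> emeasure M (ball x r) = emeasure M (ball y r)"
    and unifN: "\<And>x y r. x \<in> X \<Longrightarrow> y \<in> X \<Longrightarrow> emeasure N (ball x r) = emeasure N (ball y r)"
    and x0: "x0 \<in> X" and W: "open W"
  shows "emeasure M {x. ball x r \<subseteq> W} * emeasure N (ball x0 r)
      \<le> emeasure N W * emeasure M (ball x0 r)"
proof -
  interpret M: prob_space M by fact
  interpret N: prob_space N by fact
  note [measurable_cong] = M(2) N(2)
  interpret P: pair_sigma_finite M N ..
  have rel [measurable]: "Measurable.pred (M \<Otimes>\<^sub>M N) (\<lambda>z. dist (fst z) (snd z) < r)" for r
    by measurable
  have rel' [measurable]: "Measurable.pred (borel \<Otimes>\<^sub>M borel) (\<lambda>z::'a\<times>'a. dist (fst z) (snd z) < r)" for r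
    by measurable
  have "- {x. ball x r \<subseteq> W} = (\<Union>y\<in>-W. ball y r)"
    by (auto simp: dist_commute subset_eq)
  then have "closed {x. ball x r \<subseteq> W}" by (auto simp: closed_def)
  then have [measurable]: "{x. ball x r \<subseteq> W} \<in> sets borel" by simp
  have [measurable]: "W \<in> sets borel" using W by simp
  let ?d = "\<lambda>x y. indicator {z. dist (fst z) (snd z) < r} (x, y) :: ennreal"
  have mM: "(\<integral>\<^sup>+x. ?d x y \<partial>M) = emeasure M (ball y r)" for y
  proof -
    have "(\<integral>\<^sup>+x. ?d x y \<partial>M) = (\<integral>\<^sup>+x. indicator (ball y r) x \<partial>M)"
      by (intro nn_integral_cong) (auto simp: indicator_def dist_commute)
    then show ?thesis by simp
  qed
  have mN: "(\<integral>\<^sup>+y. ?d x y \<partial>N) = emeasure N (ball x r)" for x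
  proof -
    have "(\<integral>\<^sup>+y. ?d x y \<partial>N) = (\<integral>\<^sup>+y. indicator (ball x r) y \<partial>N)"
      by (intro nn_integral_cong) (auto simp: indicator_def)
    then show ?thesis by simp
  qed
  have "emeasure M {x. ball x r \<subseteq> W} * emeasure N (ball x0 r)
      = (\<integral>\<^sup>+x. indicator {x. ball x r \<subseteq> W} x * emeasure N (ball x0 r) \<partial>M)"
    by (simp add: nn_integral_multc)
  also have "\<dots> = (\<integral>\<^sup>+x. indicator {x. ball x r \<subseteq> W} x * emeasure N (ball x r) \<partial>M)"
    using M(3) by (intro nn_integral_cong_AE) (auto elim!: eventually_mono simp: unifN[OF x0])
  also have "\<dots> = (\<integral>\<^sup>+x. \<integral>\<^sup>+y. indicator {x. ball x r \<subseteq> W} x * ?d x y \<partial>N \<partial>M)"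
    by (subst nn_integral_cmult) (auto simp: mN)
  also have "\<dots> \<le> (\<integral>\<^sup>+x. \<integral>\<^sup>+y. indicator W y * ?d x y \<partial>N \<partial>M)"
    by (intro nn_integral_mono) (auto simp: indicator_def)
  also have "\<dots> = (\<integral>\<^sup>+y. \<integral>\<^sup>+x. indicator W y * ?d x y \<partial>M \<partial>N)"
    by (rule P.Fubini'[symmetric]) measurable
  also have "\<dots> = (\<integral>\<^sup>+y. indicator W y * emeasure M (ball y r) \<partial>N)"
    by (subst nn_integral_cmult) (auto simp: mM)
  also have "\<dots> = (\<integral>\<^sup>+y. indicator W y * emeasure M (ball x0 r) \<partial>N)"
    using N(3) by (intro nn_integral_cong_AE) (auto elim!: eventually_mono simp: unifM[OF x0])
  also have "\<dots> = emeasure N W * emeasure M (ball x0 r)"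
    by (simp add: nn_integral_multc)
  finally show ?thesis .
qed

text \<open>
  The open set is the increasing union of the sets of centres of balls of radius \<open>1/(n+1)\<close> inside it.
\<close>

lemma uniformly_distributed_open_le:
  fixes M N :: "'a::{second_countable_topology, metric_space} measure"
  assumes M: "prob_space M" "sets M = sets borel" "AE x in M. x \<in> X"
    and N: "prob_space N" "sets N = sets borel" "AE x in N. x \<in> X"
    and unifM: "\<And>x y r. x \<in> X \<Longrightarrow> y \<in> X \<Longrightarrow> emeasure M (ball x r) = emeasure M (ball y r)"
    and unifN: "\<And>x y r. x \<in> X \<Longrightarrow> y \<in> X \<Longrightarrow> emeasure N (ball x r) = emeasure N (ball y r)"
    and U: "open U"
  shows "emeasure M U \<le> emeasure N U"
proof -
  interpret M: prob_space M by fact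
  interpret N: prob_space N by fact
  obtain x0 where x0: "x0 \<in> X"
    using M(3) M.AE_const by (metis (no_types, lifting) M.AE_False eventually_mono)
  have le: "emeasure M {x. ball x r \<subseteq> U} \<le> emeasure N U" if r: "r > 0" for r
  proof -
    \<comment> \<open>Comparing on the whole space with the roles of the two measures exchanged shows that balls of
        \<open>M\<close> are at most as large as those of \<open>N\<close>.\<close>
    have "emeasure M (ball x0 r) \<le> emeasure N (ball x0 r)"
      using uniformly_distributed_compare[OF N M unifN unifM x0 open_UNIV, of r]
        M.emeasure_space_1 N.emeasure_space_1 sets_eq_imp_space_eq[OF M(2)] sets_eq_imp_space_eq[OF N(2)]
      by simp
    then have "emeasure N (ball x0 r) * emeasure M {x. ball x r \<subseteq> U}
        \<le> emeasure N (ball x0 r) * emeasure N U"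
      using uniformly_distributed_compare[OF M N unifM unifN x0 U, of r]
      by (metis mult.commute mult_left_mono order_trans zero_le)
    moreover have "emeasure N (ball x0 r) > 0"
      using uniformly_distributed_ball_pos[OF N unifN x0 r] .
    ultimately show ?thesis
      using N.emeasure_finite[of "ball x0 r"]
      by (subst (asm) ennreal_mult_le_mult_iff) (auto simp: less_top)
  qed
  let ?U = "\<lambda>n. {x. ball x (inverse (real (Suc n))) \<subseteq> U}"
  have "U = (\<Union>n. ?U n)"
  proof safe
    fix x assume "x \<in> U"
    then obtain e where "e > 0" "ball x e \<subseteq> U" using U openE by blast
    moreover obtain n where "inverse (real (Suc n)) < e" using \<open>e > 0\<close> reals_Archimedean by blast
    ultimately have "ball x (inverse (real (Suc n))) \<subseteq> U"
      by (meson less_imp_le order_trans subset_ball)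
    then show "x \<in> (\<Union>n. ?U n)" by blast
  next
    fix x n assume "ball x (inverse (real (Suc n))) \<subseteq> U"
    then show "x \<in> U" by (meson centre_in_ball in_mono inverse_positive_iff_positive of_nat_0_less_iff zero_less_Suc)
  qed
  moreover have "incseq ?U"
  proof (rule incseq_SucI)
    fix n
    have "ball x (inverse (real (Suc (Suc n)))) \<subseteq> ball x (inverse (real (Suc n)))" for x :: 'a
      by (intro subset_ball le_imp_inverse_le) auto
    then show "?U n \<subseteq> ?U (Suc n)" by blast
  qed
  moreover have "?U n \<in> sets M" for n
  proof -
    have "- ?U n = (\<Union>y\<in>-U. ball y (inverse (real (Suc n))))"
      by (auto simp: dist_commute subset_eq)
    then have "closed (?U n)" by (auto simp: closed_def)
    then show ?thesis using M(2) by simp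
  qed
  ultimately have "emeasure M U = (SUP n. emeasure M (?U n))"
    by (subst SUP_emeasure_incseq) auto
  also have "\<dots> \<le> emeasure N U"
    by (intro SUP_least le) simp
  finally show ?thesis .
qed

text \<open>
  A transitive group of isometries moves any ball centred in \<open>X\<close> to any other of the same radius, so an
  invariant measure is uniformly distributed in the sense of the preceding lemmas. Compactness
  and a Haar measure on the group are avoided in this way.
\<close>

lemma invariant_prob_unique:
  fixes M N :: "'a::{second_countable_topology, metric_space} measure"
  assumes M: "prob_space M" "sets M = sets borel" "AE x in M. x \<in> X"
    and N: "prob_space N" "sets N = sets borel" "AE x in N. x \<in> X"
    and iso: "\<And>g x y. g \<in> G \<Longrightarrow> dist (g x) (g y) = dist x y"
    and trans: "\<And>x y. x \<in> X \<Longrightarrow> y \<in> X \<Longrightarrow> \<exists>g\<in>G. g x = y"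
    and invM: "\<And>g. g \<in> G \<Longrightarrow> distr M borel g = M"
    and invN: "\<And>g. g \<in> G \<Longrightarrow> distr N borel g = N"
  shows "M = N"
proof -
  have unif: "emeasure K (ball x r) = emeasure K (ball y r)"
    if K: "sets K = sets borel" "\<And>g. g \<in> G \<Longrightarrow> distr K borel g = K" and xy: "x \<in> X" "y \<in> X"
    for K :: "'a measure" and x y r
  proof -
    obtain g where g: "g \<in> G" "g x = y" using trans[OF xy] by blast
    have "continuous_on UNIV g"
      using iso[OF g(1)] by (auto simp: continuous_on_iff)
    then have "g \<in> borel_measurable K"
      using K(1) borel_measurable_continuous_onI measurable_cong_sets by blast
    then have "emeasure (distr K borel g) (ball y r) = emeasure K (g -` ball y r \<inter> space K)"
      by (rule emeasure_distr) simp
    also have "g -` ball y r \<inter> space K = ball x r"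
      using iso[OF g(1)] g(2) sets_eq_imp_space_eq[OF K(1)] by auto
    finally show ?thesis using K(2)[OF g(1)] by simp
  qed
  show ?thesis
  proof (rule measure_eqI_generator_eq[where E = "{S. open S}" and \<Omega> = UNIV and A = "\<lambda>_. UNIV"])
    show "Int_stable {S :: 'a set. open S}" by (auto simp: Int_stable_def)
    show "sets M = sigma_sets UNIV {S. open S}" "sets N = sigma_sets UNIV {S. open S}"
      using M(2) N(2) by (simp_all add: borel_def)
    show "emeasure M UNIV \<noteq> \<infinity>" for i :: nat
      using finite_measure.emeasure_finite[OF prob_space.finite_measure[OF M(1)]] by auto
    show "emeasure M S = emeasure N S" if "S \<in> {S. open S}" for S
      using that
      by (intro antisym uniformly_distributed_open_le[OF M N unif[OF M(2) invM] unif[OF N(2) invN]]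
          uniformly_distributed_open_le[OF N M unif[OF N(2) invN] unif[OF M(2) invM]]) auto
  qed auto
qed


section \<open>Reflections and rotations\<close>

definition hyperplane_reflection :: "'a::real_inner \<Rightarrow> 'a \<Rightarrow> 'a" where
  "hyperplane_reflection a x = x - (2 * (x \<bullet> a) / (a \<bullet> a)) *\<^sub>R a"

lemma hyperplane_reflection_orthogonal:
  "orthogonal_transformation (hyperplane_reflection a)"
  unfolding orthogonal_transformation_def
proof (intro conjI allI)
  show "linear (hyperplane_reflection a)"
    by (rule linearI)
      (simp_all add: hyperplane_reflection_def algebra_simps inner_add_left add_divide_distrib)
  fix v w
  show "hyperplane_reflection a v \<bullet> hyperplane_reflection a w = v \<bullet> w"
  proof (cases "a = 0")
    case False
    define c where "c = 2 * (v \<bullet> a) / (a \<bullet> a)"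
    define d where "d = 2 * (w \<bullet> a) / (a \<bullet> a)"
    have "c * (a \<bullet> a) = 2 * (v \<bullet> a)" "c * (w \<bullet> a) = d * (v \<bullet> a)"
      using False by (simp_all add: c_def d_def)
    moreover have "hyperplane_reflection a v \<bullet> hyperplane_reflection a w
        = v \<bullet> w - d * (v \<bullet> a) - c * (w \<bullet> a) + d * (c * (a \<bullet> a))"
      unfolding hyperplane_reflection_def c_def[symmetric] d_def[symmetric]
      by (simp add: inner_diff_left inner_diff_right inner_commute algebra_simps)
    ultimately show ?thesis by simp
  qed (simp add: hyperplane_reflection_def)
qed

lemma hyperplane_reflection_fixes: "x \<bullet> a = 0 \<Longrightarrow> hyperplane_reflection a x = x"
  by (simp add: hyperplane_reflection_def)

lemma hyperplane_reflection_self: "hyperplane_reflection a a = - a"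
  by (cases "a = 0") (simp_all add: hyperplane_reflection_def scaleR_2)

lemma hyperplane_reflection_swap:
  assumes "norm x = norm y"
  shows "hyperplane_reflection (x - y) x = y"
proof (cases "x = y")
  case False
  have "x \<bullet> x = y \<bullet> y" using assms by (simp add: norm_eq)
  then have "(x - y) \<bullet> (x - y) = 2 * (x \<bullet> (x - y))"
    by (simp add: inner_diff_left inner_diff_right inner_commute)
  moreover have "(x - y) \<bullet> (x - y) \<noteq> 0" using False by simp
  ultimately have 1: "2 * (x \<bullet> (x - y)) / ((x - y) \<bullet> (x - y)) = 1" by simp
  show ?thesis unfolding hyperplane_reflection_def 1 by simp
qed (simp add: hyperplane_reflection_def)

lemma hyperplane_reflection_scaleR:
  "c \<noteq> 0 \<Longrightarrow> hyperplane_reflection (c *\<^sub>R a) = hyperplane_reflection a"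
  by (auto simp: hyperplane_reflection_def fun_eq_iff)

lemma orthogonal_image_subspace_eq:
  fixes f :: "'a::euclidean_space \<Rightarrow> 'a"
  assumes f: "orthogonal_transformation f" and K: "subspace K" and sub: "f ` K \<subseteq> K"
  shows "f ` K = K"
proof (rule subspace_dim_equal)
  have lin: "linear f" and inj: "inj f"
    using f by (auto simp: orthogonal_transformation_linear orthogonal_transformation_inj)
  show "subspace (f ` K)" using lin K by (simp add: linear_subspace_image)
  show "dim K \<le> dim (f ` K)" using lin inj by (simp add: dim_image_eq inj_on_subset)
qed (use K sub in auto)

lemma hyperplane_reflection_image:
  fixes a :: "'a::euclidean_space"
  assumes K: "subspace K" and a: "a \<in> K"
  shows "hyperplane_reflection a ` K = K"
  using K a
  by (intro orthogonal_image_subspace_eq hyperplane_reflection_orthogonal)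
    (auto simp: hyperplane_reflection_def subspace_diff subspace_scale)

text \<open>
  All reflections are conjugate under orthogonal maps, which reduces the claim to a coordinate
  reflection, whose matrix is diagonal.
\<close>

lemma det_hyperplane_reflection:
  fixes a :: "real^'n"
  assumes a: "a \<noteq> 0"
  shows "det (matrix (hyperplane_reflection a)) = - 1"
proof -
  let ?R = "hyperplane_reflection :: real^'n \<Rightarrow> _"
  fix k :: 'n
  let ?e = "axis k 1 :: real^'n"
  obtain f where f: "orthogonal_transformation f" "f ?e = a /\<^sub>R norm a"
    using orthogonal_transformation_exists[of ?e "a /\<^sub>R norm a"] a by auto
  note lin = orthogonal_transformation_linear[OF f(1)]
    orthogonal_transformation_linear[OF hyperplane_reflection_orthogonal]
  have "f \<circ> ?R ?e = ?R (f ?e) \<circ> f"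
    using f(1) lin(1)
    by (auto simp: fun_eq_iff hyperplane_reflection_def orthogonal_transformation_def
        linear_diff linear_cmul)
  then have "matrix f ** matrix (?R ?e) = matrix (?R (f ?e)) ** matrix f"
    using matrix_compose[OF lin(2)[of ?e] lin(1)] matrix_compose[OF lin(1) lin(2)[of "f ?e"]] by simp
  then have "det (matrix f) * det (matrix (?R ?e)) = det (matrix (?R (f ?e))) * det (matrix f)"
    unfolding det_mul[symmetric] by simp
  moreover have "det (matrix f) \<noteq> 0"
    using orthogonal_transformation_det[OF f(1)] by auto
  ultimately have "det (matrix (?R (f ?e))) = det (matrix (?R ?e))" by simp
  moreover have "?R (f ?e) = ?R a"
    unfolding f(2) using a by (intro hyperplane_reflection_scaleR) simp
  moreover have "det (matrix (?R ?e)) = - 1"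
  proof -
    let ?D = "matrix (?R ?e)"
    have D: "?D $ i $ j = (if i = j then (if i = k then - 1 else 1) else 0)" for i j
      by (simp add: matrix_def hyperplane_reflection_def inner_axis_axis) (simp add: axis_def)
    then have "det ?D = (\<Prod>i\<in>UNIV. ?D $ i $ i)"
      by (intro det_diagonal) simp
    also have "\<dots> = (\<Prod>i\<in>UNIV. if i = k then - 1 else 1)"
      by (simp add: D)
    also have "\<dots> = - 1"
      by (subst prod.delta) auto
    finally show ?thesis .
  qed
  ultimately show ?thesis by simp
qed

text \<open>
  Two reflections suffice: the first carries \<open>x\<close> to \<open>x'\<close>; the second carries the image of \<open>v\<close> to \<open>v'\<close> in
  a direction orthogonal to \<open>x'\<close>. Both mirror directions lie in every subspace that contains the
  four vectors, so such a subspace is preserved.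
\<close>

lemma orthogonal_frame_map:
  fixes x v x' v' :: "'a::euclidean_space"
  assumes xv: "norm x = 1" "norm v = 1" "x \<bullet> v = 0"
    and xv': "norm x' = 1" "norm v' = 1" "x' \<bullet> v' = 0"
  obtains f where "orthogonal_transformation f" "f x = x'" "f v = v'"
    "\<And>K. subspace K \<Longrightarrow> {x, v, x', v'} \<subseteq> K \<Longrightarrow> f ` K = K"
proof -
  define f where "f = hyperplane_reflection (x - x')"
  define w where "w = f v"
  define g where "g = hyperplane_reflection (w - v')"
  have of: "orthogonal_transformation f" and og: "orthogonal_transformation g"
    by (simp_all add: f_def g_def hyperplane_reflection_orthogonal)
  have fx: "f x = x'" using xv xv' by (simp add: f_def hyperplane_reflection_swap)
  have "norm w = norm v'" using of xv xv' by (simp add: w_def orthogonal_transformation_norm)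
  then have gw: "g w = v'" by (simp add: g_def hyperplane_reflection_swap)
  have "x' \<bullet> w = 0"
    using of xv(3) fx unfolding w_def by (metis orthogonal_transformation_def)
  then have gx: "g x' = x'"
    using xv' by (simp add: g_def hyperplane_reflection_fixes inner_diff_right)
  show ?thesis
  proof (rule that[of "g \<circ> f"])
    show "orthogonal_transformation (g \<circ> f)"
      using of og by (simp add: orthogonal_transformation_compose)
    show "(g \<circ> f) x = x'" "(g \<circ> f) v = v'"
      using fx gx gw by (simp_all add: w_def)
    fix K assume K: "subspace K" "{x, v, x', v'} \<subseteq> K"
    have fK: "f ` K = K"
      unfolding f_def using K by (intro hyperplane_reflection_image) (auto simp: subspace_diff)
    then have "w \<in> K" using K by (auto simp: w_def)
    then have "g ` K = K"
      unfolding g_def using K by (intro hyperplane_reflection_image) (auto simp: subspace_diff)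
    then show "(g \<circ> f) ` K = K" unfolding image_comp[symmetric] fK .
  qed
qed

text \<open>
  A wrong determinant is corrected by the reflection along \<open>v'\<close>. This is where the sign comes from;
  in dimension 2 it cannot be avoided.
\<close>

lemma rotation_frame_map:
  fixes x v x' v' :: "real^'n"
  assumes xv: "norm x = 1" "norm v = 1" "x \<bullet> v = 0"
    and xv': "norm x' = 1" "norm v' = 1" "x' \<bullet> v' = 0"
  obtains g where "rotation g" "g x = x'" "g v = v' \<or> g v = - v'"
    "\<And>K. subspace K \<Longrightarrow> {x, v, x', v'} \<subseteq> K \<Longrightarrow> g ` K = K"
proof -
  obtain f where f: "orthogonal_transformation f" "f x = x'" "f v = v'"
    "\<And>K. subspace K \<Longrightarrow> {x, v, x', v'} \<subseteq> K \<Longrightarrow> f ` K = K"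
    using orthogonal_frame_map[OF assms] by metis
  show ?thesis
  proof (cases "det (matrix f) = 1")
    case True
    then show ?thesis using f that[of f] by (simp add: rotation_def)
  next
    case False
    then have det: "det (matrix f) = - 1"
      using orthogonal_transformation_det[OF f(1)] by linarith
    let ?r = "hyperplane_reflection v'"
    note o = hyperplane_reflection_orthogonal[of v']
    have "v' \<noteq> 0" using xv' by auto
    then have "det (matrix (?r \<circ> f)) = 1"
      using det f(1) o
      by (simp add: matrix_compose orthogonal_transformation_linear det_mul det_hyperplane_reflection)
    then show ?thesis
    proof (intro that[of "?r \<circ> f"])
      show "rotation (?r \<circ> f)" if "det (matrix (?r \<circ> f)) = 1"
        using that f(1) o by (simp add: rotation_def orthogonal_transformation_compose)
      show "(?r \<circ> f) x = x'" "(?r \<circ> f) v = v' \<or> (?r \<circ> f) v = - v'"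
        using f xv' by (simp_all add: hyperplane_reflection_fixes hyperplane_reflection_self)
      fix K assume K: "subspace K" "{x, v, x', v'} \<subseteq> K"
      have "?r ` (f ` K) = K"
        using f(4)[OF K] hyperplane_reflection_image[OF K(1), of v'] K(2) by simp
      then show "(?r \<circ> f) ` K = K" by (simp only: image_comp)
    qed
  qed
qed

lemma exists_orthonormal_in_subspace:
  fixes H :: "'a::euclidean_space set"
  assumes H: "subspace H" "dim H \<ge> 2"
  obtains v where "v \<in> H" "norm v = 1" "x \<bullet> v = 0"
proof -
  obtain p where p: "p = closest_point H x" by blast
  have pH: "p \<in> H" using closest_point_subspace[OF H(1)] p by blast
  have "span {p} \<subseteq> span H" using pH by (simp add: span_mono)
  moreover have "dim (span {p}) \<le> 1" by (simp add: dim_singleton)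
  then have "dim (span {p}) < dim (span H)" using H(2) by simp
  then have "span {p} \<noteq> span H" by (metis less_irrefl)
  ultimately have "span {p} \<subset> span H" by blast
  then obtain y where y: "y \<noteq> 0" "y \<in> span H" "\<And>z. z \<in> span {p} \<Longrightarrow> orthogonal y z"
    by (rule orthogonal_to_subspace_exists_gen) blast
  have yH: "y \<in> H" using y(2) H(1) by (simp add: span_eq_iff[THEN iffD2])
  have "p \<bullet> y = 0" using y(3)[of p] by (simp add: orthogonal_def span_base inner_commute)
  then have "x \<bullet> y = 0"
    using closest_point_subspace(2)[OF H(1) yH, of x] p by (simp add: inner_diff_left)
  then show ?thesis
    using that[of "y /\<^sub>R norm y"] y(1) yH H(1) by (simp add: subspace_scale)
qed


section \<open>The uniform distribution on a ball and its radial projections\<close>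

text \<open>
  A ball, instead of the sphere itself, is used as the source of randomness: its measure is given by
  Lebesgue measure, so proper subspaces are null sets, and it is invariant under orthogonal maps.
\<close>

definition ball_uniform :: "'a::euclidean_space measure" where
  "ball_uniform = uniform_measure lborel (ball 0 1)"

lemma sets_ball_uniform [measurable_cong, simp]: "sets ball_uniform = sets borel"
  by (simp add: ball_uniform_def)

lemma space_ball_uniform [simp]: "space ball_uniform = UNIV"
  by (simp add: ball_uniform_def)

lemma prob_space_ball_uniform: "prob_space (ball_uniform :: 'a::euclidean_space measure)"
  unfolding ball_uniform_def
proof (rule prob_space_uniform_measure)
  have "\<not> negligible (ball (0::'a) 1)" using open_not_negligible[of "ball (0::'a) 1"] by simp
  then show "emeasure lborel (ball (0::'a) 1) \<noteq> 0"
    by (auto simp: negligible_iff_null_sets null_sets_def)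
  show "emeasure lborel (ball (0::'a) 1) \<noteq> \<infinity>"
    using emeasure_lborel_ball_finite[of "0::'a" 1] by auto
qed

interpretation ball_uniform: prob_space "ball_uniform :: 'a::euclidean_space measure"
  by (rule prob_space_ball_uniform)

lemma distr_ball_uniform_orthogonal:
  fixes f :: "'a::euclidean_space \<Rightarrow> 'a"
  assumes f: "orthogonal_transformation f"
  shows "distr ball_uniform borel f = ball_uniform"
proof (rule measure_eqI)
  have [measurable]: "f \<in> borel_measurable borel"
    using f orthogonal_transformation_linear linear_borel_measurable by blast
  fix A :: "'a set" assume "A \<in> sets (distr ball_uniform borel f)"
  then have [measurable]: "A \<in> sets borel" by simp
  have eq: "ball 0 1 \<inter> f -` A = f -` (ball 0 1 \<inter> A)"
    using f by (auto simp: orthogonal_transformation_norm)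
  have "f -` A \<in> sets borel" using measurable_sets[of f borel borel A] by simp
  then have "emeasure (distr ball_uniform borel f) A
      = emeasure lborel (ball 0 1 \<inter> f -` A) / emeasure lborel (ball (0::'a) 1)"
    by (simp add: emeasure_distr ball_uniform_def emeasure_uniform_measure)
  also have "emeasure lborel (ball 0 1 \<inter> f -` A) = emeasure (distr lborel borel f) (ball 0 1 \<inter> A)"
    unfolding eq by (simp add: emeasure_distr)
  finally show "emeasure (distr ball_uniform borel f) A = emeasure ball_uniform A"
    by (simp add: lborel_distr_orthogonal[OF f] ball_uniform_def emeasure_uniform_measure)
qed simp

lemma integral_ball_uniform_orthogonal:
  fixes f :: "'a::euclidean_space \<Rightarrow> 'a" and h :: "'a \<Rightarrow> real"
  assumes f: "orthogonal_transformation f" and h: "h \<in> borel_measurable borel"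
  shows "(\<integral>z. h (f z) \<partial>ball_uniform) = (\<integral>z. h z \<partial>ball_uniform)"
proof -
  have "f \<in> borel_measurable borel"
    using f orthogonal_transformation_linear linear_borel_measurable by blast
  then have "(\<integral>z. h z \<partial>distr ball_uniform borel f) = (\<integral>z. h (f z) \<partial>ball_uniform)"
    using h by (intro integral_distr) auto
  then show ?thesis by (simp add: distr_ball_uniform_orthogonal[OF f])
qed

lemma AE_ball_uniform_inner_neq_0:
  fixes a :: "'a::euclidean_space"
  assumes "a \<noteq> 0"
  shows "AE z in ball_uniform. z \<bullet> a \<noteq> 0"
proof -
  have "negligible {z. a \<bullet> z = 0}" using assms by (intro negligible_hyperplane) auto
  then have "{z. a \<bullet> z = 0} \<in> null_sets lebesgue" by (simp add: negligible_iff_null_sets)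
  moreover have "{z. a \<bullet> z = 0} \<in> sets borel" by (intro borel_closed closed_hyperplane)
  ultimately have "{z. a \<bullet> z = 0} \<in> null_sets lborel"
    by (simp add: null_sets_def)
  then have "AE z in lborel. z \<notin> {z. a \<bullet> z = 0}" by (rule AE_not_in)
  then show ?thesis
    unfolding ball_uniform_def
    by (intro AE_uniform_measureI) (auto simp: inner_commute elim!: eventually_mono)
qed

lemma closest_point_subspace_inner:
  fixes H :: "'a::euclidean_space set"
  assumes "subspace H" "a \<in> H"
  shows "closest_point H z \<bullet> a = z \<bullet> a"
  using closest_point_subspace(2)[OF assms, of z] by (simp add: inner_diff_left)

lemma AE_closest_point_neq_0:
  fixes H :: "'a::euclidean_space set"
  assumes H: "subspace H" "a \<in> H" "a \<noteq> 0"
  shows "AE z in ball_uniform. closest_point H z \<noteq> 0"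
  using AE_ball_uniform_inner_neq_0[OF H(3)]
proof (rule eventually_mono)
  show "closest_point H z \<noteq> 0" if "z \<bullet> a \<noteq> 0" for z
    using that closest_point_subspace_inner[OF H(1,2), of z] by auto
qed

lemma borel_measurable_closest_point_subspace:
  fixes H :: "'a::euclidean_space set"
  assumes "subspace H"
  shows "closest_point H \<in> borel_measurable borel"
  using linear_closest_point[OF assms] by (rule linear_borel_measurable)

lemma orthogonal_transformation_sgn:
  fixes f :: "'a::real_inner \<Rightarrow> 'a"
  assumes "orthogonal_transformation f"
  shows "f (sgn x) = sgn (f x)"
  using assms
  by (simp add: sgn_div_norm orthogonal_transformation_norm linear_cmul orthogonal_transformation_linear)

text \<open>
  The case \<open>H = UNIV\<close> describes the uniform distribution on the whole sphere, the case of a plane that on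
  a great circle. The rotations that preserve \<open>H\<close> act transitively on its unit sphere
  because \<open>dim H \<ge> 2\<close> leaves room for a second direction in \<open>H\<close>.
\<close>

theorem invariant_prob_on_subsphere_unique:
  fixes H :: "(real^'n) set"
  assumes H: "subspace H" "dim H \<ge> 2"
    and M: "rotation_invariant_prob_on (sphere 0 1 \<inter> H) M"
  shows "distr M borel (\<lambda>x. x) = distr ball_uniform borel (\<lambda>z. sgn (closest_point H z))"
proof -
  let ?S = "sphere 0 1 \<inter> H" and ?T = "\<lambda>z. sgn (closest_point H z)"
  let ?G = "{g. rotation g \<and> g ` H = H}"
  have pM: "prob_space M" and sM: "sets M = sets (restrict_space borel ?S)"
    and inv: "\<And>f B. rotation f \<Longrightarrow> f ` ?S = ?S \<Longrightarrow> B \<in> sets M \<Longrightarrow> measure M (f ` B) = measure M B"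
    using M by (auto simp: rotation_invariant_prob_on_def)
  interpret M: prob_space M by (rule pM)
  have spM: "space M = ?S" using sets_eq_imp_space_eq[OF sM] by (simp add: space_restrict_space)
  have Sb: "?S \<in> sets borel"
    using closed_subspace[OF H(1)] by (intro borel_closed closed_Int) auto
  have Sb': "{x \<in> space borel. x \<in> ?S} \<in> sets borel"
  proof -
    have "{x \<in> space borel. x \<in> ?S} = ?S" by auto
    then show ?thesis using Sb by (simp only:)
  qed
  have idm: "g \<in> M \<rightarrow>\<^sub>M borel" if "g \<in> borel_measurable borel" for g :: "real^'n \<Rightarrow> real^'n"
    using measurable_restrict_space1[OF that, of ?S] measurable_cong_sets[OF sM refl] by blast
  note idm1 = idm[of "\<lambda>x. x", simplified]
  have [measurable]: "closest_point H \<in> borel_measurable borel"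
    by (rule borel_measurable_closest_point_subspace[OF H(1)])
  have Tm: "?T \<in> borel_measurable borel" by measurable
  have rot: "orthogonal_transformation g" "g \<in> borel_measurable borel" "\<And>x. norm (g x) = norm x"
    if "g \<in> ?G" for g
    using that orthogonal_transformation_linear linear_borel_measurable
    by (auto simp: rotation_def orthogonal_transformation_norm)
  have gS: "g ` ?S = ?S" if "g \<in> ?G" for g
  proof -
    have "g x \<in> ?S" if "x \<in> ?S" for x
    proof -
      have "g x \<in> g ` H" using that by blast
      then show ?thesis using \<open>g \<in> ?G\<close> rot(3)[OF \<open>g \<in> ?G\<close>, of x] that by simp
    qed
    then have "g ` ?S \<subseteq> ?S" by blast
    moreover have "?S \<subseteq> g ` ?S"
    proof
      fix y assume y: "y \<in> ?S"
      then have "y \<in> g ` H" using that by simp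
      then obtain x where "x \<in> H" "y = g x" by blast
      then show "y \<in> g ` ?S" using y rot(3)[OF that, of x] by auto
    qed
    ultimately show ?thesis by (rule equalityI)
  qed
  obtain a where a: "a \<in> H" "norm a = 1"
    using exists_orthonormal_in_subspace[OF H] by blast
  then have a0: "a \<noteq> 0" by auto
  show ?thesis
  proof (rule invariant_prob_unique[where X = ?S and G = ?G])
    show "prob_space (distr M borel (\<lambda>x. x))" by (intro M.prob_space_distr idm1)
    show "AE x in distr M borel (\<lambda>x. x). x \<in> ?S"
      unfolding AE_distr_iff[OF idm1 Sb'] by (rule AE_I2) (simp add: spM)
    show "prob_space (distr ball_uniform borel ?T)"
      using Tm by (intro ball_uniform.prob_space_distr) simp
    have "?T z \<in> ?S" if "closest_point H z \<noteq> 0" for z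
      using that closest_point_subspace(1)[OF H(1)] H(1)
      by (auto simp: norm_sgn sgn_div_norm subspace_scale)
    then have "AE z in ball_uniform. ?T z \<in> ?S"
      using AE_closest_point_neq_0[OF H(1) a(1) a0] by (auto elim!: eventually_mono)
    then show "AE x in distr ball_uniform borel ?T. x \<in> ?S"
      using Tm by (subst AE_distr_iff[OF _ Sb']) simp_all
    show "dist (g x) (g y) = dist x y" if "g \<in> ?G" for g x y
      using orthogonal_transformation_isometry rot(1)[OF that] by blast
    show "\<exists>g\<in>?G. g x = y" if "x \<in> ?S" "y \<in> ?S" for x y
    proof -
      obtain v where v: "v \<in> H" "norm v = 1" "x \<bullet> v = 0"
        using exists_orthonormal_in_subspace[OF H] by blast
      obtain w where w: "w \<in> H" "norm w = 1" "y \<bullet> w = 0"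
        using exists_orthonormal_in_subspace[OF H] by blast
      have xy: "norm x = 1" "norm y = 1" using that by auto
      obtain g where "rotation g" "g x = y" "g v = w \<or> g v = - w"
        "\<And>K. subspace K \<Longrightarrow> {x, v, y, w} \<subseteq> K \<Longrightarrow> g ` K = K"
        using rotation_frame_map[OF xy(1) v(2,3) xy(2) w(2,3)] by metis
      then show ?thesis using that v w H(1) by (intro bexI[of _ g]) auto
    qed
    show "distr (distr M borel (\<lambda>x. x)) borel g = distr M borel (\<lambda>x. x)" if g: "g \<in> ?G" for g
    proof (rule measure_eqI)
      note gm = rot(2)[OF g]
      fix C assume "C \<in> sets (distr (distr M borel (\<lambda>x. x)) borel g)"
      then have C: "C \<in> sets borel" by simp
      let ?B = "g -` C \<inter> ?S"
      have "g -` C \<in> sets borel" using measurable_sets[OF gm C] by simp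
      then have B: "?B \<in> sets M" using Sb by (auto simp: sM sets_restrict_space_iff)
      have "g ` ?B = C \<inter> g ` ?S" by blast
      then have "g ` ?B = C \<inter> ?S" by (simp only: gS[OF g])
      then have "measure M (C \<inter> ?S) = measure M ?B"
        using inv[OF _ gS[OF g] B] g by simp
      then have "emeasure M (C \<inter> ?S) = emeasure M ?B"
        by (simp add: M.emeasure_eq_measure)
      then show "emeasure (distr (distr M borel (\<lambda>x. x)) borel g) C = emeasure (distr M borel (\<lambda>x. x)) C"
        using C idm1 idm[OF gm] gm by (simp add: distr_distr o_def emeasure_distr spM)
    qed simp
    show "distr (distr ball_uniform borel ?T) borel g = distr ball_uniform borel ?T" if g: "g \<in> ?G" for g
    proof -
      note [measurable] = rot(2)[OF g]
      have gT: "g (?T z) = ?T (g z)" for z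
        using closest_point_orthogonal_image[OF rot(1)[OF g] H(1), of z] g
        by (simp add: orthogonal_transformation_sgn[OF rot(1)[OF g]])
      have "distr (distr ball_uniform borel ?T) borel g = distr ball_uniform borel (g \<circ> ?T)"
        by (rule distr_distr) measurable
      also have "g \<circ> ?T = ?T \<circ> g" by (auto simp: gT)
      also have "distr ball_uniform borel (?T \<circ> g) = distr (distr ball_uniform borel g) borel ?T"
        by (rule distr_distr[symmetric]) measurable
      finally show ?thesis by (simp add: distr_ball_uniform_orthogonal[OF rot(1)[OF g]])
    qed
  qed auto
qed


section \<open>Random orthonormal frames in a random plane\<close>

text \<open>
  The Gram-Schmidt orthonormalisation of two vectors. For dependent vectors a component is the
  junk value \<open>0\<close>; the components have norm at most \<open>1\<close> in all cases.
\<close>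

definition gs_frame :: "'a::euclidean_space \<Rightarrow> 'a \<Rightarrow> 'a \<times> 'a" where
  "gs_frame a b = (sgn a, sgn (b - (b \<bullet> sgn a) *\<^sub>R sgn a))"

definition orthonormal_frames :: "('a::euclidean_space \<times> 'a) set" where
  "orthonormal_frames = {(x, v). norm x = 1 \<and> norm v = 1 \<and> x \<bullet> v = 0}"

lemma norm_sgn_le_1: "norm (sgn x) \<le> 1" for x :: "'a::real_normed_vector"
  by (simp add: norm_sgn)

lemma sgn_in_subspace: "subspace H \<Longrightarrow> x \<in> H \<Longrightarrow> sgn x \<in> H" for x :: "'a::real_normed_vector"
  by (simp add: sgn_div_norm subspace_scale)

lemma gs_frame_in_subspace:
  assumes "subspace H" "a \<in> H" "b \<in> H"
  shows "fst (gs_frame a b) \<in> H" "snd (gs_frame a b) \<in> H"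
  using assms by (auto simp: gs_frame_def intro!: sgn_in_subspace subspace_diff subspace_scale)

lemma gs_frame_orthonormal:
  assumes a: "a \<noteq> 0" and b: "b - (b \<bullet> sgn a) *\<^sub>R sgn a \<noteq> 0"
  shows "gs_frame a b \<in> orthonormal_frames"
proof -
  have 1: "norm (sgn a) = 1" using a by (simp add: norm_sgn)
  then have "sgn a \<bullet> sgn a = 1" by (simp add: norm_eq_1)
  then have "sgn a \<bullet> (b - (b \<bullet> sgn a) *\<^sub>R sgn a) = 0"
    by (simp add: inner_diff_right inner_commute)
  then have "sgn a \<bullet> sgn (b - (b \<bullet> sgn a) *\<^sub>R sgn a) = 0"
    unfolding sgn_div_norm[of "b - (b \<bullet> sgn a) *\<^sub>R sgn a"] by simp
  then show ?thesis
    using 1 b by (simp add: orthonormal_frames_def gs_frame_def norm_sgn)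
qed

text \<open>
  The sign \<open>s\<close> is carried along because \<open>rotation_frame_map\<close> reaches an orthonormal pair only up to the
  sign of its second vector.
\<close>

lemma gs_frame_equivariant:
  fixes g :: "'a::euclidean_space \<Rightarrow> 'a"
  assumes g: "orthogonal_transformation g" and s: "\<bar>s\<bar> = 1"
  shows "gs_frame (g a) (s *\<^sub>R g b) = (g (fst (gs_frame a b)), s *\<^sub>R g (snd (gs_frame a b)))"
proof -
  have lin: "linear g" using g by (rule orthogonal_transformation_linear)
  have x: "sgn (g y) = g (sgn y)" for y using orthogonal_transformation_sgn[OF g, of y] by simp
  have "g b \<bullet> g (sgn a) = b \<bullet> sgn a" using g by (simp add: orthogonal_transformation_def)
  then have "s *\<^sub>R g b - ((s *\<^sub>R g b) \<bullet> g (sgn a)) *\<^sub>R g (sgn a)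
      = s *\<^sub>R g (b - (b \<bullet> sgn a) *\<^sub>R sgn a)"
    using lin by (simp add: linear_diff linear_cmul scaleR_diff_right)
  moreover have "sgn s = s" using s by (simp add: sgn_if abs_if split: if_splits)
  ultimately show ?thesis
    by (simp add: gs_frame_def x sgn_scaleR)
qed

lemma measurable_gs_frame [measurable]:
  fixes F G :: "'b \<Rightarrow> 'a::euclidean_space"
  assumes [measurable]: "F \<in> borel_measurable M" "G \<in> borel_measurable M"
  shows "(\<lambda>w. gs_frame (F w) (G w)) \<in> borel_measurable M"
  unfolding gs_frame_def borel_prod[symmetric] by measurable

lemma sets_orthonormal_frames [measurable]:
  "orthonormal_frames \<in> sets (borel :: ('a::euclidean_space \<times> 'a) measure)"
proof -
  have "closed {p :: 'a \<times> 'a. norm (fst p) = 1 \<and> norm (snd p) = 1 \<and> fst p \<bullet> snd p = 0}"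
    by (intro closed_Collect_conj closed_Collect_eq continuous_intros)
  moreover have "orthonormal_frames = {p :: 'a \<times> 'a. norm (fst p) = 1 \<and> norm (snd p) = 1 \<and> fst p \<bullet> snd p = 0}"
    by (auto simp: orthonormal_frames_def)
  ultimately show ?thesis by simp
qed

lemma AE_gs_frame_orthonormal:
  fixes H :: "'a::euclidean_space set"
  assumes H: "subspace H" "dim H \<ge> 2"
  shows "AE z in ball_uniform. AE w in ball_uniform.
    gs_frame (closest_point H z) (closest_point H w) \<in> orthonormal_frames"
proof -
  let ?P = "closest_point H"
  obtain a where a: "a \<in> H" "norm a = 1"
    using exists_orthonormal_in_subspace[OF H] by blast
  then have "a \<noteq> 0" by auto
  then have "AE z in ball_uniform. ?P z \<noteq> 0"
    using AE_closest_point_neq_0[OF H(1) a(1)] by blast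
  then show ?thesis
  proof (rule eventually_mono)
    fix z assume z: "?P z \<noteq> 0"
    let ?x = "sgn (?P z)"
    obtain b where b: "b \<in> H" "norm b = 1" "?x \<bullet> b = 0"
      using exists_orthonormal_in_subspace[OF H] by blast
    then have "b \<noteq> 0" by auto
    then have "AE w in ball_uniform. w \<bullet> b \<noteq> 0" by (rule AE_ball_uniform_inner_neq_0)
    then show "AE w in ball_uniform. gs_frame (?P z) (?P w) \<in> orthonormal_frames"
    proof (rule eventually_mono)
      fix w assume w: "w \<bullet> b \<noteq> 0"
      have "(?P w - (?P w \<bullet> ?x) *\<^sub>R ?x) \<bullet> b = w \<bullet> b"
        using b(3) closest_point_subspace_inner[OF H(1) b(1), of w] by (simp add: inner_diff_left)
      then have "?P w - (?P w \<bullet> ?x) *\<^sub>R ?x \<noteq> 0" using w by auto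
      with z show "gs_frame (?P z) (?P w) \<in> orthonormal_frames" by (rule gs_frame_orthonormal)
    qed
  qed
qed

text \<open>
  If \<open>F\<close> intertwines a measure preserving map of the source with \<open>T\<close>, then the law of \<open>F\<close> is
  \<open>T\<close>-invariant. All invariance claims about random frames are of this kind.
\<close>

lemma distr_equivariant:
  assumes F: "F \<in> K \<rightarrow>\<^sub>M L" and \<Gamma>: "\<Gamma> \<in> K \<rightarrow>\<^sub>M K" and T: "T \<in> L \<rightarrow>\<^sub>M L"
    and inv: "distr K K \<Gamma> = K" and eq: "\<And>\<omega>. \<omega> \<in> space K \<Longrightarrow> F (\<Gamma> \<omega>) = T (F \<omega>)"
  shows "distr (distr K L F) L T = distr K L F"
proof -
  have "distr (distr K L F) L T = distr K L (T \<circ> F)"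
    using T F by (rule distr_distr)
  also have "\<dots> = distr K L (F \<circ> \<Gamma>)"
    by (rule distr_cong) (simp_all add: eq)
  also have "\<dots> = distr (distr K K \<Gamma>) L F"
    using F \<Gamma> by (rule distr_distr[symmetric])
  finally show ?thesis by (simp add: inv)
qed

interpretation ball_uniform_pair: pair_prob_space
  "ball_uniform :: 'a::euclidean_space measure" "ball_uniform :: 'b::euclidean_space measure" ..

lemma distr_ball_uniform_pair:
  fixes f g :: "'a::euclidean_space \<Rightarrow> 'a"
  assumes f: "orthogonal_transformation f" and g: "orthogonal_transformation g"
  shows "distr (ball_uniform \<Otimes>\<^sub>M ball_uniform) (ball_uniform \<Otimes>\<^sub>M ball_uniform) (\<lambda>(z, w). (f z, g w))
    = ball_uniform \<Otimes>\<^sub>M (ball_uniform :: 'a measure)"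
proof -
  have m: "f \<in> ball_uniform \<rightarrow>\<^sub>M ball_uniform" "g \<in> ball_uniform \<rightarrow>\<^sub>M ball_uniform"
    using linear_borel_measurable(2)[OF orthogonal_transformation_linear[OF f]]
      linear_borel_measurable(2)[OF orthogonal_transformation_linear[OF g]]
    by (simp_all cong: measurable_cong_sets)
  have d: "distr ball_uniform ball_uniform h = ball_uniform"
    if "orthogonal_transformation h" for h :: "'a \<Rightarrow> 'a"
    using distr_ball_uniform_orthogonal[OF that] by (simp cong: distr_cong)
  have "distr ball_uniform ball_uniform f \<Otimes>\<^sub>M distr ball_uniform ball_uniform g
      = distr (ball_uniform \<Otimes>\<^sub>M ball_uniform) (ball_uniform \<Otimes>\<^sub>M ball_uniform) (\<lambda>(z, w). (f z, g w))"
    using m by (rule pair_measure_distr)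
      (simp add: d[OF g] ball_uniform.sigma_finite_measure_axioms)
  then show ?thesis by (simp add: d f g)
qed

lemma orthogonal_transformation_signed:
  fixes g :: "'a::real_inner \<Rightarrow> 'a"
  assumes g: "orthogonal_transformation g" and s: "\<bar>s::real\<bar> = 1"
  shows "orthogonal_transformation (\<lambda>x. s *\<^sub>R g x)"
proof -
  have "s * s = 1" using s by (metis abs_mult_self_eq mult_1)
  then show ?thesis
    using g by (auto simp: orthogonal_transformation_def linear_compose_scale_right mult.assoc[symmetric])
qed

locale random_plane =
  fixes \<mu> :: "(real^'n) set measure"
  assumes invariant: "rotation_invariant_prob_grassmannian 2 \<mu>"
begin

lemma prob_space_plane: "prob_space \<mu>"
  using invariant by (simp add: rotation_invariant_prob_grassmannian_def)

sublocale prob_space \<mu> by (rule prob_space_plane)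

lemma sets_plane: "sets \<mu> = sets (grassmannian_borel 2)"
  using invariant by (simp add: rotation_invariant_prob_grassmannian_def)

lemma space_plane: "space \<mu> = grassmannian 2"
  using sets_eq_imp_space_eq[OF sets_plane] by (simp add: grassmannian_borel_def)

lemma planeD: "H \<in> space \<mu> \<Longrightarrow> subspace H" "H \<in> space \<mu> \<Longrightarrow> dim H = 2"
  by (auto simp: space_plane grassmannian_def)

lemma measurable_proj_matrix [measurable]: "proj_matrix \<in> borel_measurable \<mu>"
  unfolding measurable_cong_sets[OF sets_plane refl] grassmannian_borel_def
  by (rule measurable_vimage_algebra1) simp

text \<open>
  The Borel structure on planes is defined through the matrix of the projection, and
  the projection of a vector is a polynomial in the entries of that matrix and of the vector.
\<close>

lemma measurable_closest_point [measurable]: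
  assumes [measurable]: "F \<in> M \<rightarrow>\<^sub>M \<mu>" "G \<in> borel_measurable M"
  shows "(\<lambda>w. closest_point (F w) (G w)) \<in> borel_measurable M"
proof -
  have nth: "(\<lambda>x. x $ i) \<in> borel_measurable borel" for i :: 'n and x :: "('b::euclidean_space)^'n"
    by (intro borel_measurable_continuous_onI continuous_intros)
  have "(\<lambda>w. proj_matrix (F w)) \<in> borel_measurable M" by measurable
  then have "(\<lambda>w. proj_matrix (F w) *v G w) \<in> borel_measurable M"
    unfolding matrix_vector_mult_def
    by (intro borel_measurable_vec_lambda borel_measurable_sum borel_measurable_times
        measurable_compose[OF _ nth] assms(2)) auto
  moreover have "closest_point (F w) (G w) = proj_matrix (F w) *v G w" if "w \<in> space M" for w
  proof -
    have "F w \<in> space \<mu>" using that by (metis assms(1) measurable_space)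
    then have "linear (closest_point (F w))" using planeD(1) linear_closest_point by blast
    then show ?thesis by (simp add: proj_matrix_def matrix_works)
  qed
  ultimately show ?thesis
    by (subst measurable_cong) auto
qed

lemma distr_plane_rotation:
  assumes g: "rotation g"
  shows "(`) g \<in> \<mu> \<rightarrow>\<^sub>M \<mu>" "distr \<mu> \<mu> ((`) g) = \<mu>"
proof -
  have o: "orthogonal_transformation g" using g by (simp add: rotation_def)
  show m: "(`) g \<in> \<mu> \<rightarrow>\<^sub>M \<mu>"
    unfolding measurable_cong_sets[OF sets_plane sets_plane]
    by (rule orthogonal_image_measurable_grassmannian[OF o])
  have mi: "(`) (inv g) \<in> \<mu> \<rightarrow>\<^sub>M \<mu>"
    unfolding measurable_cong_sets[OF sets_plane sets_plane]
    by (rule orthogonal_image_measurable_grassmannian[OF orthogonal_transformation_inv[OF o]])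
  have gi: "g ` inv g ` H = H" for H
    using orthogonal_transformation_surj[OF o] by (simp add: image_f_inv_f)
  show "distr \<mu> \<mu> ((`) g) = \<mu>"
  proof (rule measure_eqI)
    fix B assume "B \<in> sets (distr \<mu> \<mu> ((`) g))"
    then have B: "B \<in> sets \<mu>" by simp
    let ?C = "(`) g -` B \<inter> space \<mu>"
    have C: "?C \<in> sets \<mu>" using measurable_sets[OF m B] .
    have "(`) g ` ?C = B"
    proof safe
      fix K assume K: "K \<in> B"
      then have "inv g ` K \<in> space \<mu>"
        using sets.sets_into_space[OF B] measurable_space[OF mi, of K] by blast
      then show "K \<in> (`) g ` ?C" using K gi[of K] by (intro image_eqI[of _ _ "inv g ` K"]) auto
    qed
    then have "measure \<mu> B = measure \<mu> ?C"
      using invariant g C unfolding rotation_invariant_prob_grassmannian_def by metis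
    then show "emeasure (distr \<mu> \<mu> ((`) g)) B = emeasure \<mu> B"
      using B m by (simp add: emeasure_distr emeasure_eq_measure)
  qed simp
qed

sublocale plane_pair: pair_prob_space \<mu>
  "ball_uniform \<Otimes>\<^sub>M ball_uniform :: ((real^'n) \<times> (real^'n)) measure" ..

text \<open>
  Both laws live on the orthonormal pairs and are invariant under the maps
  \<open>(x, v) \<mapsto> (g x, s *\<^sub>R g v)\<close> with a rotation \<open>g\<close> and a sign \<open>s\<close>, which act transitively on these pairs.
\<close>

theorem frame_law:
  "distr (\<mu> \<Otimes>\<^sub>M (ball_uniform \<Otimes>\<^sub>M ball_uniform)) borel
      (\<lambda>(H, z, w). gs_frame (closest_point H z) (closest_point H w))
    = distr (ball_uniform \<Otimes>\<^sub>M ball_uniform) borel (\<lambda>(z, w). gs_frame z (w::real^'n))"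
    (is "distr ?K borel ?F = distr ?U borel ?F'")
proof -
  have n: "2 \<le> dim (UNIV :: (real^'n) set)"
  proof -
    obtain H where H: "H \<in> space \<mu>" using not_empty by blast
    have "dim H \<le> dim (UNIV :: (real^'n) set)" by (rule dim_subset) simp
    then show ?thesis using planeD(2)[OF H] by simp
  qed
  define G where "G = {\<lambda>(x, v). (g x, s *\<^sub>R g v) |(g :: real^'n \<Rightarrow> real^'n) s. rotation g \<and> \<bar>s\<bar> = 1}"
  have F [measurable]: "?F \<in> borel_measurable ?K" by measurable
  have F' [measurable]: "?F' \<in> borel_measurable ?U" by measurable
  have set: "{p \<in> space borel. p \<in> orthonormal_frames} \<in> sets (borel :: ((real^'n) \<times> (real^'n)) measure)"
    by measurable
  have GE: "\<exists>g s. T = (\<lambda>(x, v). (g x, s *\<^sub>R g v)) \<and> rotation g \<and> \<bar>s\<bar> = 1 \<and> orthogonal_transformation g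
      \<and> g \<in> borel_measurable borel \<and> orthogonal_transformation (\<lambda>x. s *\<^sub>R g x)"
    if "T \<in> G" for T
    using that orthogonal_transformation_signed orthogonal_transformation_linear linear_borel_measurable(2)
    unfolding G_def rotation_def by blast
  have Tm: "T \<in> borel_measurable borel" if T: "T \<in> G" for T
  proof -
    obtain g s where T: "T = (\<lambda>(x, v). (g x, s *\<^sub>R g v))" and [measurable]: "g \<in> borel_measurable borel"
      using GE[OF T] by blast
    show ?thesis unfolding T borel_prod[symmetric] by measurable
  qed
  show ?thesis
  proof (rule invariant_prob_unique[where X = orthonormal_frames and G = G])
    show "prob_space (distr ?K borel ?F)" by (rule plane_pair.prob_space_distr[OF F])
    show "prob_space (distr ?U borel ?F')" by (rule ball_uniform_pair.prob_space_distr[OF F'])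
    show "AE p in distr ?K borel ?F. p \<in> orthonormal_frames"
    proof (subst AE_distr_iff[OF F set], rule plane_pair.AE_pair_measure)
      show "{p \<in> space ?K. ?F p \<in> orthonormal_frames} \<in> sets ?K" by measurable
      show "AE H in \<mu>. AE q in ?U. ?F (H, q) \<in> orthonormal_frames"
      proof (rule AE_I2)
        fix H assume H: "H \<in> space \<mu>"
        then have [measurable]: "closest_point H \<in> borel_measurable borel"
          using planeD(1) borel_measurable_closest_point_subspace by blast
        have eq: "?F (H, q) = gs_frame (closest_point H (fst q)) (closest_point H (snd q))" for q
          by (simp add: split_beta)
        show "AE q in ?U. ?F (H, q) \<in> orthonormal_frames"
          unfolding eq
        proof (rule ball_uniform_pair.AE_pair_measure)
          show "{q \<in> space ?U. gs_frame (closest_point H (fst q)) (closest_point H (snd q))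
              \<in> orthonormal_frames} \<in> sets ?U"
            by measurable
        qed (use AE_gs_frame_orthonormal[of H] planeD[OF H] in simp)
      qed
    qed
    show "AE p in distr ?U borel ?F'. p \<in> orthonormal_frames"
    proof (subst AE_distr_iff[OF F' set], rule ball_uniform_pair.AE_pair_measure)
      show "{q \<in> space ?U. ?F' q \<in> orthonormal_frames} \<in> sets ?U" by measurable
    qed (use AE_gs_frame_orthonormal[OF subspace_UNIV n] in \<open>simp add: closest_point_self\<close>)
    show "dist (T p) (T q) = dist p q" if T: "T \<in> G" for T p q
    proof -
      obtain g s where T: "T = (\<lambda>(x, v). (g x, s *\<^sub>R g v))" and g: "orthogonal_transformation g"
        and sg: "orthogonal_transformation (\<lambda>x. s *\<^sub>R g x)"
        using GE[OF T] by blast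
      have "dist (g x) (g y) = dist x y" "dist (s *\<^sub>R g x) (s *\<^sub>R g y) = dist x y" for x y
        using g[unfolded orthogonal_transformation_isometry] sg[unfolded orthogonal_transformation_isometry]
        by simp_all
      then show ?thesis
        by (simp add: T split_beta dist_prod_def)
    qed
    show "\<exists>T\<in>G. T p = q" if pq: "p \<in> orthonormal_frames" "q \<in> orthonormal_frames" for p q :: "(real^'n) \<times> (real^'n)"
    proof -
      obtain x v x' v' where p: "p = (x, v)" and q: "q = (x', v')"
        and fr: "norm x = 1" "norm v = 1" "x \<bullet> v = 0" "norm x' = 1" "norm v' = 1" "x' \<bullet> v' = 0"
        using pq by (auto simp: orthonormal_frames_def)
      obtain g where g: "rotation g" "g x = x'" "g v = v' \<or> g v = - v'"
        using rotation_frame_map[OF fr] by metis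
      define s :: real where "s = (if g v = v' then 1 else - 1)"
      have s: "\<bar>s\<bar> = 1" "s *\<^sub>R g v = v'" using g(3) by (auto simp: s_def)
      show ?thesis
        using g(1,2) s unfolding G_def p q
        by (intro bexI[of _ "\<lambda>(x, v). (g x, s *\<^sub>R g v)"]) auto
    qed
    show "distr (distr ?K borel ?F) borel T = distr ?K borel ?F" if T: "T \<in> G" for T
    proof -
      obtain g s where T': "T = (\<lambda>(x, v). (g x, s *\<^sub>R g v))" and g: "rotation g" "orthogonal_transformation g"
        and s: "\<bar>s\<bar> = 1" and [measurable]: "g \<in> borel_measurable borel"
        and sg: "orthogonal_transformation (\<lambda>x. s *\<^sub>R g x)"
        using GE[OF T] by blast
      let ?\<Gamma>' = "\<lambda>(z, w). (g z, s *\<^sub>R g w)"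
      let ?\<Gamma> = "\<lambda>(H, q). (g ` H, ?\<Gamma>' q)"
      note [measurable] = distr_plane_rotation(1)[OF g(1)]
      have m': "?\<Gamma>' \<in> ?U \<rightarrow>\<^sub>M ?U" by measurable
      have U: "distr ?U ?U ?\<Gamma>' = ?U" by (rule distr_ball_uniform_pair[OF g(2) sg])
      have "distr \<mu> \<mu> ((`) g) \<Otimes>\<^sub>M distr ?U ?U ?\<Gamma>' = distr ?K ?K ?\<Gamma>"
        using distr_plane_rotation(1)[OF g(1)] m'
        by (rule pair_measure_distr) (unfold U, rule ball_uniform_pair.sigma_finite_measure_axioms)
      then have "distr ?K ?K ?\<Gamma> = ?K"
        by (simp add: U distr_plane_rotation(2)[OF g(1)])
      moreover have "?\<Gamma> \<in> ?K \<rightarrow>\<^sub>M ?K" using m' by measurable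
      moreover have "?F (?\<Gamma> \<omega>) = T (?F \<omega>)" if \<omega>: "\<omega> \<in> space ?K" for \<omega>
      proof -
        obtain H z w where [simp]: "\<omega> = (H, z, w)" by (cases \<omega>) auto
        have H: "subspace H" using \<omega> planeD(1) by (auto simp: space_pair_measure)
        have "closest_point (g ` H) (g z) = g (closest_point H z)"
          by (rule closest_point_orthogonal_image[OF g(2) H])
        moreover have "closest_point (g ` H) (s *\<^sub>R g w) = s *\<^sub>R g (closest_point H w)"
          using closest_point_orthogonal_image[OF g(2) H, of w]
            linear_cmul[OF linear_closest_point, of "g ` H"]
            linear_subspace_image[OF orthogonal_transformation_linear[OF g(2)] H]
          by simp
        ultimately show ?thesis
          by (simp add: T' gs_frame_equivariant[OF g(2) s] split_beta)
      qed
      ultimately show ?thesis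
        using distr_equivariant[OF F _ Tm[OF T]] by blast
    qed
    show "distr (distr ?U borel ?F') borel T = distr ?U borel ?F'" if T: "T \<in> G" for T
    proof -
      obtain g s where T': "T = (\<lambda>(x, v). (g x, s *\<^sub>R g v))" and g: "rotation g" "orthogonal_transformation g"
        and s: "\<bar>s\<bar> = 1" and [measurable]: "g \<in> borel_measurable borel"
        and sg: "orthogonal_transformation (\<lambda>x. s *\<^sub>R g x)"
        using GE[OF T] by blast
      let ?\<Gamma>' = "\<lambda>(z, w). (g z, s *\<^sub>R g w)"
      have m': "?\<Gamma>' \<in> ?U \<rightarrow>\<^sub>M ?U" by measurable
      have U: "distr ?U ?U ?\<Gamma>' = ?U" by (rule distr_ball_uniform_pair[OF g(2) sg])
      show ?thesis
        by (rule distr_equivariant[OF F' m' Tm[OF T] U])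
          (auto simp: T' gs_frame_equivariant[OF g(2) s] split_beta)
    qed
  qed simp_all
qed

corollary integral_frame_law:
  fixes \<Phi> :: "(real^'n) \<times> (real^'n) \<Rightarrow> real"
  assumes [measurable]: "\<Phi> \<in> borel_measurable borel"
    and bound: "\<And>x v. norm x \<le> 1 \<Longrightarrow> norm v \<le> 1 \<Longrightarrow> \<bar>\<Phi> (x, v)\<bar> \<le> C"
  shows "(\<integral>H. (\<integral>z. (\<integral>w. \<Phi> (gs_frame (closest_point H z) (closest_point H w)) \<partial>ball_uniform) \<partial>ball_uniform) \<partial>\<mu>)
    = (\<integral>z. (\<integral>w. \<Phi> (gs_frame z w) \<partial>ball_uniform) \<partial>ball_uniform)"
proof -
  let ?U = "ball_uniform \<Otimes>\<^sub>M ball_uniform :: ((real^'n) \<times> (real^'n)) measure"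
  have b: "norm (\<Phi> (gs_frame a b)) \<le> C" for a b :: "real^'n"
    using bound by (simp add: gs_frame_def norm_sgn_le_1)
  have pairs: "(\<integral>z. (\<integral>w. h (z, w) \<partial>ball_uniform) \<partial>ball_uniform) = (\<integral>q. h q \<partial>?U)"
    if "h \<in> borel_measurable ?U" "\<And>q. norm (h q) \<le> C" for h :: "_ \<Rightarrow> real"
    using that by (intro ball_uniform_pair.integral_fst' ball_uniform_pair.integrable_const_bound[of _ C]) auto
  have "(\<integral>H. (\<integral>z. (\<integral>w. \<Phi> (gs_frame (closest_point H z) (closest_point H w)) \<partial>ball_uniform) \<partial>ball_uniform) \<partial>\<mu>)
      = (\<integral>H. (\<integral>q. \<Phi> (gs_frame (closest_point H (fst q)) (closest_point H (snd q))) \<partial>?U) \<partial>\<mu>)"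
  proof (rule Bochner_Integration.integral_cong[OF refl])
    fix H assume "H \<in> space \<mu>"
    then have [measurable]: "closest_point H \<in> borel_measurable borel"
      using planeD(1) borel_measurable_closest_point_subspace by blast
    show "(\<integral>z. (\<integral>w. \<Phi> (gs_frame (closest_point H z) (closest_point H w)) \<partial>ball_uniform) \<partial>ball_uniform)
        = (\<integral>q. \<Phi> (gs_frame (closest_point H (fst q)) (closest_point H (snd q))) \<partial>?U)"
      by (subst pairs[symmetric]) (auto simp: b[unfolded real_norm_def])
  qed
  also have "\<dots> = (\<integral>p. \<Phi> (gs_frame (closest_point (fst p) (fst (snd p))) (closest_point (fst p) (snd (snd p))))
      \<partial>(\<mu> \<Otimes>\<^sub>M ?U))"
    by (subst plane_pair.integral_fst'[symmetric])
      (auto intro!: plane_pair.integrable_const_bound[of _ C] simp: b[unfolded real_norm_def])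
  also have "\<dots> = (\<integral>p. \<Phi> p \<partial>distr (\<mu> \<Otimes>\<^sub>M ?U) borel
      (\<lambda>(H, z, w). gs_frame (closest_point H z) (closest_point H w)))"
    by (subst integral_distr) (auto simp: split_beta)
  also have "\<dots> = (\<integral>q. \<Phi> (gs_frame (fst q) (snd q)) \<partial>?U)"
    unfolding frame_law by (subst integral_distr) (auto simp: split_beta)
  also have "\<dots> = (\<integral>z. (\<integral>w. \<Phi> (gs_frame z w) \<partial>ball_uniform) \<partial>ball_uniform)"
    by (subst pairs[symmetric]) (auto simp: b[unfolded real_norm_def])
  finally show ?thesis .
qed

end


section \<open>Means over spheres of subspaces\<close>

lemma measure_ball_uniform_UNIV [simp]:
  "measure ball_uniform UNIV = 1" "emeasure ball_uniform UNIV = 1"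
  using ball_uniform.prob_space ball_uniform.emeasure_space_1 by simp_all

text \<open>
  For a subspace \<open>H \<noteq> {0}\<close> this is the mean of \<open>f\<close> over the unit sphere of \<open>H\<close>, that is over
  the whole sphere if \<open>H = UNIV\<close> and over a great circle if \<open>H\<close> is a plane.
\<close>

definition subsphere_mean :: "('a::euclidean_space \<Rightarrow> real) \<Rightarrow> 'a set \<Rightarrow> real" where
  "subsphere_mean f H = (\<integral>z. f (sgn (closest_point H z)) \<partial>ball_uniform)"

text \<open>
  Boundedness is required on the unit ball, rather than on the sphere, since \<open>sgn\<close> also takes the value
  \<open>0\<close>; continuous functions on the whole space then belong to the class.
\<close>

definition ball_bounded_borel :: "('a::euclidean_space \<Rightarrow> real) \<Rightarrow> bool" where
  "ball_bounded_borel f \<longleftrightarrow> f \<in> borel_measurable borel \<and> (\<exists>C. \<forall>x. norm x \<le> 1 \<longrightarrow> \<bar>f x\<bar> \<le> C)"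

lemma ball_bounded_borel_measurable [measurable_dest]:
  "ball_bounded_borel f \<Longrightarrow> f \<in> borel_measurable borel"
  by (simp add: ball_bounded_borel_def)

lemma ball_bounded_borelE:
  assumes "ball_bounded_borel f"
  obtains C where "C \<ge> 0" "\<And>x. norm x \<le> 1 \<Longrightarrow> \<bar>f x\<bar> \<le> C"
proof -
  obtain C where C: "\<And>x. norm x \<le> 1 \<Longrightarrow> \<bar>f x\<bar> \<le> C"
    using assms by (auto simp: ball_bounded_borel_def)
  have "0 \<le> \<bar>f 0\<bar>" by simp
  also have "\<dots> \<le> C" using C[of 0] by simp
  finally show ?thesis using that C by blast
qed

lemma ball_bounded_borel_continuous:
  assumes f: "continuous_on UNIV f"
  shows "ball_bounded_borel (f :: 'a::euclidean_space \<Rightarrow> real)"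
proof -
  have "compact (f ` cball 0 1)"
    by (intro compact_continuous_image continuous_on_subset[OF f]) auto
  then obtain C where "\<forall>y\<in>f ` cball 0 1. norm y \<le> C"
    using compact_imp_bounded bounded_iff by metis
  then show ?thesis
    using f by (auto simp: ball_bounded_borel_def intro!: borel_measurable_continuous_onI exI[of _ C])
qed

lemma ball_bounded_borel_const [simp, intro]: "ball_bounded_borel (\<lambda>x. c)"
  by (rule ball_bounded_borel_continuous) simp

lemma ball_bounded_borel_inner_power [simp, intro]: "ball_bounded_borel (\<lambda>x. (x \<bullet> u) ^ k)"
  by (intro ball_bounded_borel_continuous continuous_intros)

lemma ball_bounded_borel_mult [intro]:
  assumes "ball_bounded_borel f" "ball_bounded_borel g"
  shows "ball_bounded_borel (\<lambda>x. f x * g x)"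
proof -
  obtain C where C: "C \<ge> 0" "\<And>x. norm x \<le> 1 \<Longrightarrow> \<bar>f x\<bar> \<le> C"
    using ball_bounded_borelE[OF assms(1)] by blast
  obtain D where D: "D \<ge> 0" "\<And>x. norm x \<le> 1 \<Longrightarrow> \<bar>g x\<bar> \<le> D"
    using ball_bounded_borelE[OF assms(2)] by blast
  have "\<bar>f x * g x\<bar> \<le> C * D" if "norm x \<le> 1" for x
    unfolding abs_mult using C D that by (intro mult_mono) auto
  then show ?thesis using assms by (auto simp: ball_bounded_borel_def)
qed

lemma ball_bounded_borel_add [intro]:
  assumes "ball_bounded_borel f" "ball_bounded_borel g"
  shows "ball_bounded_borel (\<lambda>x. f x + g x)"
proof -
  obtain C where C: "C \<ge> 0" "\<And>x. norm x \<le> 1 \<Longrightarrow> \<bar>f x\<bar> \<le> C"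
    using ball_bounded_borelE[OF assms(1)] by blast
  obtain D where D: "D \<ge> 0" "\<And>x. norm x \<le> 1 \<Longrightarrow> \<bar>g x\<bar> \<le> D"
    using ball_bounded_borelE[OF assms(2)] by blast
  have "\<bar>f x + g x\<bar> \<le> C + D" if "norm x \<le> 1" for x
    using C(2)[OF that] D(2)[OF that] by linarith
  then show ?thesis using assms by (auto simp: ball_bounded_borel_def)
qed

lemma ball_bounded_borel_diff [intro]:
  assumes "ball_bounded_borel f" "ball_bounded_borel g"
  shows "ball_bounded_borel (\<lambda>x. f x - g x)"
  using ball_bounded_borel_add[OF assms(1) ball_bounded_borel_mult[OF ball_bounded_borel_const[of "-1"] assms(2)]]
  by simp

lemma ball_bounded_borel_sum [intro]:
  "(\<And>i. i \<in> I \<Longrightarrow> ball_bounded_borel (f i)) \<Longrightarrow> ball_bounded_borel (\<lambda>x. \<Sum>i\<in>I. f i x)"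
  by (induction I rule: infinite_finite_induct) auto

lemma measurable_sgn_closest_point:
  fixes H :: "'a::euclidean_space set"
  assumes "subspace H"
  shows "(\<lambda>z. sgn (closest_point H z)) \<in> borel_measurable borel"
  using borel_measurable_closest_point_subspace[OF assms] by measurable

lemma integrable_subsphere_mean:
  assumes H: "subspace H" and f: "ball_bounded_borel f"
  shows "integrable ball_uniform (\<lambda>z. f (sgn (closest_point H z)))"
proof -
  obtain C where C: "\<And>x. norm x \<le> 1 \<Longrightarrow> \<bar>f x\<bar> \<le> C"
    using ball_bounded_borelE[OF f] by blast
  note [measurable] = measurable_sgn_closest_point[OF H] ball_bounded_borel_measurable[OF f]
  show ?thesis
    by (rule ball_uniform.integrable_const_bound[of _ C]) (auto simp: C norm_sgn_le_1)
qed

lemma subsphere_mean_add: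
  "\<lbrakk>subspace H; ball_bounded_borel f; ball_bounded_borel g\<rbrakk>
    \<Longrightarrow> subsphere_mean (\<lambda>x. f x + g x) H = subsphere_mean f H + subsphere_mean g H"
  unfolding subsphere_mean_def
  by (intro Bochner_Integration.integral_add integrable_subsphere_mean)

lemma subsphere_mean_cmult: "subsphere_mean (\<lambda>x. c * f x) H = c * subsphere_mean f H"
  by (simp add: subsphere_mean_def)

lemma subsphere_mean_sum:
  "\<lbrakk>subspace H; \<And>i. i \<in> I \<Longrightarrow> ball_bounded_borel (f i)\<rbrakk>
    \<Longrightarrow> subsphere_mean (\<lambda>x. \<Sum>i\<in>I. f i x) H = (\<Sum>i\<in>I. subsphere_mean (f i) H)"
  unfolding subsphere_mean_def
  by (intro Bochner_Integration.integral_sum integrable_subsphere_mean)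

lemma subsphere_mean_const [simp]: "subsphere_mean (\<lambda>x. c) H = c"
  by (simp add: subsphere_mean_def)

lemma subsphere_mean_mono:
  assumes H: "subspace H" and f: "ball_bounded_borel f" "ball_bounded_borel g"
    and le: "\<And>x. norm x \<le> 1 \<Longrightarrow> f x \<le> g x"
  shows "subsphere_mean f H \<le> subsphere_mean g H"
  unfolding subsphere_mean_def
  using H f by (intro integral_mono integrable_subsphere_mean) (auto intro: le norm_sgn_le_1)

lemma subsphere_mean_orthogonal:
  fixes g :: "'a::euclidean_space \<Rightarrow> 'a"
  assumes g: "orthogonal_transformation g" and H: "subspace H" and f: "f \<in> borel_measurable borel"
  shows "subsphere_mean f (g ` H) = subsphere_mean (\<lambda>x. f (g x)) H"
proof -
  have gH: "subspace (g ` H)"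
    using linear_subspace_image[OF orthogonal_transformation_linear[OF g] H] .
  have "(\<lambda>z. f (sgn (closest_point (g ` H) z))) \<in> borel_measurable borel"
    using f measurable_sgn_closest_point[OF gH] by measurable
  then have "(\<integral>z. f (sgn (closest_point (g ` H) z)) \<partial>ball_uniform)
      = (\<integral>z. f (sgn (closest_point (g ` H) (g z))) \<partial>ball_uniform)"
    by (rule integral_ball_uniform_orthogonal[OF g, symmetric])
  then show ?thesis
    by (simp add: subsphere_mean_def closest_point_orthogonal_image[OF g H]
        orthogonal_transformation_sgn[OF g])
qed

lemma sgn_closest_point_in: "subspace H \<Longrightarrow> sgn (closest_point H z) \<in> H" for H :: "'a::euclidean_space set"
  using closest_point_subspace(1) sgn_in_subspace by blast

lemma subsphere_mean_cong:
  fixes H :: "'a::euclidean_space set"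
  assumes "subspace H" "\<And>x. x \<in> H \<Longrightarrow> f x = g x"
  shows "subsphere_mean f H = subsphere_mean g H"
  unfolding subsphere_mean_def
  by (intro Bochner_Integration.integral_cong refl assms(2) sgn_closest_point_in assms(1))

lemma subsphere_mean_odd_power:
  assumes H: "subspace H"
  shows "subsphere_mean (\<lambda>x. (x \<bullet> u) ^ Suc (2 * k)) H = 0"
proof -
  let ?f = "\<lambda>x. (x \<bullet> u) ^ Suc (2 * k)"
  have o: "orthogonal_transformation (uminus :: 'a \<Rightarrow> 'a)"
    by (simp add: orthogonal_transformation_def linear_uminus)
  have "uminus ` H = H"
  proof
    show "uminus ` H \<subseteq> H" using H by (auto simp: subspace_neg)
    show "H \<subseteq> uminus ` H"
    proof
      fix x assume "x \<in> H"
      then show "x \<in> uminus ` H" using H by (intro image_eqI[of _ _ "- x"]) (simp_all add: subspace_neg)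
    qed
  qed
  then have "subsphere_mean ?f H = subsphere_mean (\<lambda>x. ?f (- x)) H"
    using subsphere_mean_orthogonal[OF o H, of ?f] by simp
  also have "(\<lambda>x. ?f (- x)) = (\<lambda>x. - 1 * ?f x)"
    by (simp add: fun_eq_iff)
  also have "subsphere_mean \<dots> H = - 1 * subsphere_mean ?f H"
    by (rule subsphere_mean_cmult)
  finally show ?thesis by simp
qed


section \<open>Moments of coordinates\<close>

lemma plane_eq_span:
  fixes H :: "'a::euclidean_space set"
  assumes H: "subspace H" "dim H = 2" and a: "a \<in> H" "norm a = 1" and b: "b \<in> H" "norm b = 1"
    and ab: "a \<bullet> b = 0"
  shows "H = span {a, b}"
proof -
  have ne: "a \<noteq> b" using a ab by (auto simp: norm_eq_1)
  have "pairwise orthogonal {a, b}"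
    using ab by (auto simp: pairwise_def orthogonal_def inner_commute)
  then have "independent {a, b}"
    using a b by (intro pairwise_orthogonal_independent) auto
  then have "dim (span {a, b}) = 2" using ne by (simp add: dim_eq_card_independent)
  moreover have "span {a, b} \<subseteq> H" using a b H by (simp add: span_minimal)
  ultimately show ?thesis using H subspace_dim_equal[of "span {a, b}" H] by auto
qed

lemma plane_projection:
  fixes H :: "'a::euclidean_space set"
  assumes H: "subspace H" "dim H = 2" and a: "a \<in> H" "norm a = 1" and b: "b \<in> H" "norm b = 1"
    and ab: "a \<bullet> b = 0"
  shows "closest_point H u = (a \<bullet> u) *\<^sub>R a + (b \<bullet> u) *\<^sub>R b"
    and "(norm (closest_point H u))\<^sup>2 = (a \<bullet> u)\<^sup>2 + (b \<bullet> u)\<^sup>2"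
proof -
  let ?p = "(a \<bullet> u) *\<^sub>R a + (b \<bullet> u) *\<^sub>R b"
  have n: "a \<bullet> a = 1" "b \<bullet> b = 1" "b \<bullet> a = 0"
    using a b ab by (auto simp: norm_eq_1 inner_commute)
  show eq: "closest_point H u = ?p"
  proof (rule closest_point_subspace_eqI[OF H(1)])
    show "?p \<in> H" using a b H by (simp add: subspace_add subspace_scale)
    fix h assume "h \<in> H"
    then have "h \<in> span {a, b}" using plane_eq_span[OF assms] by simp
    moreover have "orthogonal (u - ?p) y" if "y \<in> {a, b}" for y
      using that n ab
      by (auto simp: orthogonal_def inner_diff_left inner_add_left inner_commute[of u])
    ultimately show "(u - ?p) \<bullet> h = 0"
      using orthogonal_to_span[of h "{a, b}" "u - ?p"] by (simp add: orthogonal_def)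
  qed
  have "(norm ?p)\<^sup>2 = ?p \<bullet> ?p" by (simp add: power2_norm_eq_inner)
  also have "\<dots> = (a \<bullet> u)\<^sup>2 + (b \<bullet> u)\<^sup>2"
    using n ab by (simp add: inner_add_left inner_add_right power2_eq_square)
  finally show "(norm (closest_point H u))\<^sup>2 = (a \<bullet> u)\<^sup>2 + (b \<bullet> u)\<^sup>2" by (simp add: eq)
qed

text \<open>
  An orthogonal map that carries an orthonormal basis starting with \<open>a\<close> to one starting with \<open>a'\<close> also carries
  \<open>H\<close> to \<open>H'\<close>.
\<close>

lemma plane_marginal:
  fixes H H' :: "'a::euclidean_space set"
  assumes H: "subspace H" "dim H = 2" "a \<in> H" "norm a = 1"
    and H': "subspace H'" "dim H' = 2" "a' \<in> H'" "norm a' = 1"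
    and \<phi>: "\<phi> \<in> borel_measurable borel"
  shows "subsphere_mean (\<lambda>x. \<phi> (x \<bullet> a)) H = subsphere_mean (\<lambda>x. \<phi> (x \<bullet> a')) H'"
proof -
  obtain b where b: "b \<in> H" "norm b = 1" "a \<bullet> b = 0"
    using exists_orthonormal_in_subspace[OF H(1)] H(2) by (metis order_refl)
  obtain b' where b': "b' \<in> H'" "norm b' = 1" "a' \<bullet> b' = 0"
    using exists_orthonormal_in_subspace[OF H'(1)] H'(2) by (metis order_refl)
  obtain g where g: "orthogonal_transformation g" "g a = a'" "g b = b'"
    using orthogonal_frame_map[OF H(4) b(2,3) H'(4) b'(2,3)] by metis
  have "g ` H = span (g ` {a, b})"
    using linear_span_image[OF orthogonal_transformation_linear[OF g(1)], of "{a, b}"]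
      plane_eq_span[OF H b] by simp
  then have gH: "g ` H = H'" using plane_eq_span[OF H' b'] g by simp
  have "(\<lambda>x. \<phi> (x \<bullet> a')) \<in> borel_measurable borel" using \<phi> by measurable
  then have "subsphere_mean (\<lambda>x. \<phi> (x \<bullet> a')) H' = subsphere_mean (\<lambda>x. \<phi> (g x \<bullet> g a)) H"
    using subsphere_mean_orthogonal[OF g(1) H(1), of "\<lambda>x. \<phi> (x \<bullet> a')"] gH g(2) by simp
  then show ?thesis using g(1) by (simp add: orthogonal_transformation_def)
qed

lemma orthogonal_complement_marginal:
  fixes e a e' a' :: "'a::euclidean_space"
  assumes e: "norm e = 1" "norm a = 1" "e \<bullet> a = 0"
    and e': "norm e' = 1" "norm a' = 1" "e' \<bullet> a' = 0"
    and \<phi>: "\<phi> \<in> borel_measurable borel"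
  shows "subsphere_mean (\<lambda>x. \<phi> (x \<bullet> a)) {y. e \<bullet> y = 0} = subsphere_mean (\<lambda>x. \<phi> (x \<bullet> a')) {y. e' \<bullet> y = 0}"
proof -
  obtain g where g: "orthogonal_transformation g" "g e = e'" "g a = a'"
    using orthogonal_frame_map[OF e e'] by metis
  have gi: "g x \<bullet> g y = x \<bullet> y" for x y using g(1) by (simp add: orthogonal_transformation_def)
  have gH: "g ` {y. e \<bullet> y = 0} = {y. e' \<bullet> y = 0}"
  proof (intro equalityI subsetI)
    fix y assume y: "y \<in> {y. e' \<bullet> y = 0}"
    obtain x where x: "y = g x" using orthogonal_transformation_surj[OF g(1)] by (metis surjD)
    then have "e \<bullet> x = 0" using y gi[of e x] g(2) by simp
    then show "y \<in> g ` {y. e \<bullet> y = 0}" using x by blast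
  next
    fix y assume "y \<in> g ` {y. e \<bullet> y = 0}"
    then obtain x where "e \<bullet> x = 0" "y = g x" by blast
    then show "y \<in> {y. e' \<bullet> y = 0}" using gi[of e x] g(2) by simp
  qed
  have "(\<lambda>x. \<phi> (x \<bullet> a')) \<in> borel_measurable borel" using \<phi> by measurable
  then have "subsphere_mean (\<lambda>x. \<phi> (x \<bullet> a')) {y. e' \<bullet> y = 0} = subsphere_mean (\<lambda>x. \<phi> (g x \<bullet> g a)) {y. e \<bullet> y = 0}"
    using subsphere_mean_orthogonal[OF g(1) subspace_hyperplane, of "\<lambda>x. \<phi> (x \<bullet> a')" e] gH g(3) by simp
  then show ?thesis by (simp add: gi)
qed

lemma subsphere_mean_less:
  assumes H: "subspace H" and f: "ball_bounded_borel f" "ball_bounded_borel g"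
    and less: "AE z in ball_uniform. f (sgn (closest_point H z)) < g (sgn (closest_point H z))"
  shows "subsphere_mean f H < subsphere_mean g H"
  unfolding subsphere_mean_def
  using integrable_subsphere_mean[OF H f(1)] integrable_subsphere_mean[OF H f(2)] less
  by (rule ball_uniform.integral_less_AE_space) simp

lemma sgn_inner: "sgn x \<bullet> a = (x \<bullet> a) / norm x" for x :: "'a::real_inner"
  by (simp add: sgn_div_norm divide_inverse_commute)

lemma AE_sgn_closest_point_inner:
  fixes H :: "'a::euclidean_space set"
  assumes "subspace H" "a \<in> H" "a \<noteq> 0"
  shows "AE z in ball_uniform. sgn (closest_point H z) \<bullet> a \<noteq> 0"
  using AE_ball_uniform_inner_neq_0[OF assms(3)]
proof (rule eventually_mono)
  fix z assume "z \<bullet> a \<noteq> 0"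
  then have "closest_point H z \<bullet> a \<noteq> 0" using closest_point_subspace_inner[OF assms(1,2)] by simp
  then show "sgn (closest_point H z) \<bullet> a \<noteq> 0" by (auto simp: sgn_inner)
qed

text \<open>
  The number \<open>\<gamma> k\<close> is the mean of \<open>cos\<close> to the power \<open>2 k\<close> over a period; \<open>\<gamma> 1 = 1/2\<close> because the
  squares of the two coordinates on the circle have equal means and sum to \<open>1\<close>. In the last clause, only
  the component \<open>P u\<close> of \<open>u\<close> in \<open>H\<close> matters, and it is a multiple of a unit vector of \<open>H\<close>.
\<close>

lemma plane_even_moments:
  fixes H0 :: "'a::euclidean_space set"
  assumes H0: "subspace H0" "dim H0 = 2"
  shows "\<exists>\<gamma> :: nat \<Rightarrow> real. \<gamma> 0 = 1 \<and> \<gamma> 1 = 1/2 \<and> (\<forall>k. 0 < \<gamma> k) \<and> (\<forall>k. \<gamma> (Suc k) < \<gamma> k) \<and>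
    (\<forall>(H :: 'a set) u k. subspace H \<longrightarrow> dim H = 2 \<longrightarrow>
      subsphere_mean (\<lambda>x. (x \<bullet> u) ^ (2 * k)) H = \<gamma> k * (norm (closest_point H u)) ^ (2 * k))"
proof -
  have d: "dim H0 \<ge> 2" using H0 by simp
  obtain a where a: "a \<in> H0" "norm a = 1"
    using exists_orthonormal_in_subspace[OF H0(1) d] by blast
  obtain b where b: "b \<in> H0" "norm b = 1" "a \<bullet> b = 0"
    using exists_orthonormal_in_subspace[OF H0(1) d] by blast
  have ne: "a \<noteq> 0" "b \<noteq> 0" using a b by auto
  define \<gamma> where "\<gamma> k = subsphere_mean (\<lambda>x. (x \<bullet> a) ^ (2 * k)) H0" for k
  let ?x = "\<lambda>z. sgn (closest_point H0 z)"
  have AE: "AE z in ball_uniform. (?x z \<bullet> a)\<^sup>2 + (?x z \<bullet> b)\<^sup>2 = 1 \<and> ?x z \<bullet> a \<noteq> 0 \<and> ?x z \<bullet> b \<noteq> 0"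
    using AE_sgn_closest_point_inner[OF H0(1) a(1) ne(1)] AE_sgn_closest_point_inner[OF H0(1) b(1) ne(2)]
  proof eventually_elim
    case (elim z)
    have "closest_point H0 z \<noteq> 0" using elim(1) by auto
    then have "norm (?x z) = 1" by (simp add: norm_sgn)
    moreover have "closest_point H0 (?x z) = ?x z"
      using sgn_closest_point_in[OF H0(1)] by (rule closest_point_self)
    ultimately show ?case
      using plane_projection(2)[OF H0 a b, of "?x z"] elim by (simp add: inner_commute)
  qed
  have \<gamma>0: "\<gamma> 0 = 1" by (simp add: \<gamma>_def)
  have pos: "0 < \<gamma> k" for k
  proof -
    have "subsphere_mean (\<lambda>x. 0) H0 < \<gamma> k"
      unfolding \<gamma>_def
    proof (rule subsphere_mean_less[OF H0(1)])
      show "AE z in ball_uniform. 0 < (?x z \<bullet> a) ^ (2 * k)"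
        using AE by (rule eventually_mono) (simp add: zero_less_power2 power_mult)
    qed auto
    then show ?thesis by simp
  qed
  have dec: "\<gamma> (Suc k) < \<gamma> k" for k
    unfolding \<gamma>_def
  proof (rule subsphere_mean_less[OF H0(1)])
    show "AE z in ball_uniform. (?x z \<bullet> a) ^ (2 * Suc k) < (?x z \<bullet> a) ^ (2 * k)"
      using AE
    proof (rule eventually_mono)
      fix z assume *: "(?x z \<bullet> a)\<^sup>2 + (?x z \<bullet> b)\<^sup>2 = 1 \<and> ?x z \<bullet> a \<noteq> 0 \<and> ?x z \<bullet> b \<noteq> 0"
      then have "0 < (?x z \<bullet> b)\<^sup>2" "0 < (?x z \<bullet> a)\<^sup>2" by simp_all
      then have "(?x z \<bullet> a)\<^sup>2 < 1" using * by linarith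
      then have "((?x z \<bullet> a)\<^sup>2) ^ Suc k < ((?x z \<bullet> a)\<^sup>2) ^ k"
        using \<open>0 < (?x z \<bullet> a)\<^sup>2\<close> by (intro power_strict_decreasing) auto
      then show "(?x z \<bullet> a) ^ (2 * Suc k) < (?x z \<bullet> a) ^ (2 * k)" by (simp only: power_mult)
    qed
  qed (rule ball_bounded_borel_inner_power)+
  have pw: "(\<lambda>t::real. t ^ m) \<in> borel_measurable borel" for m by measurable
  have half: "\<gamma> 1 = 1/2"
  proof -
    have "\<gamma> 1 = subsphere_mean (\<lambda>x. (x \<bullet> b) ^ 2) H0"
      unfolding \<gamma>_def using plane_marginal[OF H0 a H0 b(1,2) pw, of 2] by simp
    then have "2 * \<gamma> 1 = subsphere_mean (\<lambda>x. (x \<bullet> a)^2 + (x \<bullet> b)^2) H0"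
      by (subst subsphere_mean_add[OF H0(1)]) (auto simp: \<gamma>_def)
    also have "\<dots> = (\<integral>z. 1 \<partial>(ball_uniform :: 'a measure))"
      unfolding subsphere_mean_def
    proof (rule integral_cong_AE)
      show "(\<lambda>z. (?x z \<bullet> a)^2 + (?x z \<bullet> b)^2) \<in> borel_measurable ball_uniform"
        using measurable_sgn_closest_point[OF H0(1)] by measurable
    qed (use AE in \<open>auto elim: eventually_mono\<close>)
    finally show ?thesis by simp
  qed
  have main: "subsphere_mean (\<lambda>x. (x \<bullet> u) ^ (2 * k)) H = \<gamma> k * (norm (closest_point H u)) ^ (2 * k)"
    if H: "subspace H" "dim H = 2" for H :: "'a set" and u k
  proof -
    define p where "p = closest_point H u"
    have pH: "p \<in> H" using closest_point_subspace(1)[OF H(1)] by (simp add: p_def)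
    have xu: "x \<bullet> u = x \<bullet> p" if "x \<in> H" for x
      using closest_point_subspace_inner[OF H(1) that, of u] by (simp add: p_def inner_commute)
    define a' where "a' = (if p = 0 then (SOME a'. a' \<in> H \<and> norm a' = 1) else sgn p)"
    have "\<exists>a'. a' \<in> H \<and> norm a' = 1"
      using exists_orthonormal_in_subspace[OF H(1)] H(2) by (metis order_refl)
    then have a': "a' \<in> H" "norm a' = 1"
      using someI_ex[of "\<lambda>a'. a' \<in> H \<and> norm a' = 1"] sgn_in_subspace[OF H(1) pH]
      by (auto simp: a'_def norm_sgn)
    have "p = norm p *\<^sub>R a'" by (simp add: a'_def sgn_div_norm)
    then have xa: "x \<bullet> p = norm p * (x \<bullet> a')" for x by (metis inner_scaleR_right)
    have "subsphere_mean (\<lambda>x. (x \<bullet> u) ^ (2 * k)) H = subsphere_mean (\<lambda>x. norm p ^ (2 * k) * (x \<bullet> a') ^ (2 * k)) H"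
      by (rule subsphere_mean_cong[OF H(1)]) (simp add: xu xa power_mult_distrib)
    also have "\<dots> = norm p ^ (2 * k) * \<gamma> k"
      using plane_marginal[OF H a' H0 a pw, of "2 * k"] by (simp add: subsphere_mean_cmult \<gamma>_def)
    finally show ?thesis by (simp add: p_def)
  qed
  show ?thesis
    by (intro exI[of _ \<gamma>] conjI allI impI \<gamma>0 half pos dec main)
qed

text \<open>
  The squared length of \<open>x\<close> exceeds \<open>(x \<bullet> a)\<^sup>2\<close> by that of its component orthogonal to \<open>a\<close>, which does not
  vanish because it has a nonzero product with \<open>c\<close>.
\<close>

lemma inner_square_less_1:
  fixes x a c :: "'a::real_inner"
  assumes x: "norm x \<le> 1" and a: "norm a = 1" and c: "a \<bullet> c = 0" "x \<bullet> c \<noteq> 0"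
  shows "(x \<bullet> a)\<^sup>2 < 1"
proof -
  define d where "d = x - (x \<bullet> a) *\<^sub>R a"
  have "d \<bullet> c = x \<bullet> c" using c(1) by (simp add: d_def inner_diff_left)
  then have "d \<noteq> 0" using c(2) by auto
  then have "0 < d \<bullet> d" by simp
  also have "d \<bullet> d = x \<bullet> x - (x \<bullet> a)\<^sup>2"
    using a by (simp add: d_def inner_diff_left inner_diff_right inner_commute norm_eq_1 power2_eq_square)
  also have "x \<bullet> x \<le> 1"
    using x power_le_one[of "norm x" 2] by (simp add: power2_norm_eq_inner)
  finally show ?thesis by simp
qed

text \<open>
  Write \<open>u\<close> as \<open>t e + r a\<close> with a unit vector \<open>a\<close> orthogonal to \<open>e\<close> and \<open>r\<^sup>2 = 1 - t\<^sup>2\<close>, and put \<open>s = v \<bullet> a\<close>. Then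
  \<open>t\<^sup>2 + (v \<bullet> u)\<^sup>2 = t\<^sup>2 (1 - s\<^sup>2) + s\<^sup>2\<close>, and the binomial theorem gives the expansion in powers of
  \<open>t\<^sup>2\<close>, with coefficients that depend on the law of \<open>s\<close> only. The leading one, \<open>\<kappa> k k\<close>, is the mean of
  \<open>(1 - s\<^sup>2) ^ k\<close>. In dimension 2 one would have \<open>s\<^sup>2 = 1\<close> almost surely, and it would vanish for \<open>k > 0\<close>.
\<close>

lemma orthogonal_complement_moments:
  assumes n: "DIM('a::euclidean_space) \<ge> 3"
  shows "\<exists>\<kappa> :: nat \<Rightarrow> nat \<Rightarrow> real. \<kappa> 0 0 = 1 \<and> (\<forall>k. 0 < \<kappa> k k) \<and> (\<forall>k. \<kappa> (Suc k) (Suc k) \<le> \<kappa> k k) \<and>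
    (\<forall>(e :: 'a) u k. norm e = 1 \<longrightarrow> norm u = 1 \<longrightarrow>
      subsphere_mean (\<lambda>v. ((e \<bullet> u)\<^sup>2 + (v \<bullet> u)\<^sup>2) ^ k) {y. e \<bullet> y = 0} = (\<Sum>j\<le>k. \<kappa> k j * (e \<bullet> u) ^ (2 * j)))"
proof -
  have U: "subspace (UNIV :: 'a set)" "dim (UNIV :: 'a set) \<ge> 2" using n by auto
  have ex: "\<exists>a. norm a = 1 \<and> e \<bullet> a = 0" for e :: 'a
    using exists_orthonormal_in_subspace[OF U] by metis
  obtain e0 a0 :: 'a where 0: "norm e0 = 1" "norm a0 = 1" "e0 \<bullet> a0 = 0"
    using ex[of 0] ex by blast
  let ?K = "{y :: 'a. e0 \<bullet> y = 0}"
  have K: "subspace ?K" by (rule subspace_hyperplane)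
  define m where "m k j = subsphere_mean (\<lambda>v. (1 - (v \<bullet> a0)\<^sup>2) ^ j * ((v \<bullet> a0)\<^sup>2) ^ (k - j)) ?K" for k j
  have bb: "ball_bounded_borel (\<lambda>v::'a. (1 - (v \<bullet> a)\<^sup>2) ^ j * ((v \<bullet> a)\<^sup>2) ^ i)" for a i j
    by (intro ball_bounded_borel_continuous continuous_intros)
  have bb': "ball_bounded_borel (\<lambda>v::'a. (1 - (v \<bullet> a)\<^sup>2) ^ j)" for a j
    by (intro ball_bounded_borel_continuous continuous_intros)
  have le1: "(x \<bullet> a)\<^sup>2 \<le> 1" if "norm x \<le> 1" "norm a = 1" for x a :: 'a
    using Cauchy_Schwarz_ineq2[of x a] that by (simp add: abs_square_le_1)
  have dec: "m (Suc k) (Suc k) \<le> m k k" for k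
    unfolding m_def diff_self_eq_0 power_0 mult_1_right
  proof (rule subsphere_mean_mono[OF K bb' bb'])
    fix x :: 'a assume "norm x \<le> 1"
    then show "(1 - (x \<bullet> a0)\<^sup>2) ^ Suc k \<le> (1 - (x \<bullet> a0)\<^sup>2) ^ k"
      using le1[of x a0] 0 by (intro power_decreasing) auto
  qed
  have pos: "0 < m k k" for k
  proof -
    \<comment> \<open>A third direction is what keeps the coordinate along \<open>a0\<close> away from \<open>1\<close>.\<close>
    obtain c where c: "c \<noteq> 0" "e0 \<bullet> c = 0" "a0 \<bullet> c = 0"
    proof -
      have "dim {e0, a0} \<le> card {e0, a0}" by (intro dim_le_card') simp
      also have "\<dots> \<le> 2" by (simp add: card_insert_if)
      finally have "dim {e0, a0} < DIM('a)" using n by simp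
      then obtain x where "x \<noteq> 0" "\<And>y. y \<in> span {e0, a0} \<Longrightarrow> orthogonal x y"
        using orthogonal_to_subspace_exists by blast
      then show ?thesis
        by (intro that[of x]) (auto simp: orthogonal_def inner_commute span_base)
    qed
    have "subsphere_mean (\<lambda>x. 0) ?K < m k k"
      unfolding m_def diff_self_eq_0 power_0 mult_1_right
    proof (rule subsphere_mean_less[OF K _ bb'])
      have "AE z in ball_uniform. sgn (closest_point ?K z) \<bullet> c \<noteq> 0"
        using c by (intro AE_sgn_closest_point_inner[OF K]) auto
      then show "AE z in ball_uniform. 0 < (1 - (sgn (closest_point ?K z) \<bullet> a0)\<^sup>2) ^ k"
      proof (rule eventually_mono)
        fix z assume z: "sgn (closest_point ?K z) \<bullet> c \<noteq> 0"
        have "(sgn (closest_point ?K z) \<bullet> a0)\<^sup>2 < 1"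
          using norm_sgn_le_1 0(2) c(3) z by (rule inner_square_less_1)
        then show "0 < (1 - (sgn (closest_point ?K z) \<bullet> a0)\<^sup>2) ^ k" by simp
      qed
    qed auto
    then show ?thesis by simp
  qed
  have main: "subsphere_mean (\<lambda>v. ((e \<bullet> u)\<^sup>2 + (v \<bullet> u)\<^sup>2) ^ k) {y. e \<bullet> y = 0}
      = (\<Sum>j\<le>k. (real (k choose j) * m k j) * (e \<bullet> u) ^ (2 * j))"
    if e: "norm e = 1" and u: "norm u = 1" for e u :: 'a and k
  proof -
    let ?E = "{y :: 'a. e \<bullet> y = 0}" and ?t = "e \<bullet> u"
    have E: "subspace ?E" by (rule subspace_hyperplane)
    define w where "w = u - ?t *\<^sub>R e"
    have ew: "e \<bullet> w = 0" using e by (simp add: w_def inner_diff_right norm_eq_1)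
    have w2: "(norm w)\<^sup>2 = 1 - ?t\<^sup>2"
    proof -
      have "(norm w)\<^sup>2 = w \<bullet> w" by (simp add: power2_norm_eq_inner)
      also have "\<dots> = u \<bullet> u - ?t\<^sup>2"
        using e by (simp add: w_def inner_diff_left inner_diff_right inner_commute norm_eq_1 power2_eq_square)
      finally show ?thesis using u by (simp add: norm_eq_1)
    qed
    obtain a where a: "norm a = 1" "e \<bullet> a = 0" "w = norm w *\<^sub>R a"
    proof (cases "w = 0")
      case True
      then show ?thesis using ex[of e] that by auto
    next
      case False
      then show ?thesis
        using ew by (intro that[of "sgn w"]) (auto simp: norm_sgn sgn_div_norm)
    qed
    have vu: "v \<bullet> u = norm w * (v \<bullet> a)" if "v \<in> ?E" for v
    proof -
      have "v \<bullet> u = v \<bullet> w" using that by (simp add: w_def inner_diff_right inner_commute)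
      also have "\<dots> = norm w * (v \<bullet> a)" using a(3) by (metis inner_scaleR_right)
      finally show ?thesis .
    qed
    have expand: "(?t\<^sup>2 + (v \<bullet> u)\<^sup>2) ^ k
        = (\<Sum>j\<le>k. (real (k choose j) * ?t ^ (2 * j)) * ((1 - (v \<bullet> a)\<^sup>2) ^ j * ((v \<bullet> a)\<^sup>2) ^ (k - j)))"
      if "v \<in> ?E" for v
    proof -
      have "?t\<^sup>2 + (v \<bullet> u)\<^sup>2 = ?t\<^sup>2 * (1 - (v \<bullet> a)\<^sup>2) + (v \<bullet> a)\<^sup>2"
        by (simp add: vu[OF that] power_mult_distrib w2 algebra_simps)
      then show ?thesis
        unfolding power_mult[of ?t 2] by (simp only: binomial_ring power_mult_distrib mult_ac)
    qed
    have "subsphere_mean (\<lambda>v. (?t\<^sup>2 + (v \<bullet> u)\<^sup>2) ^ k) ?E = (\<Sum>j\<le>k. (real (k choose j) * ?t ^ (2 * j)) *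
        subsphere_mean (\<lambda>v. (1 - (v \<bullet> a)\<^sup>2) ^ j * ((v \<bullet> a)\<^sup>2) ^ (k - j)) ?E)"
      unfolding subsphere_mean_cmult[symmetric]
      by (subst subsphere_mean_sum[OF E, symmetric])
        (auto intro!: subsphere_mean_cong[OF E] ball_bounded_borel_mult bb simp: expand)
    moreover have "subsphere_mean (\<lambda>v. (1 - (v \<bullet> a)\<^sup>2) ^ j * ((v \<bullet> a)\<^sup>2) ^ (k - j)) ?E = m k j" for j
      unfolding m_def
      by (rule orthogonal_complement_marginal[OF e a(1,2) 0, of "\<lambda>s. (1 - s\<^sup>2) ^ j * (s\<^sup>2) ^ (k - j)"]) measurable
    ultimately show ?thesis by (simp add: mult_ac)
  qed
  show ?thesis
  proof (intro exI[of _ "\<lambda>k j. real (k choose j) * m k j"] conjI allI impI main)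
    show "real (0 choose 0) * m 0 0 = 1" by (simp add: m_def)
  qed (use pos dec in simp_all)
qed


section \<open>The quadratic form of the great circle transform\<close>

definition sphere_inner :: "('a::euclidean_space \<Rightarrow> real) \<Rightarrow> ('a \<Rightarrow> real) \<Rightarrow> real" where
  "sphere_inner f g = subsphere_mean (\<lambda>x. f x * g x) UNIV"

lemma sphere_inner_commute: "sphere_inner f g = sphere_inner g f"
  by (simp add: sphere_inner_def mult.commute)

lemma sphere_inner_cmult: "sphere_inner h (\<lambda>x. c * f x) = c * sphere_inner h f"
  using subsphere_mean_cmult[of c "\<lambda>x. h x * f x" UNIV] by (simp add: sphere_inner_def mult_ac)

lemma sphere_inner_add:
  assumes "ball_bounded_borel h" "ball_bounded_borel f" "ball_bounded_borel g"
  shows "sphere_inner h (\<lambda>x. f x + g x) = sphere_inner h f + sphere_inner h g"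
  unfolding sphere_inner_def distrib_left
  using assms by (intro subsphere_mean_add subspace_UNIV ball_bounded_borel_mult)

lemma sphere_inner_sum:
  assumes "ball_bounded_borel h" "\<And>i. i \<in> I \<Longrightarrow> ball_bounded_borel (f i)"
  shows "sphere_inner h (\<lambda>x. \<Sum>i\<in>I. f i x) = (\<Sum>i\<in>I. sphere_inner h (f i))"
  unfolding sphere_inner_def sum_distrib_left
  using assms by (intro subsphere_mean_sum subspace_UNIV ball_bounded_borel_mult)

lemma sphere_inner_self_nonneg: "0 \<le> sphere_inner f f"
  by (simp add: sphere_inner_def subsphere_mean_def)

context random_plane
begin

definition circle_form :: "(real^'n \<Rightarrow> real) \<Rightarrow> (real^'n \<Rightarrow> real) \<Rightarrow> real" where
  "circle_form f g = (\<integral>H. subsphere_mean f H * subsphere_mean g H \<partial>\<mu>)"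

lemma measurable_subsphere_mean:
  assumes f: "f \<in> borel_measurable borel"
  shows "subsphere_mean f \<in> borel_measurable \<mu>"
proof -
  have "(\<lambda>(H, z). f (sgn (closest_point H z))) \<in> borel_measurable (\<mu> \<Otimes>\<^sub>M ball_uniform)"
    using f by measurable
  then show ?thesis
    unfolding subsphere_mean_def[abs_def] by (rule ball_uniform.borel_measurable_lebesgue_integral)
qed

lemma subsphere_mean_bounded:
  assumes f: "ball_bounded_borel f"
  obtains C where "C \<ge> 0" "\<And>H. H \<in> space \<mu> \<Longrightarrow> \<bar>subsphere_mean f H\<bar> \<le> C"
proof -
  obtain C where C: "C \<ge> 0" "\<And>x. norm x \<le> 1 \<Longrightarrow> \<bar>f x\<bar> \<le> C"
    using ball_bounded_borelE[OF f] by blast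
  have "\<bar>subsphere_mean f H\<bar> \<le> C" if "H \<in> space \<mu>" for H
  proof -
    have H: "subspace H" using that by (rule planeD)
    have "subsphere_mean f H \<le> subsphere_mean (\<lambda>x. C) H"
      using C(2) by (intro subsphere_mean_mono H f) (auto simp: abs_le_iff)
    moreover have "subsphere_mean (\<lambda>x. - C) H \<le> subsphere_mean f H"
      using C(2) by (intro subsphere_mean_mono H f) (force simp: abs_le_iff)+
    ultimately show ?thesis by simp
  qed
  then show ?thesis using that C(1) by blast
qed

lemma integrable_mean_mult:
  assumes f: "ball_bounded_borel f" and g: "ball_bounded_borel g"
  shows "integrable \<mu> (\<lambda>H. subsphere_mean f H * subsphere_mean g H)"
proof -
  obtain C where C: "C \<ge> 0" "\<And>H. H \<in> space \<mu> \<Longrightarrow> \<bar>subsphere_mean f H\<bar> \<le> C"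
    using subsphere_mean_bounded[OF f] by blast
  obtain D where D: "D \<ge> 0" "\<And>H. H \<in> space \<mu> \<Longrightarrow> \<bar>subsphere_mean g H\<bar> \<le> D"
    using subsphere_mean_bounded[OF g] by blast
  show ?thesis
  proof (rule integrable_const_bound[of _ "C * D"])
    show "AE H in \<mu>. norm (subsphere_mean f H * subsphere_mean g H) \<le> C * D"
      using C D by (intro AE_I2) (auto simp: abs_mult intro!: mult_mono)
  qed (intro borel_measurable_times measurable_subsphere_mean ball_bounded_borel_measurable f g)
qed

lemma circle_form_commute: "circle_form f g = circle_form g f"
  by (simp add: circle_form_def mult.commute)

lemma circle_form_cmult: "circle_form h (\<lambda>x. c * f x) = c * circle_form h f"
  by (simp add: circle_form_def subsphere_mean_cmult mult.left_commute)

lemma circle_form_add: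
  assumes "ball_bounded_borel h" "ball_bounded_borel f" "ball_bounded_borel g"
  shows "circle_form h (\<lambda>x. f x + g x) = circle_form h f + circle_form h g"
proof -
  have "circle_form h (\<lambda>x. f x + g x)
      = (\<integral>H. subsphere_mean h H * subsphere_mean f H + subsphere_mean h H * subsphere_mean g H \<partial>\<mu>)"
    unfolding circle_form_def using assms
    by (intro Bochner_Integration.integral_cong refl) (simp add: subsphere_mean_add planeD distrib_left)
  then show ?thesis
    unfolding circle_form_def
    using assms by (simp add: Bochner_Integration.integral_add integrable_mean_mult)
qed

lemma circle_form_zero [simp]: "circle_form h (\<lambda>x. 0) = 0"
  by (simp add: circle_form_def)

lemma circle_form_sum:
  assumes h: "ball_bounded_borel h" and I: "finite I" and f: "\<And>i. i \<in> I \<Longrightarrow> ball_bounded_borel (f i)"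
  shows "circle_form h (\<lambda>x. \<Sum>i\<in>I. f i x) = (\<Sum>i\<in>I. circle_form h (f i))"
  using I f
proof (induction I)
  case (insert i I)
  have "ball_bounded_borel (\<lambda>x. \<Sum>i\<in>I. f i x)" using insert.prems by auto
  then show ?case using insert h by (simp add: circle_form_add)
qed simp

lemma circle_form_odd_power: "circle_form h (\<lambda>x. (x \<bullet> u) ^ Suc (2 * k)) = 0"
proof -
  have "circle_form h (\<lambda>x. (x \<bullet> u) ^ Suc (2 * k)) = (\<integral>H. 0 \<partial>\<mu>)"
    unfolding circle_form_def
    by (intro Bochner_Integration.integral_cong refl)
      (simp add: subsphere_mean_odd_power planeD(1) del: power_Suc)
  then show ?thesis by simp
qed

text \<open>
  For almost all \<open>z\<close> and \<open>w\<close> the Gram-Schmidt pair of their projections is an orthonormal basis of \<open>H\<close>, so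
  the inner integrand does not depend on \<open>w\<close>.
\<close>

lemma projected_moment_eq_frame_mean:
  assumes H: "H \<in> space \<mu>" and h: "ball_bounded_borel h" and u: "norm u = 1"
  shows "subsphere_mean h H * norm (closest_point H u) ^ (2 * k)
    = (\<integral>z. (\<integral>w. (\<lambda>(x, v). h x * ((x \<bullet> u)\<^sup>2 + (v \<bullet> u)\<^sup>2) ^ k)
        (gs_frame (closest_point H z) (closest_point H w)) \<partial>ball_uniform) \<partial>ball_uniform)"
proof -
  note H' = planeD[OF H]
  let ?\<Phi> = "\<lambda>(x, v). h x * ((x \<bullet> u)\<^sup>2 + (v \<bullet> u)\<^sup>2) ^ k"
  let ?P = "closest_point H"
  note [measurable] = borel_measurable_closest_point_subspace[OF H'(1)] ball_bounded_borel_measurable[OF h]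
  have \<Phi> [measurable]: "?\<Phi> \<in> borel_measurable borel"
    unfolding borel_prod[symmetric] by measurable
  have frame_value: "?\<Phi> (gs_frame (?P z) (?P w)) = h (sgn (?P z)) * norm (?P u) ^ (2 * k)"
    if fr: "gs_frame (?P z) (?P w) \<in> orthonormal_frames" for z w
  proof -
    obtain x v where xv: "gs_frame (?P z) (?P w) = (x, v)" by (cases "gs_frame (?P z) (?P w)")
    have x: "x = sgn (?P z)" using xv by (simp add: gs_frame_def)
    have "x \<in> H" "v \<in> H"
      using gs_frame_in_subspace[OF H'(1), of "?P z" "?P w"] closest_point_subspace(1)[OF H'(1)] xv
      by auto
    then have "(norm (?P u))\<^sup>2 = (x \<bullet> u)\<^sup>2 + (v \<bullet> u)\<^sup>2"
      using fr xv by (intro plane_projection(2)[OF H']) (auto simp: orthonormal_frames_def)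
    then show ?thesis by (simp add: xv x power_mult)
  qed
  have "(\<integral>z. (\<integral>w. ?\<Phi> (gs_frame (?P z) (?P w)) \<partial>ball_uniform) \<partial>ball_uniform)
      = (\<integral>z. h (sgn (?P z)) * norm (?P u) ^ (2 * k) \<partial>ball_uniform)"
  proof (rule integral_cong_AE)
    have "(\<lambda>(z, w). ?\<Phi> (gs_frame (?P z) (?P w))) \<in> borel_measurable (ball_uniform \<Otimes>\<^sub>M ball_uniform)"
      by measurable
    then show "(\<lambda>z. \<integral>w. ?\<Phi> (gs_frame (?P z) (?P w)) \<partial>ball_uniform) \<in> borel_measurable ball_uniform"
      by (rule ball_uniform.borel_measurable_lebesgue_integral)
    show "AE z in ball_uniform. (\<integral>w. ?\<Phi> (gs_frame (?P z) (?P w)) \<partial>ball_uniform)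
        = h (sgn (?P z)) * norm (?P u) ^ (2 * k)"
      using AE_gs_frame_orthonormal[OF H'(1) eq_refl[OF H'(2)[symmetric]]]
    proof (rule eventually_mono)
      fix z assume "AE w in ball_uniform. gs_frame (?P z) (?P w) \<in> orthonormal_frames"
      then have "AE w in ball_uniform. ?\<Phi> (gs_frame (?P z) (?P w)) = h (sgn (?P z)) * norm (?P u) ^ (2 * k)"
        by (rule eventually_mono) (rule frame_value)
      then have "(\<integral>w. ?\<Phi> (gs_frame (?P z) (?P w)) \<partial>ball_uniform)
          = (\<integral>w. h (sgn (?P z)) * norm (?P u) ^ (2 * k) \<partial>(ball_uniform :: (real^'n) measure))"
        by (intro integral_cong_AE) measurable
      then show "(\<integral>w. ?\<Phi> (gs_frame (?P z) (?P w)) \<partial>ball_uniform) = h (sgn (?P z)) * norm (?P u) ^ (2 * k)"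
        by simp
    qed
  qed measurable
  then show ?thesis by (simp add: subsphere_mean_def)
qed

lemma gs_frame_complement:
  fixes z w :: "'a::euclidean_space"
  assumes "z \<noteq> 0"
  shows "gs_frame z w = (sgn z, sgn (closest_point {y. sgn z \<bullet> y = 0} w))"
proof -
  have e: "sgn z \<bullet> sgn z = 1" using assms by (simp add: norm_sgn flip: norm_eq_1)
  have "closest_point {y. sgn z \<bullet> y = 0} w = w - (w \<bullet> sgn z) *\<^sub>R sgn z"
    by (rule closest_point_subspace_eqI[OF subspace_hyperplane])
      (use e in \<open>auto simp: inner_diff_right inner_commute\<close>)
  then show ?thesis by (simp add: gs_frame_def)
qed

text \<open>
  The mean of \<open>(x \<bullet> u) ^ (2 * k)\<close> over the circle in \<open>H\<close> is \<open>\<gamma> k * |P u| ^ (2 * k)\<close>. The form is therefore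
  \<open>\<gamma> k\<close> times an expectation over a random orthonormal pair \<open>(x, v)\<close> in a random plane. By \<open>integral_frame_law\<close> the
  plane can be forgotten, and then the integration over \<open>v\<close> for fixed \<open>x\<close> is the one of
  \<open>orthogonal_complement_moments\<close>.
\<close>

lemma circle_form_even_power:
  assumes n: "CARD('n) \<ge> 3"
  shows "\<exists>c :: nat \<Rightarrow> nat \<Rightarrow> real. c 0 0 = 1 \<and> c 1 1 \<le> 1/2 \<and> (\<forall>k. c (Suc k) (Suc k) < c k k) \<and>
    (\<forall>u h k. norm u = 1 \<longrightarrow> ball_bounded_borel h \<longrightarrow>
      circle_form h (\<lambda>x. (x \<bullet> u) ^ (2 * k)) = (\<Sum>j\<le>k. c k j * sphere_inner h (\<lambda>x. (x \<bullet> u) ^ (2 * j))))"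
proof -
  have n': "DIM(real^'n) \<ge> 3" using n by simp
  obtain H0 where "H0 \<in> space \<mu>" using not_empty by blast
  note H0 = planeD[OF this]
  obtain \<gamma> :: "nat \<Rightarrow> real" where \<gamma>: "\<gamma> 0 = 1" "\<gamma> 1 = 1/2" "\<forall>k. 0 < \<gamma> k" "\<forall>k. \<gamma> (Suc k) < \<gamma> k"
    "\<forall>(H :: (real^'n) set) u k. subspace H \<longrightarrow> dim H = 2 \<longrightarrow>
      subsphere_mean (\<lambda>x. (x \<bullet> u) ^ (2 * k)) H = \<gamma> k * (norm (closest_point H u)) ^ (2 * k)"
    using plane_even_moments[OF H0] by (elim exE conjE) (rule that)
  obtain \<kappa> :: "nat \<Rightarrow> nat \<Rightarrow> real" where \<kappa>: "\<kappa> 0 0 = 1" "\<forall>k. 0 < \<kappa> k k" "\<forall>k. \<kappa> (Suc k) (Suc k) \<le> \<kappa> k k"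
    "\<forall>(e :: real^'n) u k. norm e = 1 \<longrightarrow> norm u = 1 \<longrightarrow>
      subsphere_mean (\<lambda>v. ((e \<bullet> u)\<^sup>2 + (v \<bullet> u)\<^sup>2) ^ k) {y. e \<bullet> y = 0} = (\<Sum>j\<le>k. \<kappa> k j * (e \<bullet> u) ^ (2 * j))"
    using orthogonal_complement_moments[OF n'] by (elim exE conjE) (rule that)
  have main: "circle_form h (\<lambda>x. (x \<bullet> u) ^ (2 * k))
      = (\<Sum>j\<le>k. (\<gamma> k * \<kappa> k j) * sphere_inner h (\<lambda>x. (x \<bullet> u) ^ (2 * j)))"
    if u: "norm u = 1" and h: "ball_bounded_borel h" for u h k
  proof -
    note [measurable] = ball_bounded_borel_measurable[OF h]
    define \<Phi> where "\<Phi> = (\<lambda>(x :: real^'n, v :: real^'n). h x * ((x \<bullet> u)\<^sup>2 + (v \<bullet> u)\<^sup>2) ^ k)"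
    have \<Phi> [measurable]: "\<Phi> \<in> borel_measurable borel"
      unfolding \<Phi>_def borel_prod[symmetric] by measurable
    obtain C where C: "C \<ge> 0" "\<And>x. norm x \<le> 1 \<Longrightarrow> \<bar>h x\<bar> \<le> C"
      using ball_bounded_borelE[OF h] by blast
    have bound: "\<bar>\<Phi> (x, v)\<bar> \<le> C * 2 ^ k" if "norm x \<le> 1" "norm v \<le> 1" for x v
    proof -
      have sq: "(y \<bullet> u)\<^sup>2 \<le> 1" if "norm y \<le> 1" for y
        using Cauchy_Schwarz_ineq2[of y u] u that by (simp add: abs_square_le_1)
      have "((x \<bullet> u)\<^sup>2 + (v \<bullet> u)\<^sup>2) ^ k \<le> 2 ^ k"
        using sq[of x] sq[of v] that by (intro power_mono) auto
      then show ?thesis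
        using C that by (auto simp: \<Phi>_def abs_mult intro!: mult_mono)
    qed
    have "circle_form h (\<lambda>x. (x \<bullet> u) ^ (2 * k))
        = (\<integral>H. \<gamma> k * (\<integral>z. (\<integral>w. \<Phi> (gs_frame (closest_point H z) (closest_point H w))
            \<partial>ball_uniform) \<partial>ball_uniform) \<partial>\<mu>)"
      unfolding circle_form_def
    proof (rule Bochner_Integration.integral_cong[OF refl])
      fix H assume H: "H \<in> space \<mu>"
      show "subsphere_mean h H * subsphere_mean (\<lambda>x. (x \<bullet> u) ^ (2 * k)) H
          = \<gamma> k * (\<integral>z. (\<integral>w. \<Phi> (gs_frame (closest_point H z) (closest_point H w)) \<partial>ball_uniform) \<partial>ball_uniform)"
        unfolding \<gamma>(5)[rule_format, OF planeD[OF H]] \<Phi>_def projected_moment_eq_frame_mean[OF H h u, symmetric]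
        by (simp add: mult_ac)
    qed
    also have "\<dots> = \<gamma> k * (\<integral>z. (\<integral>w. \<Phi> (gs_frame z w) \<partial>ball_uniform) \<partial>ball_uniform)"
      using integral_frame_law[OF \<Phi> bound] by simp
    also have "(\<integral>z. (\<integral>w. \<Phi> (gs_frame z w) \<partial>ball_uniform) \<partial>ball_uniform)
        = (\<integral>z. h (sgn z) * (\<Sum>j\<le>k. \<kappa> k j * (sgn z \<bullet> u) ^ (2 * j)) \<partial>ball_uniform)"
    proof (rule integral_cong_AE)
      have "(\<lambda>(z, w). \<Phi> (gs_frame z w)) \<in> borel_measurable (ball_uniform \<Otimes>\<^sub>M ball_uniform)"
        by measurable
      then show "(\<lambda>z. \<integral>w. \<Phi> (gs_frame z w) \<partial>ball_uniform) \<in> borel_measurable ball_uniform"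
        by (rule ball_uniform.borel_measurable_lebesgue_integral)
      have "u \<noteq> 0" using u by auto
      from AE_ball_uniform_inner_neq_0[OF this]
      show "AE z in ball_uniform. (\<integral>w. \<Phi> (gs_frame z w) \<partial>ball_uniform)
          = h (sgn z) * (\<Sum>j\<le>k. \<kappa> k j * (sgn z \<bullet> u) ^ (2 * j))"
      proof (rule eventually_mono)
        fix z assume "z \<bullet> u \<noteq> 0"
        then have z: "z \<noteq> 0" by auto
        let ?e = "sgn z"
        have e: "norm ?e = 1" using z by (simp add: norm_sgn)
        have "(\<integral>w. \<Phi> (gs_frame z w) \<partial>ball_uniform)
            = h ?e * subsphere_mean (\<lambda>v. ((?e \<bullet> u)\<^sup>2 + (v \<bullet> u)\<^sup>2) ^ k) {y. ?e \<bullet> y = 0}"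
          by (simp add: gs_frame_complement[OF z] \<Phi>_def subsphere_mean_def)
        then show "(\<integral>w. \<Phi> (gs_frame z w) \<partial>ball_uniform)
            = h ?e * (\<Sum>j\<le>k. \<kappa> k j * (?e \<bullet> u) ^ (2 * j))"
          by (simp only: \<kappa>(4)[rule_format, OF e u])
      qed
    qed measurable
    also have "\<dots> = sphere_inner h (\<lambda>x. \<Sum>j\<le>k. \<kappa> k j * (x \<bullet> u) ^ (2 * j))"
      by (simp add: sphere_inner_def subsphere_mean_def closest_point_self)
    also have "\<dots> = (\<Sum>j\<le>k. \<kappa> k j * sphere_inner h (\<lambda>x. (x \<bullet> u) ^ (2 * j)))"
      using h by (subst sphere_inner_sum) (auto simp: sphere_inner_cmult)
    finally show ?thesis by (simp add: sum_distrib_left mult.assoc)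
  qed
  show ?thesis
  proof (intro exI[of _ "\<lambda>k j. \<gamma> k * \<kappa> k j"] conjI allI impI main)
    show "\<gamma> 0 * \<kappa> 0 0 = 1" using \<gamma>(1) \<kappa>(1) by simp
    show "\<gamma> 1 * \<kappa> 1 1 \<le> 1/2" unfolding \<gamma>(2) using \<kappa>(1) \<kappa>(3)[rule_format, of 0] by simp
    show "\<gamma> (Suc k) * \<kappa> (Suc k) (Suc k) < \<gamma> k * \<kappa> k k" for k
    proof -
      have "\<gamma> (Suc k) * \<kappa> (Suc k) (Suc k) \<le> \<gamma> (Suc k) * \<kappa> k k"
        using \<gamma>(3) \<kappa>(3) by (intro mult_left_mono) (auto intro: less_imp_le)
      also have "\<dots> < \<gamma> k * \<kappa> k k"
        using \<gamma>(4) \<kappa>(2) by (intro mult_strict_right_mono) auto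
      finally show ?thesis .
    qed
  qed
qed


section \<open>Eigenfunctions\<close>

text \<open>
  An eigenfunction, in the weak sense, of the operator that represents \<open>circle_form\<close> with respect to
  \<open>sphere_inner\<close>. The last clause restricts the eigenvalues to those that are compatible with the
  final estimate: at most \<open>1/2\<close>, or \<open>1\<close> with a constant function.
\<close>

definition eigenfunction :: "real \<Rightarrow> (real^'n \<Rightarrow> real) \<Rightarrow> bool" where
  "eigenfunction \<nu> f \<longleftrightarrow> ball_bounded_borel f \<and>
     (\<forall>h. ball_bounded_borel h \<longrightarrow> circle_form h f = \<nu> * sphere_inner h f) \<and>
     (\<nu> \<le> 1/2 \<or> (\<nu> = 1 \<and> (\<exists>c. f = (\<lambda>x. c))))"

definition eigen_decomposable :: "real set \<Rightarrow> (real^'n \<Rightarrow> real) \<Rightarrow> bool" where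
  "eigen_decomposable \<Lambda> p \<longleftrightarrow> finite \<Lambda> \<and>
     (\<exists>F. (\<forall>\<nu>\<in>\<Lambda>. eigenfunction \<nu> (F \<nu>)) \<and> p = (\<lambda>x. \<Sum>\<nu>\<in>\<Lambda>. F \<nu> x))"

lemma eigenfunction_bounded: "eigenfunction \<nu> f \<Longrightarrow> ball_bounded_borel f"
  by (simp add: eigenfunction_def)

lemma eigenfunctionD:
  "eigenfunction \<nu> f \<Longrightarrow> ball_bounded_borel h \<Longrightarrow> circle_form h f = \<nu> * sphere_inner h f"
  by (simp add: eigenfunction_def)

lemma eigenfunction_add:
  assumes "eigenfunction \<nu> f" "eigenfunction \<nu> g"
  shows "eigenfunction \<nu> (\<lambda>x. f x + g x)"
proof -
  have bb: "ball_bounded_borel f" "ball_bounded_borel g"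
    using assms by (simp_all add: eigenfunction_bounded)
  have "circle_form h (\<lambda>x. f x + g x) = \<nu> * sphere_inner h (\<lambda>x. f x + g x)" if "ball_bounded_borel h" for h
    using that bb assms by (simp add: circle_form_add sphere_inner_add eigenfunctionD distrib_left)
  moreover have "\<nu> \<le> 1/2 \<or> (\<nu> = 1 \<and> (\<exists>c. (\<lambda>x. f x + g x) = (\<lambda>x. c)))"
    using assms unfolding eigenfunction_def by fastforce
  ultimately show ?thesis using bb by (auto simp: eigenfunction_def)
qed

lemma eigenfunction_cmult:
  assumes "eigenfunction \<nu> f"
  shows "eigenfunction \<nu> (\<lambda>x. c * f x)"
proof -
  have "ball_bounded_borel (\<lambda>x. c * f x)"
    using eigenfunction_bounded[OF assms] by auto
  moreover have "circle_form h (\<lambda>x. c * f x) = \<nu> * sphere_inner h (\<lambda>x. c * f x)" if "ball_bounded_borel h" for h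
    using that assms by (simp add: circle_form_cmult sphere_inner_cmult eigenfunctionD)
  moreover have "\<nu> \<le> 1/2 \<or> (\<nu> = 1 \<and> (\<exists>d. (\<lambda>x. c * f x) = (\<lambda>x. d)))"
    using assms unfolding eigenfunction_def by fastforce
  ultimately show ?thesis by (simp add: eigenfunction_def)
qed

lemma eigenfunction_orthogonal:
  assumes f: "eigenfunction \<nu> f" and g: "eigenfunction \<rho> g" and ne: "\<nu> \<noteq> \<rho>"
  shows "sphere_inner f g = 0"
proof -
  have "\<rho> * sphere_inner f g = circle_form f g"
    using eigenfunctionD[OF g eigenfunction_bounded[OF f]] by simp
  also have "\<dots> = \<nu> * sphere_inner g f"
    using eigenfunctionD[OF f eigenfunction_bounded[OF g]] by (simp add: circle_form_commute)
  finally show ?thesis using ne by (simp add: sphere_inner_commute[of g])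
qed

lemma eigen_decomposable_bounded:
  assumes "eigen_decomposable \<Lambda> p"
  shows "ball_bounded_borel p"
  using assms eigenfunction_bounded by (auto simp: eigen_decomposable_def)

lemma eigen_decomposable_eigenfunction: "eigenfunction \<nu> f \<Longrightarrow> eigen_decomposable {\<nu>} f"
  by (auto simp: eigen_decomposable_def)

lemma eigen_decomposable_cmult:
  assumes "eigen_decomposable \<Lambda> p"
  shows "eigen_decomposable \<Lambda> (\<lambda>x. c * p x)"
proof -
  obtain F where F: "finite \<Lambda>" "\<forall>\<nu>\<in>\<Lambda>. eigenfunction \<nu> (F \<nu>)" "p = (\<lambda>x. \<Sum>\<nu>\<in>\<Lambda>. F \<nu> x)"
    using assms by (auto simp: eigen_decomposable_def)
  then show ?thesis
    by (auto simp: eigen_decomposable_def sum_distrib_left eigenfunction_cmult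
        intro!: exI[of _ "\<lambda>\<nu> x. c * F \<nu> x"])
qed

lemma eigen_decomposable_add:
  assumes "eigen_decomposable \<Lambda> p" "eigen_decomposable \<Lambda>' q"
  shows "eigen_decomposable (\<Lambda> \<union> \<Lambda>') (\<lambda>x. p x + q x)"
proof -
  obtain F where F: "finite \<Lambda>" "\<forall>\<nu>\<in>\<Lambda>. eigenfunction \<nu> (F \<nu>)" "p = (\<lambda>x. \<Sum>\<nu>\<in>\<Lambda>. F \<nu> x)"
    using assms(1) by (auto simp: eigen_decomposable_def)
  obtain G where G: "finite \<Lambda>'" "\<forall>\<nu>\<in>\<Lambda>'. eigenfunction \<nu> (G \<nu>)" "q = (\<lambda>x. \<Sum>\<nu>\<in>\<Lambda>'. G \<nu> x)"
    using assms(2) by (auto simp: eigen_decomposable_def)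
  let ?K = "\<lambda>\<nu> x. (if \<nu> \<in> \<Lambda> then F \<nu> x else 0) + (if \<nu> \<in> \<Lambda>' then G \<nu> x else 0)"
  have "eigenfunction \<nu> (?K \<nu>)" if "\<nu> \<in> \<Lambda> \<union> \<Lambda>'" for \<nu>
    using that F(2) G(2)
    by (cases "\<nu> \<in> \<Lambda>"; cases "\<nu> \<in> \<Lambda>'") (simp_all add: eigenfunction_add)
  moreover have "(\<Sum>\<nu>\<in>\<Lambda>. F \<nu> x) + (\<Sum>\<nu>\<in>\<Lambda>'. G \<nu> x) = (\<Sum>\<nu>\<in>\<Lambda> \<union> \<Lambda>'. ?K \<nu> x)" for x
  proof -
    have "(\<Sum>\<nu>\<in>\<Lambda> \<union> \<Lambda>'. if \<nu> \<in> \<Lambda> then F \<nu> x else 0) = (\<Sum>\<nu>\<in>\<Lambda>. F \<nu> x)"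
      using F(1) G(1) by (intro sum.mono_neutral_cong_right) auto
    moreover have "(\<Sum>\<nu>\<in>\<Lambda> \<union> \<Lambda>'. if \<nu> \<in> \<Lambda>' then G \<nu> x else 0) = (\<Sum>\<nu>\<in>\<Lambda>'. G \<nu> x)"
      using F(1) G(1) by (intro sum.mono_neutral_cong_right) auto
    ultimately show ?thesis by (simp add: sum.distrib)
  qed
  ultimately show ?thesis
    using F(1,3) G(1,3) unfolding eigen_decomposable_def
    by (intro conjI exI[of _ ?K]) auto
qed

lemma eigen_decomposable_sum:
  assumes "finite I" "I \<noteq> {}" "\<And>i. i \<in> I \<Longrightarrow> eigen_decomposable (\<Lambda> i) (p i)"
  shows "eigen_decomposable (\<Union>i\<in>I. \<Lambda> i) (\<lambda>x. \<Sum>i\<in>I. p i x)"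
  using assms
proof (induction I rule: finite_ne_induct)
  case (insert i I)
  then have "eigen_decomposable (\<Lambda> i \<union> (\<Union>i\<in>I. \<Lambda> i)) (\<lambda>x. p i x + (\<Sum>i\<in>I. p i x))"
    by (intro eigen_decomposable_add) auto
  then show ?case using insert.hyps by simp
qed simp

text \<open>
  If \<open>T r = \<nu> r + q\<close> and \<open>q\<close> is the sum of eigenfunctions \<open>F \<rho>\<close> with \<open>\<rho> \<noteq> \<nu>\<close>, then
  adding \<open>F \<rho> / (\<nu> - \<rho>)\<close> for all \<open>\<rho>\<close> to \<open>r\<close> yields an eigenfunction for \<open>\<nu>\<close>.
\<close>

lemma eigen_decomposable_triangular:
  assumes r: "ball_bounded_borel r"
    and form: "\<And>h. ball_bounded_borel h \<Longrightarrow> circle_form h r = \<nu> * sphere_inner h r + sphere_inner h q"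
    and q: "eigen_decomposable \<Lambda> q" and \<nu>: "\<nu> \<notin> \<Lambda>" "\<nu> \<le> 1/2"
  shows "eigen_decomposable (insert \<nu> \<Lambda>) r"
proof -
  obtain F where F: "finite \<Lambda>" "\<And>\<rho>. \<rho> \<in> \<Lambda> \<Longrightarrow> eigenfunction \<rho> (F \<rho>)" "q = (\<lambda>x. \<Sum>\<rho>\<in>\<Lambda>. F \<rho> x)"
    using q by (auto simp: eigen_decomposable_def)
  define a where "a \<rho> = 1 / (\<nu> - \<rho>)" for \<rho>
  define s where "s x = (\<Sum>\<rho>\<in>\<Lambda>. a \<rho> * F \<rho> x)" for x
  have bF: "ball_bounded_borel (\<lambda>x. c * F \<rho> x)" if "\<rho> \<in> \<Lambda>" for \<rho> c
    using eigenfunction_bounded[OF F(2)[OF that]] by auto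
  have bs: "ball_bounded_borel s" unfolding s_def[abs_def] using bF by auto
  have "eigenfunction \<nu> (\<lambda>x. r x + s x)"
    unfolding eigenfunction_def
  proof (intro conjI allI impI)
    fix h :: "real^'n \<Rightarrow> real" assume h: "ball_bounded_borel h"
    have s1: "circle_form h s = (\<Sum>\<rho>\<in>\<Lambda>. a \<rho> * (\<rho> * sphere_inner h (F \<rho>)))"
      unfolding s_def[abs_def] using h F bF
      by (subst circle_form_sum) (auto simp: circle_form_cmult eigenfunctionD[OF F(2) h])
    have s2: "sphere_inner h s = (\<Sum>\<rho>\<in>\<Lambda>. a \<rho> * sphere_inner h (F \<rho>))"
      unfolding s_def[abs_def] using h bF
      by (subst sphere_inner_sum) (auto simp: sphere_inner_cmult)
    have q1: "sphere_inner h q = (\<Sum>\<rho>\<in>\<Lambda>. sphere_inner h (F \<rho>))"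
      unfolding F(3) using h F(2) by (intro sphere_inner_sum) (auto intro: eigenfunction_bounded)
    have coeff: "y + a \<rho> * (\<rho> * y) = \<nu> * (a \<rho> * y)" if "\<rho> \<in> \<Lambda>" for \<rho> y
    proof -
      have "\<nu> - \<rho> \<noteq> 0" using that \<nu>(1) by auto
      then show ?thesis by (simp add: a_def field_simps)
    qed
    have "sphere_inner h q + circle_form h s = \<nu> * sphere_inner h s"
      unfolding q1 s1 s2 sum_distrib_left sum.distrib[symmetric]
      by (rule sum.cong) (simp_all add: coeff)
    then show "circle_form h (\<lambda>x. r x + s x) = \<nu> * sphere_inner h (\<lambda>x. r x + s x)"
      using h r bs form[OF h] by (simp add: circle_form_add sphere_inner_add distrib_left)
  qed (use r bs \<nu> in auto)
  then have "eigen_decomposable {\<nu>} (\<lambda>x. r x + s x)"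
    by (rule eigen_decomposable_eigenfunction)
  moreover have "eigen_decomposable \<Lambda> (\<lambda>x. - 1 * s x)"
    unfolding eigen_decomposable_def
  proof (intro conjI exI[of _ "\<lambda>\<rho> x. (- a \<rho>) * F \<rho> x"] ballI)
    show "(\<lambda>x. - 1 * s x) = (\<lambda>x. \<Sum>\<rho>\<in>\<Lambda>. - a \<rho> * F \<rho> x)"
      by (simp add: s_def sum_negf)
    show "eigenfunction \<rho> (\<lambda>x. - a \<rho> * F \<rho> x)" if "\<rho> \<in> \<Lambda>" for \<rho>
      using eigenfunction_cmult[OF F(2)[OF that]] .
  qed (rule F(1))
  ultimately have "eigen_decomposable ({\<nu>} \<union> \<Lambda>) (\<lambda>x. (r x + s x) + - 1 * s x)"
    by (rule eigen_decomposable_add)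
  then show ?thesis by simp
qed

text \<open>
  This is the even power with exponent \<open>0\<close>. It says that the average over a random great circle of the
  mean of a function is its mean over the sphere.
\<close>

lemma eigenfunction_one:
  assumes n: "CARD('n) \<ge> 3"
  shows "eigenfunction 1 (\<lambda>x. 1)"
proof -
  obtain c :: "nat \<Rightarrow> nat \<Rightarrow> real" where c: "c 0 0 = 1"
    "\<forall>u h k. norm u = 1 \<longrightarrow> ball_bounded_borel h \<longrightarrow>
      circle_form h (\<lambda>x. (x \<bullet> u) ^ (2 * k)) = (\<Sum>j\<le>k. c k j * sphere_inner h (\<lambda>x. (x \<bullet> u) ^ (2 * j)))"
    using circle_form_even_power[OF n] by (elim exE conjE) (rule that)
  obtain u :: "real^'n" where "norm u = 1" using vector_choose_size[of 1] by auto
  then show ?thesis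
    using c(2)[rule_format, of u _ 0] c(1) by (auto simp: eigenfunction_def)
qed

text \<open>
  Induction on the degree along the triangular system. The diagonal entries strictly decrease, hence are
  distinct, and those of positive degree are at most the one of degree one, which is at most \<open>1/2\<close>.
\<close>

lemma eigen_decomposable_inner_power:
  fixes u :: "real^'n"
  assumes n: "CARD('n) \<ge> 3"
  shows "\<exists>\<Lambda>. eigen_decomposable \<Lambda> (\<lambda>x. (x \<bullet> u) ^ m)"
proof (cases "u = 0")
  case True
  have "eigen_decomposable {1} (\<lambda>x. (0::real) ^ m * 1)"
    by (intro eigen_decomposable_cmult eigen_decomposable_eigenfunction eigenfunction_one n)
  then show ?thesis using True by auto
next
  case False
  define e where "e = sgn u"
  have e: "norm e = 1" using False by (simp add: e_def norm_sgn)
  have "\<exists>\<Lambda>. eigen_decomposable \<Lambda> (\<lambda>x. (x \<bullet> e) ^ m)"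
  proof (cases "even m")
    case False
    then obtain k where m: "m = Suc (2 * k)" by (metis oddE Suc_eq_plus1)
    have "eigenfunction 0 (\<lambda>x. (x \<bullet> e) ^ m)"
      unfolding eigenfunction_def m by (auto simp: circle_form_odd_power simp del: power_Suc)
    then show ?thesis using eigen_decomposable_eigenfunction by blast
  next
    case True
    obtain c :: "nat \<Rightarrow> nat \<Rightarrow> real" where c: "c 0 0 = 1" "c 1 1 \<le> 1/2" "\<forall>k. c (Suc k) (Suc k) < c k k"
      "\<forall>u h k. norm u = 1 \<longrightarrow> ball_bounded_borel h \<longrightarrow>
        circle_form h (\<lambda>x. (x \<bullet> u) ^ (2 * k)) = (\<Sum>j\<le>k. c k j * sphere_inner h (\<lambda>x. (x \<bullet> u) ^ (2 * j)))"
      using circle_form_even_power[OF n] by (elim exE conjE) (rule that)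
    have less: "c k k < c j j" if "j < k" for j k
      using that
    proof (induction k)
      case (Suc k)
      then show ?case using c(3)[rule_format, of k] by (cases "j = k") auto
    qed simp
    have "eigen_decomposable ((\<lambda>j. c j j) ` {..k}) (\<lambda>x. (x \<bullet> e) ^ (2 * k))" for k
    proof (induction k rule: less_induct)
      case (less k)
      show ?case
      proof (cases "k = 0")
        case True
        then show ?thesis
          using eigen_decomposable_eigenfunction[OF eigenfunction_one[OF n]] c(1) by simp
      next
        case False
        let ?r = "\<lambda>j x. (x \<bullet> e) ^ (2 * j)"
        let ?q = "\<lambda>x. \<Sum>j<k. c k j * ?r j x"
        have "eigen_decomposable (\<Union>j\<in>{..<k}. (\<lambda>j. c j j) ` {..j}) ?q"
          using False less.IH by (intro eigen_decomposable_sum eigen_decomposable_cmult) auto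
        moreover have "(\<Union>j\<in>{..<k}. (\<lambda>j. c j j) ` {..j}) = (\<lambda>j. c j j) ` {..<k}"
          by force
        ultimately have q: "eigen_decomposable ((\<lambda>j. c j j) ` {..<k}) ?q" by simp
        have "eigen_decomposable (insert (c k k) ((\<lambda>j. c j j) ` {..<k})) (?r k)"
        proof (rule eigen_decomposable_triangular[OF _ _ q])
          fix h :: "real^'n \<Rightarrow> real" assume h: "ball_bounded_borel h"
          have "sphere_inner h ?q = (\<Sum>j<k. c k j * sphere_inner h (?r j))"
            using h by (subst sphere_inner_sum) (auto simp: sphere_inner_cmult)
          then show "circle_form h (?r k) = c k k * sphere_inner h (?r k) + sphere_inner h ?q"
            using c(4)[rule_format, OF e h, of k] by (simp add: lessThan_Suc_atMost[symmetric])
        next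
          show "c k k \<notin> (\<lambda>j. c j j) ` {..<k}"
            using \<open>\<And>j k. j < k \<Longrightarrow> c k k < c j j\<close> by force
          show "c k k \<le> 1/2"
            using \<open>\<And>j k. j < k \<Longrightarrow> c k k < c j j\<close>[of 1 k] c(2) False by (cases "k = 1") auto
        qed auto
        then show ?thesis by (simp add: lessThan_Suc_atMost[symmetric] lessThan_Suc)
      qed
    qed
    then show ?thesis using True by (metis evenE)
  qed
  then obtain \<Lambda> where "eigen_decomposable \<Lambda> (\<lambda>x. (x \<bullet> e) ^ m)" by blast
  then have "eigen_decomposable \<Lambda> (\<lambda>x. norm u ^ m * (x \<bullet> e) ^ m)"
    by (rule eigen_decomposable_cmult)
  moreover have "norm u ^ m * (x \<bullet> e) ^ m = (x \<bullet> u) ^ m" for x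
  proof -
    have "u = norm u *\<^sub>R e" using False by (simp add: e_def sgn_div_norm)
    then have "x \<bullet> u = norm u * (x \<bullet> e)" by (metis inner_scaleR_right)
    then show ?thesis by (simp add: power_mult_distrib)
  qed
  ultimately show ?thesis by auto
qed

text \<open>
  By orthogonality both sides are sums over the eigenvalues. Each eigenvalue other than \<open>1\<close> is at most
  \<open>1/2\<close>, and the squared norm of the constant component is the square of the mean.
\<close>

lemma circle_form_le_of_eigen_decomposable:
  assumes n: "CARD('n) \<ge> 3" and p: "eigen_decomposable \<Lambda> p"
  shows "circle_form p p \<le> (subsphere_mean p UNIV)\<^sup>2 + 1/2 * sphere_inner p p"
proof -
  obtain F where F: "finite \<Lambda>" "\<And>\<nu>. \<nu> \<in> \<Lambda> \<Longrightarrow> eigenfunction \<nu> (F \<nu>)" and p_eq: "p = (\<lambda>x. \<Sum>\<nu>\<in>\<Lambda>. F \<nu> x)"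
    using p by (auto simp: eigen_decomposable_def)
  have bF: "ball_bounded_borel (F \<nu>)" if "\<nu> \<in> \<Lambda>" for \<nu>
    using eigenfunction_bounded[OF F(2)[OF that]] .
  have bp: "ball_bounded_borel p" using p by (rule eigen_decomposable_bounded)
  let ?N = "\<lambda>\<nu>. sphere_inner (F \<nu>) (F \<nu>)"
  have inner: "sphere_inner (F \<nu>) p = ?N \<nu>" if "\<nu> \<in> \<Lambda>" for \<nu>
  proof -
    have "sphere_inner (F \<nu>) p = (\<Sum>\<rho>\<in>\<Lambda>. sphere_inner (F \<nu>) (F \<rho>))"
      unfolding p_eq using bF that by (intro sphere_inner_sum) auto
    also have "\<dots> = (\<Sum>\<rho>\<in>\<Lambda>. if \<rho> = \<nu> then ?N \<nu> else 0)"
    proof (rule sum.cong[OF refl])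
      fix \<rho> assume \<rho>: "\<rho> \<in> \<Lambda>"
      show "sphere_inner (F \<nu>) (F \<rho>) = (if \<rho> = \<nu> then ?N \<nu> else 0)"
        using eigenfunction_orthogonal[OF F(2)[OF that] F(2)[OF \<rho>]] by auto
    qed
    finally show ?thesis using F(1) that by simp
  qed
  have inner': "sphere_inner p (F \<nu>) = ?N \<nu>" if "\<nu> \<in> \<Lambda>" for \<nu>
    using inner[OF that] by (subst sphere_inner_commute)
  have form: "circle_form p p = (\<Sum>\<nu>\<in>\<Lambda>. \<nu> * ?N \<nu>)"
  proof -
    have "circle_form p p = (\<Sum>\<nu>\<in>\<Lambda>. circle_form p (F \<nu>))"
      by (subst (2) p_eq) (intro circle_form_sum bp F(1) bF)
    also have "\<dots> = (\<Sum>\<nu>\<in>\<Lambda>. \<nu> * ?N \<nu>)"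
      by (intro sum.cong refl) (simp add: eigenfunctionD[OF F(2) bp] inner')
    finally show ?thesis .
  qed
  have norm: "sphere_inner p p = (\<Sum>\<nu>\<in>\<Lambda>. ?N \<nu>)"
  proof -
    have "sphere_inner p p = (\<Sum>\<nu>\<in>\<Lambda>. sphere_inner p (F \<nu>))"
      by (subst (2) p_eq) (intro sphere_inner_sum bp bF)
    then show ?thesis by (simp add: inner')
  qed
  have mean: "?N 1 = (subsphere_mean p UNIV)\<^sup>2" if 1: "1 \<in> \<Lambda>"
  proof -
    obtain c where c: "F 1 = (\<lambda>x. c)" using F(2)[OF 1] by (auto simp: eigenfunction_def)
    have "subsphere_mean p UNIV = sphere_inner (\<lambda>x. 1) p" by (simp add: sphere_inner_def)
    also have "\<dots> = (\<Sum>\<rho>\<in>\<Lambda>. sphere_inner (\<lambda>x. 1) (F \<rho>))"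
      unfolding p_eq using bF by (intro sphere_inner_sum) auto
    also have "\<dots> = (\<Sum>\<rho>\<in>\<Lambda>. if \<rho> = 1 then c else 0)"
    proof (rule sum.cong[OF refl])
      fix \<rho> assume \<rho>: "\<rho> \<in> \<Lambda>"
      show "sphere_inner (\<lambda>x. 1) (F \<rho>) = (if \<rho> = 1 then c else 0)"
        using eigenfunction_orthogonal[OF eigenfunction_one[OF n] F(2)[OF \<rho>]] c
        by (auto simp: sphere_inner_def)
    qed
    finally have "subsphere_mean p UNIV = c" using F(1) 1 by simp
    then show ?thesis by (simp add: c sphere_inner_def power2_eq_square)
  qed
  have "circle_form p p \<le> (\<Sum>\<nu>\<in>\<Lambda>. 1/2 * ?N \<nu> + (if \<nu> = 1 then (subsphere_mean p UNIV)\<^sup>2 else 0))"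
    unfolding form
  proof (rule sum_mono)
    fix \<nu> assume \<nu>: "\<nu> \<in> \<Lambda>"
    have N: "0 \<le> ?N \<nu>" by (rule sphere_inner_self_nonneg)
    show "\<nu> * ?N \<nu> \<le> 1/2 * ?N \<nu> + (if \<nu> = 1 then (subsphere_mean p UNIV)\<^sup>2 else 0)"
    proof (cases "\<nu> = 1")
      case True
      then show ?thesis using mean N \<nu> by simp
    next
      case False
      then have "\<nu> \<le> 1/2" using F(2)[OF \<nu>] by (auto simp: eigenfunction_def)
      then show ?thesis using mult_right_mono[OF _ N, of \<nu> "1/2"] False by simp
    qed
  qed
  also have "\<dots> = 1/2 * sphere_inner p p + (if 1 \<in> \<Lambda> then (subsphere_mean p UNIV)\<^sup>2 else 0)"
    using F(1) by (simp add: norm sum.distrib sum_distrib_left)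
  also have "\<dots> \<le> (subsphere_mean p UNIV)\<^sup>2 + 1/2 * sphere_inner p p" by simp
  finally show ?thesis .
qed

end


section \<open>Density of sums of eigenfunctions\<close>

text \<open>
  The weighted form of \<open>(a + b)\<^sup>2 \<le> 2 a\<^sup>2 + 2 b\<^sup>2\<close>. With \<open>t\<close> tending to \<open>0\<close>
  it takes the place of continuity arguments for the quadratic functionals below.
\<close>

lemma square_add_le:
  fixes a b t :: real
  assumes t: "t > 0"
  shows "(a + b)\<^sup>2 \<le> (1 + t) * a\<^sup>2 + (1 + 1/t) * b\<^sup>2"
proof -
  have "0 \<le> (t * a - b)\<^sup>2 / t" using t by simp
  also have "\<dots> = t * a\<^sup>2 - 2 * a * b + b\<^sup>2 / t"
    using t by (simp add: power2_eq_square field_simps)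
  finally show ?thesis by (simp add: power2_eq_square algebra_simps)
qed

lemma sphere_inner_self_add_le:
  assumes f: "ball_bounded_borel f" and g: "ball_bounded_borel g" and t: "t > 0"
  shows "sphere_inner (\<lambda>x. f x + g x) (\<lambda>x. f x + g x)
    \<le> (1 + t) * sphere_inner f f + (1 + 1/t) * sphere_inner g g"
proof -
  have "sphere_inner (\<lambda>x. f x + g x) (\<lambda>x. f x + g x)
      \<le> subsphere_mean (\<lambda>x. (1 + t) * (f x * f x) + (1 + 1/t) * (g x * g x)) UNIV"
    unfolding sphere_inner_def
  proof (rule subsphere_mean_mono[OF subspace_UNIV])
    show "(f x + g x) * (f x + g x) \<le> (1 + t) * (f x * f x) + (1 + 1/t) * (g x * g x)" for x
      using square_add_le[OF t, of "f x" "g x"] by (simp add: power2_eq_square)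
    show "ball_bounded_borel (\<lambda>x. (f x + g x) * (f x + g x))"
      by (intro ball_bounded_borel_mult ball_bounded_borel_add f g)
    show "ball_bounded_borel (\<lambda>x. (1 + t) * (f x * f x) + (1 + 1/t) * (g x * g x))"
      by (intro ball_bounded_borel_mult ball_bounded_borel_add ball_bounded_borel_const f g)
  qed
  also have "\<dots> = (1 + t) * sphere_inner f f + (1 + 1/t) * sphere_inner g g"
    unfolding sphere_inner_def subsphere_mean_cmult[symmetric]
    by (intro subsphere_mean_add subspace_UNIV ball_bounded_borel_mult ball_bounded_borel_const f g)
  finally show ?thesis .
qed

lemma subsphere_mean_square_le:
  fixes H :: "'a::euclidean_space set"
  assumes H: "subspace H" and f: "ball_bounded_borel f"
  shows "(subsphere_mean f H)\<^sup>2 \<le> subsphere_mean (\<lambda>x. f x * f x) H"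
proof -
  let ?c = "subsphere_mean f H"
  have bb: "ball_bounded_borel (\<lambda>x. f x * f x)" "ball_bounded_borel (\<lambda>x. (- 2 * ?c) * f x)"
    "ball_bounded_borel (\<lambda>x. f x * f x + (- 2 * ?c) * f x)"
    by (intro ball_bounded_borel_mult ball_bounded_borel_add ball_bounded_borel_const f)+
  have "0 \<le> subsphere_mean (\<lambda>x. (f x - ?c)\<^sup>2) H"
    by (simp add: subsphere_mean_def)
  also have "(\<lambda>x. (f x - ?c)\<^sup>2) = (\<lambda>x. (f x * f x + (- 2 * ?c) * f x) + ?c\<^sup>2)"
    by (simp add: fun_eq_iff power2_eq_square algebra_simps)
  also have "subsphere_mean \<dots> H = subsphere_mean (\<lambda>x. f x * f x) H + (- 2 * ?c) * ?c + ?c\<^sup>2"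
    using bb H by (simp only: subsphere_mean_add subsphere_mean_cmult subsphere_mean_const ball_bounded_borel_const)
  finally show ?thesis by (simp add: power2_eq_square)
qed

context random_plane
begin

lemma CARD_ge_2: "CARD('n) \<ge> 2"
proof -
  obtain H where H: "H \<in> space \<mu>" using not_empty by blast
  have "dim H \<le> dim (UNIV :: (real^'n) set)" by (rule dim_subset) simp
  then show ?thesis using planeD(2)[OF H] by simp
qed

lemma plane_eq_UNIV: "CARD('n) = 2 \<Longrightarrow> H \<in> space \<mu> \<Longrightarrow> H = UNIV"
  using planeD[of H] dim_eq_full[of H] by (simp add: span_eq_iff[THEN iffD2])

lemma integral_subsphere_mean:
  assumes h: "ball_bounded_borel h"
  shows "(\<integral>H. subsphere_mean h H \<partial>\<mu>) = subsphere_mean h UNIV"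
proof (cases "CARD('n) = 2")
  case True
  have "(\<integral>H. subsphere_mean h H \<partial>\<mu>) = (\<integral>H. subsphere_mean h UNIV \<partial>\<mu>)"
    by (intro Bochner_Integration.integral_cong refl) (auto dest!: plane_eq_UNIV[OF True])
  then show ?thesis by (simp add: prob_space)
next
  case False
  then have "CARD('n) \<ge> 3" using CARD_ge_2 by simp
  from eigenfunctionD[OF eigenfunction_one[OF this] h] show ?thesis
    by (simp add: circle_form_def sphere_inner_def)
qed

lemma circle_form_self_le:
  assumes d: "ball_bounded_borel d"
  shows "circle_form d d \<le> sphere_inner d d"
proof -
  have dd: "ball_bounded_borel (\<lambda>x. d x * d x)" using d d by (rule ball_bounded_borel_mult)
  have "integrable \<mu> (\<lambda>H. subsphere_mean (\<lambda>x. d x * d x) H * subsphere_mean (\<lambda>x. 1) H)"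
    using dd by (rule integrable_mean_mult) simp
  then have "circle_form d d \<le> (\<integral>H. subsphere_mean (\<lambda>x. d x * d x) H \<partial>\<mu>)"
    unfolding circle_form_def
    by (intro integral_mono integrable_mean_mult d)
      (use subsphere_mean_square_le[OF planeD(1) d] in \<open>simp_all add: power2_eq_square\<close>)
  then show ?thesis by (simp add: integral_subsphere_mean[OF dd] sphere_inner_def)
qed

lemma circle_form_self_add_le:
  assumes f: "ball_bounded_borel f" and g: "ball_bounded_borel g" and t: "t > 0"
  shows "circle_form (\<lambda>x. f x + g x) (\<lambda>x. f x + g x)
    \<le> (1 + t) * circle_form f f + (1 + 1/t) * circle_form g g"
proof -
  have "circle_form (\<lambda>x. f x + g x) (\<lambda>x. f x + g x)
      \<le> (\<integral>H. (1 + t) * (subsphere_mean f H * subsphere_mean f H)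
            + (1 + 1/t) * (subsphere_mean g H * subsphere_mean g H) \<partial>\<mu>)"
    unfolding circle_form_def
  proof (rule integral_mono)
    fix H assume H: "H \<in> space \<mu>"
    show "subsphere_mean (\<lambda>x. f x + g x) H * subsphere_mean (\<lambda>x. f x + g x) H
        \<le> (1 + t) * (subsphere_mean f H * subsphere_mean f H)
            + (1 + 1/t) * (subsphere_mean g H * subsphere_mean g H)"
      using square_add_le[OF t, of "subsphere_mean f H" "subsphere_mean g H"]
      by (simp only: subsphere_mean_add[OF planeD(1)[OF H] f g] power2_eq_square)
  qed (intro integrable_mean_mult Bochner_Integration.integrable_add integrable_mult_right
      ball_bounded_borel_add f g)+
  also have "\<dots> = (1 + t) * circle_form f f + (1 + 1/t) * circle_form g g"
    unfolding circle_form_def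
    by (subst Bochner_Integration.integral_add)
      (intro integrable_mean_mult integrable_mult_right f g | simp)+
  finally show ?thesis .
qed

definition eigen_approximable :: "(real^'n \<Rightarrow> real) \<Rightarrow> bool" where
  "eigen_approximable f \<longleftrightarrow> ball_bounded_borel f \<and>
     (\<forall>\<epsilon>>0. \<exists>\<Lambda> p. eigen_decomposable \<Lambda> p \<and> sphere_inner (\<lambda>x. f x - p x) (\<lambda>x. f x - p x) < \<epsilon>)"

lemma eigen_approximable_bounded: "eigen_approximable f \<Longrightarrow> ball_bounded_borel f"
  by (simp add: eigen_approximable_def)

lemma eigen_approximable_decomposable:
  assumes "eigen_decomposable \<Lambda> p"
  shows "eigen_approximable p"
proof -
  have "sphere_inner (\<lambda>x. p x - p x) (\<lambda>x. p x - p x) = 0" by (simp add: sphere_inner_def)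
  then show ?thesis
    using assms eigen_decomposable_bounded[OF assms] unfolding eigen_approximable_def by metis
qed

lemma eigen_approximable_cmult:
  assumes f: "eigen_approximable f"
  shows "eigen_approximable (\<lambda>x. c * f x)"
  unfolding eigen_approximable_def
proof (intro conjI allI impI)
  show "ball_bounded_borel (\<lambda>x. c * f x)"
    using eigen_approximable_bounded[OF f] by auto
  fix \<epsilon> :: real assume \<epsilon>: "\<epsilon> > 0"
  have "\<epsilon> / (c\<^sup>2 + 1) > 0" using \<epsilon> by (simp add: add_nonneg_pos)
  then obtain \<Lambda> p where p: "eigen_decomposable \<Lambda> p"
    "sphere_inner (\<lambda>x. f x - p x) (\<lambda>x. f x - p x) < \<epsilon> / (c\<^sup>2 + 1)"
    using f unfolding eigen_approximable_def by metis
  let ?d = "\<lambda>x. f x - p x"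
  have "sphere_inner (\<lambda>x. c * f x - c * p x) (\<lambda>x. c * f x - c * p x) = sphere_inner (\<lambda>x. c * ?d x) (\<lambda>x. c * ?d x)"
    by (simp add: right_diff_distrib)
  also have "\<dots> = c\<^sup>2 * sphere_inner ?d ?d"
    unfolding sphere_inner_def subsphere_mean_cmult[symmetric] by (simp add: power2_eq_square mult_ac)
  also have "\<dots> \<le> (c\<^sup>2 + 1) * sphere_inner ?d ?d"
    using sphere_inner_self_nonneg by (intro mult_right_mono) auto
  also have "\<dots> < \<epsilon>"
    using p(2) by (simp add: pos_less_divide_eq add_nonneg_pos mult.commute)
  finally show "\<exists>\<Lambda> q. eigen_decomposable \<Lambda> q \<and> sphere_inner (\<lambda>x. c * f x - q x) (\<lambda>x. c * f x - q x) < \<epsilon>"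
    using eigen_decomposable_cmult[OF p(1), of c] by blast
qed

lemma eigen_approximable_limit:
  assumes f: "ball_bounded_borel f"
    and approx: "\<And>\<epsilon>. \<epsilon> > 0 \<Longrightarrow> \<exists>g. eigen_approximable g \<and> sphere_inner (\<lambda>x. f x - g x) (\<lambda>x. f x - g x) < \<epsilon>"
  shows "eigen_approximable f"
  unfolding eigen_approximable_def
proof (intro conjI allI impI f)
  fix \<epsilon> :: real assume "\<epsilon> > 0"
  then have \<epsilon>: "\<epsilon> / 4 > 0" by simp
  obtain g where g: "eigen_approximable g" "sphere_inner (\<lambda>x. f x - g x) (\<lambda>x. f x - g x) < \<epsilon> / 4"
    using approx[OF \<epsilon>] by blast
  then obtain \<Lambda> p where p: "eigen_decomposable \<Lambda> p" "sphere_inner (\<lambda>x. g x - p x) (\<lambda>x. g x - p x) < \<epsilon> / 4"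
    using \<epsilon> unfolding eigen_approximable_def by metis
  have "sphere_inner (\<lambda>x. (f x - g x) + (g x - p x)) (\<lambda>x. (f x - g x) + (g x - p x))
      \<le> (1 + 1) * sphere_inner (\<lambda>x. f x - g x) (\<lambda>x. f x - g x)
        + (1 + 1/1) * sphere_inner (\<lambda>x. g x - p x) (\<lambda>x. g x - p x)"
    using f eigen_approximable_bounded[OF g(1)] eigen_decomposable_bounded[OF p(1)]
    by (intro sphere_inner_self_add_le ball_bounded_borel_diff) auto
  then show "\<exists>\<Lambda> p. eigen_decomposable \<Lambda> p \<and> sphere_inner (\<lambda>x. f x - p x) (\<lambda>x. f x - p x) < \<epsilon>"
    using g(2) p by (intro exI[of _ \<Lambda>] exI[of _ p] conjI) auto
qed

lemma eigen_approximable_add: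
  assumes f: "eigen_approximable f" and g: "eigen_approximable g"
  shows "eigen_approximable (\<lambda>x. f x + g x)"
  unfolding eigen_approximable_def
proof (intro conjI allI impI)
  note bb = eigen_approximable_bounded[OF f] eigen_approximable_bounded[OF g]
  show "ball_bounded_borel (\<lambda>x. f x + g x)" using bb by (rule ball_bounded_borel_add)
  fix \<epsilon> :: real assume "\<epsilon> > 0"
  then have \<epsilon>: "\<epsilon> / 4 > 0" by simp
  obtain \<Lambda> p where p: "eigen_decomposable \<Lambda> p" "sphere_inner (\<lambda>x. f x - p x) (\<lambda>x. f x - p x) < \<epsilon> / 4"
    using f \<epsilon> unfolding eigen_approximable_def by metis
  obtain \<Lambda>' q where q: "eigen_decomposable \<Lambda>' q" "sphere_inner (\<lambda>x. g x - q x) (\<lambda>x. g x - q x) < \<epsilon> / 4"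
    using g \<epsilon> unfolding eigen_approximable_def by metis
  have "sphere_inner (\<lambda>x. (f x - p x) + (g x - q x)) (\<lambda>x. (f x - p x) + (g x - q x))
      \<le> (1 + 1) * sphere_inner (\<lambda>x. f x - p x) (\<lambda>x. f x - p x)
        + (1 + 1/1) * sphere_inner (\<lambda>x. g x - q x) (\<lambda>x. g x - q x)"
    using bb eigen_decomposable_bounded[OF p(1)] eigen_decomposable_bounded[OF q(1)]
    by (intro sphere_inner_self_add_le ball_bounded_borel_diff) auto
  also have "\<dots> < \<epsilon>" using p(2) q(2) by simp
  also have "(\<lambda>x. (f x - p x) + (g x - q x)) = (\<lambda>x. f x + g x - (p x + q x))"
    by (simp add: fun_eq_iff)
  finally show "\<exists>\<Lambda> p. eigen_decomposable \<Lambda> p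
      \<and> sphere_inner (\<lambda>x. f x + g x - p x) (\<lambda>x. f x + g x - p x) < \<epsilon>"
    using eigen_decomposable_add[OF p(1) q(1)] by blast
qed

lemma eigen_approximable_dominated_limit:
  assumes g: "\<And>i::nat. eigen_approximable (g i)" and f: "f \<in> borel_measurable borel"
    and bound: "\<And>i x. norm x \<le> 1 \<Longrightarrow> \<bar>g i x\<bar> \<le> C"
    and lim: "\<And>x. norm x \<le> 1 \<Longrightarrow> (\<lambda>i. g i x) \<longlonglongrightarrow> f x"
  shows "eigen_approximable f"
proof (rule eigen_approximable_limit)
  have fC: "\<bar>f x\<bar> \<le> C" if "norm x \<le> 1" for x
    using tendsto_rabs[OF lim[OF that]] bound[OF that]
    by (intro LIMSEQ_le_const2[where X = "\<lambda>i. \<bar>g i x\<bar>"]) auto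
  then show bf: "ball_bounded_borel f" using f by (auto simp: ball_bounded_borel_def)
  let ?d = "\<lambda>i x. (f x - g i x) * (f x - g i x)"
  have meas: "(\<lambda>z. ?d i (sgn (closest_point UNIV z))) \<in> borel_measurable ball_uniform" for i
    by (intro borel_measurable_integrable integrable_subsphere_mean subspace_UNIV ball_bounded_borel_mult
        ball_bounded_borel_diff bf eigen_approximable_bounded g)
  have "(\<lambda>i. subsphere_mean (?d i) UNIV) \<longlonglongrightarrow> (\<integral>z. 0 \<partial>(ball_uniform :: (real^'n) measure))"
    unfolding subsphere_mean_def
  proof (rule integral_dominated_convergence[where w = "\<lambda>_. (2 * C) * (2 * C)"])
    show "AE z in ball_uniform. norm (?d i (sgn (closest_point UNIV z))) \<le> (2 * C) * (2 * C)" for i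
    proof (rule AE_I2)
      fix z :: "real^'n"
      let ?x = "sgn (closest_point UNIV z)"
      have "\<bar>f ?x - g i ?x\<bar> \<le> 2 * C"
        using fC[OF norm_sgn_le_1] bound[OF norm_sgn_le_1, of i]
        by (smt (verit, ccfv_SIG))
      then show "norm (?d i ?x) \<le> (2 * C) * (2 * C)"
        unfolding real_norm_def abs_mult by (intro mult_mono) auto
    qed
    show "AE z in ball_uniform. (\<lambda>i. ?d i (sgn (closest_point UNIV z))) \<longlonglongrightarrow> 0"
    proof (rule AE_I2)
      fix z :: "real^'n"
      let ?x = "sgn (closest_point UNIV z)"
      have "(\<lambda>i. ?d i ?x) \<longlonglongrightarrow> (f ?x - f ?x) * (f ?x - f ?x)"
        by (intro tendsto_intros lim norm_sgn_le_1)
      then show "(\<lambda>i. ?d i ?x) \<longlonglongrightarrow> 0" by simp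
    qed
  qed (simp_all add: meas)
  then have lim0: "(\<lambda>i. sphere_inner (\<lambda>x. f x - g i x) (\<lambda>x. f x - g i x)) \<longlonglongrightarrow> 0"
    by (simp add: sphere_inner_def)
  fix \<epsilon> :: real assume "\<epsilon> > 0"
  then have "\<exists>i. sphere_inner (\<lambda>x. f x - g i x) (\<lambda>x. f x - g i x) < \<epsilon>"
    using order_tendstoD(2)[OF lim0] eventually_happens sequentially_bot by blast
  then show "\<exists>g. eigen_approximable g \<and> sphere_inner (\<lambda>x. f x - g x) (\<lambda>x. f x - g x) < \<epsilon>"
    using g by blast
qed

lemma eigen_approximable_const:
  assumes n: "CARD('n) \<ge> 3"
  shows "eigen_approximable (\<lambda>x. c)"
  using eigen_approximable_cmult[OF eigen_approximable_decomposable[OF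
      eigen_decomposable_eigenfunction[OF eigenfunction_one[OF n]]], of c]
  by simp

lemma eigen_approximable_sum:
  assumes n: "CARD('n) \<ge> 3" and f: "\<And>i. i \<in> I \<Longrightarrow> eigen_approximable (f i)"
  shows "eigen_approximable (\<lambda>x. \<Sum>i\<in>I. f i x)"
  using f by (induction I rule: infinite_finite_induct)
    (auto intro: eigen_approximable_const[OF n] eigen_approximable_add)

text \<open>
  The partial sums of the exponential series are combinations of powers of \<open>x \<bullet> u\<close> and are dominated by
  \<open>exp (norm u)\<close> on the unit ball.
\<close>

lemma eigen_approximable_exp:
  fixes u :: "real^'n"
  assumes n: "CARD('n) \<ge> 3"
  shows "eigen_approximable (\<lambda>x. exp (x \<bullet> u))"
proof (rule eigen_approximable_dominated_limit)
  let ?g = "\<lambda>N x. \<Sum>k<N. inverse (fact k) * (x \<bullet> u) ^ k"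
  show "eigen_approximable (?g N)" for N
  proof (intro eigen_approximable_sum n eigen_approximable_cmult)
    fix k show "eigen_approximable (\<lambda>x. (x \<bullet> u) ^ k)"
      using eigen_decomposable_inner_power[OF n, of u k] eigen_approximable_decomposable by blast
  qed
  show "(\<lambda>x. exp (x \<bullet> u)) \<in> borel_measurable borel" by measurable
  have sums: "(\<lambda>k. inverse (fact k) * y ^ k) sums exp y" for y :: real
    using exp_converges[of y] by simp
  show "(\<lambda>N. ?g N x) \<longlonglongrightarrow> exp (x \<bullet> u)" for x
    using sums[of "x \<bullet> u"] by (simp add: sums_def)
  show "\<bar>?g N x\<bar> \<le> exp (norm u)" if "norm x \<le> 1" for N x
  proof -
    have xu: "\<bar>x \<bullet> u\<bar> \<le> norm u"
      using Cauchy_Schwarz_ineq2[of x u] mult_right_mono[OF that norm_ge_zero[of u]] by simp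
    have "\<bar>?g N x\<bar> \<le> (\<Sum>k<N. \<bar>inverse (fact k) * (x \<bullet> u) ^ k\<bar>)" by (rule sum_abs)
    also have "\<dots> \<le> (\<Sum>k<N. inverse (fact k) * norm u ^ k)"
      using xu by (intro sum_mono) (simp add: abs_mult power_abs power_mono mult_left_mono)
    also have "\<dots> \<le> (\<Sum>k. inverse (fact k) * norm u ^ k)"
      using sums[of "norm u"] by (intro sum_le_suminf) (auto simp: sums_iff)
    also have "\<dots> = exp (norm u)" using sums[of "norm u"] by (simp add: sums_iff)
    finally show ?thesis .
  qed
qed

inductive_set exp_span :: "(real^'n \<Rightarrow> real) set" where
  exp: "(\<lambda>x. exp (x \<bullet> u)) \<in> exp_span"
| cmult: "f \<in> exp_span \<Longrightarrow> (\<lambda>x. c * f x) \<in> exp_span"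
| add: "f \<in> exp_span \<Longrightarrow> g \<in> exp_span \<Longrightarrow> (\<lambda>x. f x + g x) \<in> exp_span"

text \<open>
  This is the reason for passing to exponentials. A product of powers of \<open>x \<bullet> u\<close> and \<open>x \<bullet> v\<close> is a
  combination of such powers only by polarisation, whereas the product of two exponentials is the
  exponential of \<open>x \<bullet> (u + v)\<close>.
\<close>

lemma exp_span_mult:
  assumes "f \<in> exp_span" "g \<in> exp_span"
  shows "(\<lambda>x. f x * g x) \<in> exp_span"
  using assms(1)
proof induction
  case (exp u)
  show ?case using assms(2)
  proof induction
    case (exp v)
    show ?case using exp_span.exp[of "u + v"] by (simp add: inner_add_right exp_add)
  next
    case (cmult f c)
    then show ?case using exp_span.cmult[of "\<lambda>x. exp (x \<bullet> u) * f x" c] by (simp add: mult.left_commute)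
  next
    case (add f g)
    then show ?case using exp_span.add by (fastforce simp: distrib_left)
  qed
next
  case (cmult f c)
  then show ?case using exp_span.cmult[of "\<lambda>x. f x * g x" c] by (simp add: mult.assoc)
next
  case (add f f')
  then show ?case
    using exp_span.add[of "\<lambda>x. f x * g x" "\<lambda>x. f' x * g x"] by (simp add: distrib_right)
qed

lemma exp_span_continuous: "f \<in> exp_span \<Longrightarrow> continuous_on S f"
  by (induction rule: exp_span.induct) (auto intro!: continuous_intros)

lemma exp_span_approximable:
  assumes n: "CARD('n) \<ge> 3"
  shows "f \<in> exp_span \<Longrightarrow> eigen_approximable f"
  by (induction rule: exp_span.induct)
    (auto intro: eigen_approximable_exp[OF n] eigen_approximable_cmult eigen_approximable_add)

lemma eigen_approximable_continuous:
  fixes f :: "real^'n \<Rightarrow> real"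
  assumes n: "CARD('n) \<ge> 3" and f: "continuous_on UNIV f"
  shows "eigen_approximable f"
proof (rule eigen_approximable_limit)
  show bf: "ball_bounded_borel f" using f by (rule ball_bounded_borel_continuous)
  interpret function_ring_on exp_span "cball (0 :: real^'n) 1"
  proof
    show "(\<lambda>_. c) \<in> exp_span" for c
      using exp_span.cmult[OF exp_span.exp[of 0], of c] by simp
    show "\<exists>f\<in>exp_span. f x \<noteq> f y" if "x \<noteq> y" for x y :: "real^'n"
    proof (rule bexI[OF _ exp_span.exp[of "x - y"]])
      have "(x - y) \<bullet> (x - y) \<noteq> 0" using that by simp
      then show "exp (x \<bullet> (x - y)) \<noteq> exp (y \<bullet> (x - y))" by (simp add: inner_diff_left)
    qed
  qed (auto intro: exp_span_continuous exp_span.add exp_span_mult)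
  fix \<epsilon> :: real assume \<epsilon>: "\<epsilon> > 0"
  have "continuous_on (cball 0 1) f" using f continuous_on_subset by blast
  then obtain g where g: "g \<in> exp_span" "\<forall>x\<in>cball 0 1. \<bar>f x - g x\<bar> < sqrt (\<epsilon> / 2)"
    using Stone_Weierstrass_basic[of f "sqrt (\<epsilon> / 2)"] \<epsilon> by auto
  have ag: "eigen_approximable g" using exp_span_approximable[OF n g(1)] .
  have "sphere_inner (\<lambda>x. f x - g x) (\<lambda>x. f x - g x) \<le> subsphere_mean (\<lambda>x :: real^'n. \<epsilon> / 2) UNIV"
    unfolding sphere_inner_def
  proof (rule subsphere_mean_mono[OF subspace_UNIV])
    show "ball_bounded_borel (\<lambda>x. (f x - g x) * (f x - g x))"
      using bf eigen_approximable_bounded[OF ag] by auto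
    fix x :: "real^'n" assume "norm x \<le> 1"
    then have "\<bar>f x - g x\<bar> \<le> sqrt (\<epsilon> / 2)" using g(2) by (auto intro: less_imp_le)
    then have "\<bar>f x - g x\<bar>\<^sup>2 \<le> (sqrt (\<epsilon> / 2))\<^sup>2" by (intro power_mono) auto
    then show "(f x - g x) * (f x - g x) \<le> \<epsilon> / 2" using \<epsilon> by (simp add: power2_eq_square)
  qed simp
  then show "\<exists>g. eigen_approximable g \<and> sphere_inner (\<lambda>x. f x - g x) (\<lambda>x. f x - g x) < \<epsilon>"
    using ag \<epsilon> by (intro exI[of _ g]) simp
qed

text \<open>
  The indicator is the limit of the continuous functions \<open>max 0 (1 - i * infdist x C)\<close>.
\<close>

lemma eigen_approximable_indicator_closed:
  fixes C :: "(real^'n) set"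
  assumes n: "CARD('n) \<ge> 3" and C: "closed C"
  shows "eigen_approximable (indicator C)"
proof (cases "C = {}")
  case True
  have "indicator {} = (\<lambda>x :: real^'n. 0 :: real)" by (simp add: fun_eq_iff)
  then show ?thesis using eigen_approximable_const[OF n, of 0] True by simp
next
  case False
  show ?thesis
  proof (rule eigen_approximable_dominated_limit)
    let ?g = "\<lambda>i x. max 0 (1 - real i * infdist x C)"
    show "eigen_approximable (?g i)" for i
      by (intro eigen_approximable_continuous n continuous_intros)
    show "indicator C \<in> borel_measurable borel" using C by simp
    show "\<bar>?g i x\<bar> \<le> 1" for i x using infdist_nonneg[of x C] by (auto simp: max_def)
    fix x :: "real^'n"
    show "(\<lambda>i. ?g i x) \<longlonglongrightarrow> indicator C x"
    proof (cases "x \<in> C")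
      case True
      then show ?thesis by simp
    next
      case x: False
      then have d: "infdist x C > 0"
        using in_closed_iff_infdist_zero[OF C False, of x] infdist_nonneg[of x C] by linarith
      obtain N where N: "1 / infdist x C < real N" using reals_Archimedean2 by blast
      have "?g i x = 0" if "i \<ge> N" for i
      proof -
        have "1 / infdist x C \<le> real i" using N that by linarith
        then have "1 \<le> real i * infdist x C" using d by (simp add: divide_le_eq)
        then show ?thesis by simp
      qed
      then have "eventually (\<lambda>i. ?g i x = 0) sequentially"
        by (auto simp: eventually_sequentially)
      then have "(\<lambda>i. ?g i x) \<longlonglongrightarrow> 0" by (rule tendsto_eventually)
      then show ?thesis using x by simp
    qed
  qed
qed

text \<open>
  The sets with an approximable indicator contain the open sets and form a Dynkin system.
\<close>

lemma eigen_approximable_indicator: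
  fixes A :: "(real^'n) set"
  assumes n: "CARD('n) \<ge> 3" and A: "A \<in> sets borel"
  shows "eigen_approximable (indicator A)"
proof -
  have compl: "eigen_approximable (indicator (UNIV - B))"
    if "eigen_approximable (indicator B)" for B :: "(real^'n) set"
  proof -
    have "eigen_approximable (\<lambda>x. 1 + (- 1) * indicator B x)"
      by (intro eigen_approximable_add eigen_approximable_const n eigen_approximable_cmult that)
    also have "(\<lambda>x. 1 + (- 1) * indicator B x) = (indicator (UNIV - B) :: _ \<Rightarrow> real)"
      by (auto simp: fun_eq_iff indicator_def)
    finally show ?thesis .
  qed
  have stable: "Int_stable {S :: (real^'n) set. open S}" by (auto simp: Int_stable_def)
  have sub: "{S. open S} \<subseteq> Pow (UNIV :: (real^'n) set)" by simp
  have "A \<in> sigma_sets UNIV {S. open S}" using A by (simp add: borel_def)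
  then show ?thesis
  proof (rule sigma_sets_induct_disjoint[OF stable sub, where P = "\<lambda>S. eigen_approximable (indicator S)"])
    show "eigen_approximable (indicator S)" if "S \<in> {S. open S}" for S :: "(real^'n) set"
    proof -
      have "closed (- S)" using that by (simp add: closed_def)
      from compl[OF eigen_approximable_indicator_closed[OF n this]]
      show ?thesis by (simp add: Diff_eq)
    qed
    show "eigen_approximable (indicator {})"
      using eigen_approximable_indicator_closed[OF n closed_empty] .
    show "eigen_approximable (indicator (UNIV - B))" if "eigen_approximable (indicator B)" for B
      using compl[OF that] .
    fix B :: "nat \<Rightarrow> (real^'n) set"
    assume B: "disjoint_family B" "range B \<subseteq> sigma_sets UNIV {S. open S}"
      "\<And>i. eigen_approximable (indicator (B i))"
    have Bm [measurable]: "B i \<in> sets borel" for i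
      using B(2) by (auto simp: borel_def)
    show "eigen_approximable (indicator (\<Union>(range B)))"
    proof (rule eigen_approximable_dominated_limit[where C = 1])
      show "eigen_approximable (indicator (\<Union>i<k. B i))" for k
      proof -
        have "disjoint_family_on B {..<k}"
          using B(1) by (rule disjoint_family_on_mono[rotated]) simp
        then have "indicator (\<Union>i<k. B i) = (\<lambda>x. \<Sum>i<k. indicator (B i) x :: real)"
          by (intro ext indicator_UN_disjoint) auto
        moreover have "eigen_approximable (\<lambda>x. \<Sum>i<k. indicator (B i) x)"
          by (rule eigen_approximable_sum[OF n B(3)])
        ultimately show ?thesis by simp
      qed
      show "(\<lambda>k. indicator (\<Union>i<k. B i) x :: real) \<longlonglongrightarrow> indicator (\<Union>i. B i) x" for x
        by (rule LIMSEQ_indicator_UN)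
    qed (auto simp: indicator_def)
  qed
qed

text \<open>
  Approximate \<open>f\<close> by a sum \<open>p\<close> of eigenfunctions, pass from \<open>f\<close> to \<open>p\<close> and back at the cost of factors \<open>1 + t\<close>,
  and let first the approximation error and then \<open>t\<close> tend to \<open>0\<close>.
\<close>

lemma circle_form_le_of_approximable:
  assumes n: "CARD('n) \<ge> 3" and f: "eigen_approximable f"
  shows "circle_form f f \<le> (subsphere_mean f UNIV)\<^sup>2 + 1/2 * sphere_inner f f"
proof -
  let ?m = "\<lambda>f. subsphere_mean f UNIV" and ?N = "\<lambda>f. sphere_inner f f"
  let ?Q = "\<lambda>f. (?m f)\<^sup>2 + 1/2 * ?N f"
  have bf: "ball_bounded_borel f" using f by (rule eigen_approximable_bounded)
  have step: "circle_form f f \<le> (1 + t)\<^sup>2 * ?Q f + K * \<epsilon>"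
    if t: "t > 0" and K: "K = (1 + t) * (1 + 1/t) * (3/2) + (1 + 1/t)" and \<epsilon>: "\<epsilon> > 0" for t K \<epsilon>
  proof -
    obtain \<Lambda> p where p: "eigen_decomposable \<Lambda> p" "?N (\<lambda>x. f x - p x) < \<epsilon>"
      using f \<epsilon> unfolding eigen_approximable_def by metis
    have bp: "ball_bounded_borel p" using p(1) by (rule eigen_decomposable_bounded)
    define d where "d = (\<lambda>x. f x - p x)"
    define e where "e = (\<lambda>x. - 1 * d x)"
    have bd: "ball_bounded_borel d" unfolding d_def using bf bp by (rule ball_bounded_borel_diff)
    then have be: "ball_bounded_borel e" unfolding e_def by (intro ball_bounded_borel_mult ball_bounded_borel_const)
    have Ne: "?N e = ?N d" by (simp add: e_def sphere_inner_def)
    have fpd: "f = (\<lambda>x. p x + d x)" and pfe: "p = (\<lambda>x. f x + e x)"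
      by (simp_all add: d_def e_def)
    have t': "1 + t > 0" "1 + 1/t > 0" using t by (simp_all add: add_pos_pos)
    have "circle_form f f \<le> (1 + t) * circle_form p p + (1 + 1/t) * circle_form d d"
      using circle_form_self_add_le[OF bp bd t] fpd by simp
    also have "\<dots> \<le> (1 + t) * ?Q p + (1 + 1/t) * ?N d"
      using t' circle_form_le_of_eigen_decomposable[OF n p(1)] circle_form_self_le[OF bd]
      by (intro add_mono mult_left_mono) auto
    also have "?Q p \<le> (1 + t) * ?Q f + (1 + 1/t) * (3/2) * ?N d"
    proof -
      have "(?m p)\<^sup>2 = (?m f + ?m e)\<^sup>2"
        using subsphere_mean_add[OF subspace_UNIV bf be] pfe by simp
      also have "\<dots> \<le> (1 + t) * (?m f)\<^sup>2 + (1 + 1/t) * (?m e)\<^sup>2"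
        by (rule square_add_le[OF t])
      also have "\<dots> \<le> (1 + t) * (?m f)\<^sup>2 + (1 + 1/t) * ?N d"
        using t' subsphere_mean_square_le[OF subspace_UNIV be] Ne
        by (intro add_mono mult_left_mono) (auto simp: sphere_inner_def)
      finally have 1: "(?m p)\<^sup>2 \<le> (1 + t) * (?m f)\<^sup>2 + (1 + 1/t) * ?N d" .
      have 2: "?N p \<le> (1 + t) * ?N f + (1 + 1/t) * ?N d"
        using sphere_inner_self_add_le[OF bf be t] pfe Ne by simp
      have "m + 1/2 * N \<le> X * (m' + 1/2 * N') + Y * (3/2) * D"
        if "m \<le> X * m' + Y * D" "N \<le> X * N' + Y * D" for m m' N N' D X Y :: real
        using that by (simp add: algebra_simps)
      from this[OF 1 2] show ?thesis .
    qed
    finally have "circle_form f f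
        \<le> (1 + t) * ((1 + t) * ?Q f + (1 + 1/t) * (3/2) * ?N d) + (1 + 1/t) * ?N d"
      using t' by (simp add: mult_left_mono)
    also have "\<dots> = (1 + t)\<^sup>2 * ?Q f + K * ?N d"
    proof -
      have "X * (X * q + Y * (3/2) * D) + Y * D = X\<^sup>2 * q + (X * Y * (3/2) + Y) * D" for X Y q D :: real
        by (simp add: power2_eq_square algebra_simps)
      then show ?thesis unfolding K .
    qed
    also have "\<dots> \<le> (1 + t)\<^sup>2 * ?Q f + K * \<epsilon>"
      using p(2) t' K by (intro add_left_mono mult_left_mono) (auto simp: d_def)
    finally show ?thesis .
  qed
  have le: "circle_form f f \<le> (1 + t)\<^sup>2 * ?Q f" if t: "t > 0" for t
  proof (rule field_le_epsilon)
    fix \<epsilon> :: real assume \<epsilon>: "\<epsilon> > 0"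
    define K where "K = (1 + t) * (1 + 1/t) * (3/2) + (1 + 1/t)"
    have "K > 0" using t unfolding K_def by (intro add_pos_pos mult_pos_pos) auto
    then show "circle_form f f \<le> (1 + t)\<^sup>2 * ?Q f + \<epsilon>"
      using step[OF t K_def, of "\<epsilon> / K"] \<epsilon> by simp
  qed
  have "(\<lambda>i. (1 + inverse (real (Suc i)))\<^sup>2 * ?Q f) \<longlonglongrightarrow> (1 + 0)\<^sup>2 * ?Q f"
    by (intro tendsto_intros LIMSEQ_inverse_real_of_nat)
  then have "circle_form f f \<le> (1 + 0)\<^sup>2 * ?Q f"
    using le by (intro LIMSEQ_le_const) auto
  then show ?thesis by simp
qed

text \<open>
  For \<open>f = 2 * indicator A - 1\<close> the mean is \<open>0\<close> and the square is constantly \<open>1\<close>.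
\<close>

theorem circle_mean_second_moment:
  assumes A: "A \<in> sets borel" and half: "subsphere_mean (indicator A) UNIV = 1/2"
  shows "(\<integral>H. (2 * subsphere_mean (indicator A) H - 1)\<^sup>2 \<partial>\<mu>) \<le> 1/2"
proof (cases "CARD('n) = 2")
  case True
  have "(\<integral>H. (2 * subsphere_mean (indicator A) H - 1)\<^sup>2 \<partial>\<mu>) = (\<integral>H. 0 \<partial>\<mu>)"
    by (intro Bochner_Integration.integral_cong refl) (auto dest!: plane_eq_UNIV[OF True] simp: half)
  then show ?thesis by simp
next
  case False
  then have n: "CARD('n) \<ge> 3" using CARD_ge_2 by simp
  define f :: "real^'n \<Rightarrow> real" where "f = (\<lambda>x. 2 * indicator A x + (- 1))"
  have f: "eigen_approximable f"
    unfolding f_def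
    by (intro eigen_approximable_add eigen_approximable_const eigen_approximable_cmult
        eigen_approximable_indicator n A)
  have bA: "ball_bounded_borel (\<lambda>x. 2 * indicator A x)"
    using eigen_approximable_bounded[OF eigen_approximable_cmult[OF eigen_approximable_indicator[OF n A]]] .
  have mean: "subsphere_mean f H = 2 * subsphere_mean (indicator A) H - 1" if "subspace H" for H
    unfolding f_def
    using subsphere_mean_add[OF that bA ball_bounded_borel_const[of "-1"]]
    by (simp add: subsphere_mean_cmult)
  have "(\<integral>H. (2 * subsphere_mean (indicator A) H - 1)\<^sup>2 \<partial>\<mu>) = circle_form f f"
    unfolding circle_form_def
    by (intro Bochner_Integration.integral_cong refl) (simp add: mean planeD power2_eq_square)
  also have "\<dots> \<le> (subsphere_mean f UNIV)\<^sup>2 + 1/2 * sphere_inner f f"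
    by (rule circle_form_le_of_approximable[OF n f])
  also have "subsphere_mean f UNIV = 0" by (simp add: mean half)
  also have "(\<lambda>x. f x * f x) = (\<lambda>x. 1)" by (auto simp: f_def indicator_def)
  then have "sphere_inner f f = 1" by (simp add: sphere_inner_def)
  finally show ?thesis by simp
qed

end


section \<open>The concentration inequality\<close>

lemma invariant_prob_measure_eq_mean:
  fixes H :: "(real^'n) set"
  assumes H: "subspace H" "dim H \<ge> 2"
    and M: "rotation_invariant_prob_on (sphere 0 1 \<inter> H) M" and B: "B \<in> sets M"
  shows "B \<in> sets borel" "measure M B = subsphere_mean (indicator B) H"
proof -
  let ?S = "sphere 0 1 \<inter> H"
  have sM: "sets M = sets (restrict_space borel ?S)"
    using M by (simp add: rotation_invariant_prob_on_def)
  have "?S \<in> sets borel"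
    using closed_subspace[OF H(1)] by (intro borel_closed closed_Int) auto
  then show Bb: "B \<in> sets borel"
    using B by (auto simp: sM sets_restrict_space_iff)
  have "(\<lambda>x. x) \<in> restrict_space borel ?S \<rightarrow>\<^sub>M (borel :: (real^'n) measure)"
    by (rule measurable_restrict_space1) simp
  then have idm: "(\<lambda>x. x) \<in> M \<rightarrow>\<^sub>M (borel :: (real^'n) measure)"
    using measurable_cong_sets[OF sM refl] by blast
  note sm = measurable_sgn_closest_point[OF H(1)]
  have "measure M B = measure (distr M borel (\<lambda>x. x)) B"
    using sets.sets_into_space[OF B] by (simp add: measure_distr[OF idm Bb] Int_absorb2)
  also have "\<dots> = measure (distr ball_uniform borel (\<lambda>z. sgn (closest_point H z))) B"
    by (simp only: invariant_prob_on_subsphere_unique[OF H M])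
  also have "\<dots> = (\<integral>x. indicator B x \<partial>distr ball_uniform borel (\<lambda>z. sgn (closest_point H z)))"
    by simp
  also have "\<dots> = subsphere_mean (indicator B) H"
    unfolding subsphere_mean_def using sm Bb by (intro integral_distr) auto
  finally show "measure M B = subsphere_mean (indicator B) H" .
qed

lemma measure_completion_Un_null:
  assumes S: "S \<in> sets M" and N: "N \<subseteq> N'" "N' \<in> null_sets M"
  shows "S \<union> N \<in> sets (completion M)" "measure (completion M) (S \<union> N) = measure M S"
proof -
  have N': "N' \<in> sets M" using N(2) by auto
  show X: "S \<union> N \<in> sets (completion M)" using sets_completionI[OF refl N S] .
  have "emeasure (completion M) (S \<union> N) = emeasure M S"
  proof (rule antisym)
    have "emeasure (completion M) (S \<union> N) \<le> emeasure (completion M) (S \<union> N')"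
      using N(1) S N' by (intro emeasure_mono) auto
    also have "\<dots> = emeasure M (S \<union> N')" using S N' by simp
    also have "\<dots> = emeasure M S" using S N(2) by (rule emeasure_Un_null_set)
    finally show "emeasure (completion M) (S \<union> N) \<le> emeasure M S" .
    have "emeasure M S = emeasure (completion M) S" using S by simp
    also have "\<dots> \<le> emeasure (completion M) (S \<union> N)" using X by (intro emeasure_mono) auto
    finally show "emeasure M S \<le> emeasure (completion M) (S \<union> N)" .
  qed
  then show "measure (completion M) (S \<union> N) = measure M S" by (simp add: measure_def)
qed

lemma (in random_plane) circle_mean_concentration:
  assumes A: "A \<in> sets borel" and half: "subsphere_mean (indicator A) UNIV = 1/2"
  defines "t \<equiv> 1 / 2 powr (1 / 3)"
  shows "{H \<in> space \<mu>. t \<le> \<bar>2 * subsphere_mean (indicator A) H - 1\<bar>} \<in> sets \<mu>"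
    and "measure \<mu> {H \<in> space \<mu>. t \<le> \<bar>2 * subsphere_mean (indicator A) H - 1\<bar>} \<le> t"
proof -
  let ?f = "\<lambda>H. 2 * subsphere_mean (indicator A) H - 1"
  have bA: "ball_bounded_borel (indicator A :: real^'n \<Rightarrow> real)"
    using A by (auto simp: ball_bounded_borel_def indicator_def intro!: exI[of _ 1])
  have [measurable]: "subsphere_mean (indicator A) \<in> borel_measurable \<mu>"
    using A by (intro measurable_subsphere_mean) simp
  show "{H \<in> space \<mu>. t \<le> \<bar>?f H\<bar>} \<in> sets \<mu>" by measurable
  obtain C where C: "C \<ge> 0" "\<And>H. H \<in> space \<mu> \<Longrightarrow> \<bar>subsphere_mean (indicator A) H\<bar> \<le> C"
    using subsphere_mean_bounded[OF bA] by blast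
  have "integrable \<mu> (\<lambda>H. (?f H)\<^sup>2)"
  proof (rule integrable_const_bound[of _ "(2 * C + 1)\<^sup>2"])
    have "\<bar>?f H\<bar> \<le> 2 * C + 1" if "H \<in> space \<mu>" for H
      using C(2)[OF that] by linarith
    then show "AE H in \<mu>. norm ((?f H)\<^sup>2) \<le> (2 * C + 1)\<^sup>2"
      using C(1) by (intro AE_I2) (auto simp: abs_le_square_iff[symmetric])
  qed measurable
  moreover have t: "t > 0" by (simp add: t_def)
  ultimately have "measure \<mu> {H \<in> space \<mu>. t \<le> \<bar>?f H\<bar>} \<le> (\<integral>H. (?f H)\<^sup>2 \<partial>\<mu>) / t\<^sup>2"
    by (intro second_moment_method) measurable
  also have "\<dots> \<le> (1/2) / t\<^sup>2"
    using circle_mean_second_moment[OF A half] by (intro divide_right_mono) auto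
  also have "\<dots> = t"
  proof -
    have "t ^ 3 = 1 / (2 powr (1/3)) ^ 3" by (simp add: t_def power_divide)
    also have "(2 powr (1/3)) ^ 3 = (2 :: real) powr (1/3 * 3)"
      by (subst powr_powr[symmetric]) (simp add: powr_numeral)
    finally have "t * t\<^sup>2 = 1/2" by (simp add: power3_eq_cube power2_eq_square)
    then show ?thesis using t by (simp add: field_simps)
  qed
  finally show "measure \<mu> {H \<in> space \<mu>. t \<le> \<bar>?f H\<bar>} \<le> t" .
qed

theorem theorem1p1:
  fixes \<sigma> :: "(real^'n) measure"
    and \<mu> :: "(real^'n) set measure"
    and \<sigma>\<^sub>L :: "(real^'n) set \<Rightarrow> (real^'n) measure"
    and A :: "(real^'n) set"
  assumes "CARD('n) \<ge> 2"
    and "rotation_invariant_prob_on (sphere 0 1) \<sigma>"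
    and "rotation_invariant_prob_grassmannian 2 \<mu>"
    and "\<And>H. H \<in> grassmannian 2 \<Longrightarrow>
           rotation_invariant_prob_on (great_circle H) (\<sigma>\<^sub>L (great_circle H))"
    and "A \<in> sets (completion \<sigma>)"
    and "measure (completion \<sigma>) A = 1 / 2"
  defines "E \<equiv> {H \<in> grassmannian 2.
      \<bar>measure (completion (\<sigma>\<^sub>L (great_circle H))) (A \<inter> great_circle H)
         / measure (completion \<sigma>) A - 1\<bar> \<ge> 1 / 2 powr (1 / 3)}"
  shows "E \<in> sets (completion \<mu>) \<and> measure (completion \<mu>) E \<le> 1 / 2 powr (1 / 3)"
proof -
  interpret random_plane \<mu> by standard (rule assms(3))
  let ?t = "1 / 2 powr (1 / 3) :: real"
  have U: "subspace (UNIV :: (real^'n) set)" "dim (UNIV :: (real^'n) set) \<ge> 2"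
    using assms(1) by auto
  have \<sigma>: "rotation_invariant_prob_on (sphere 0 1 \<inter> UNIV) \<sigma>" using assms(2) by simp
  note \<sigma>_mean = invariant_prob_measure_eq_mean[OF U \<sigma>]
  interpret \<sigma>: prob_space \<sigma> using assms(2) by (simp add: rotation_invariant_prob_on_def)
  obtain S N N' where A: "A = S \<union> N" "N \<subseteq> N'" "N' \<in> null_sets \<sigma>" "S \<in> sets \<sigma>"
    using assms(5) by (rule sets_completionE)
  have N': "N' \<in> sets \<sigma>" "measure \<sigma> N' = 0" using A(3) by (auto simp: measure_def null_sets_def)
  note Sb = \<sigma>_mean(1)[OF A(4)] and N'b = \<sigma>_mean(1)[OF N'(1)]
  have half: "subsphere_mean (indicator S) UNIV = 1/2"
    using measure_completion_Un_null(2)[OF A(4,2,3)] assms(6) \<sigma>_mean(2)[OF A(4)] A(1) by simp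
  have bb: "ball_bounded_borel (indicator N' :: real^'n \<Rightarrow> real)"
    using N'b by (auto simp: ball_bounded_borel_def indicator_def intro!: exI[of _ 1])

  \<comment> \<open>The part of \<open>A\<close> that is negligible on the sphere is negligible on almost every great circle.\<close>
  define Z where "Z = {H \<in> space \<mu>. subsphere_mean (indicator N') H \<noteq> 0}"
  have Zm: "subsphere_mean (indicator N') \<in> borel_measurable \<mu>"
    using N'b by (intro measurable_subsphere_mean) simp
  have "integrable \<mu> (\<lambda>H. subsphere_mean (indicator N') H * subsphere_mean (\<lambda>x. 1) H)"
    by (rule integrable_mean_mult[OF bb ball_bounded_borel_const])
  then have "integrable \<mu> (subsphere_mean (indicator N'))" by simp
  moreover have "(\<integral>H. subsphere_mean (indicator N') H \<partial>\<mu>) = 0"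
    using integral_subsphere_mean[OF bb] \<sigma>_mean(2)[OF N'(1)] N'(2) by simp
  moreover have "0 \<le> subsphere_mean (indicator N') H" for H
    by (simp add: subsphere_mean_def)
  ultimately have "AE H in \<mu>. subsphere_mean (indicator N') H = 0"
    by (subst (asm) integral_nonneg_eq_0_iff_AE) auto
  then have "AE H in \<mu>. H \<notin> Z" by (rule eventually_mono) (simp add: Z_def)
  moreover have "Z \<in> sets \<mu>" unfolding Z_def using Zm by measurable
  ultimately have Z: "Z \<in> null_sets \<mu>" by (simp add: AE_iff_null_sets)

  define F where "F = {H \<in> space \<mu>. ?t \<le> \<bar>2 * subsphere_mean (indicator S) H - 1\<bar>}"
  note F = circle_mean_concentration[OF Sb half, folded F_def]
  have E_iff: "H \<in> E \<longleftrightarrow> H \<in> F" if H: "H \<in> space \<mu> - Z" for H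
  proof -
    let ?L = "great_circle H"
    have H': "subspace H" "dim H \<ge> 2" using planeD[of H] H by auto
    have L: "rotation_invariant_prob_on (sphere 0 1 \<inter> H) (\<sigma>\<^sub>L ?L)"
      using assms(4)[of H] H by (simp add: space_plane great_circle_def)
    note L_mean = invariant_prob_measure_eq_mean[OF H' L]
    interpret L: prob_space "\<sigma>\<^sub>L ?L" using L by (simp add: rotation_invariant_prob_on_def)
    have Lb: "?L \<in> sets borel"
      unfolding great_circle_def using closed_subspace[OF H'(1)] by (intro borel_closed closed_Int) auto
    have Lsets: "B \<inter> ?L \<in> sets (\<sigma>\<^sub>L ?L)" if "B \<in> sets borel" for B
      using L that Lb by (auto simp: rotation_invariant_prob_on_def great_circle_def sets_restrict_space)
    have mean: "measure (\<sigma>\<^sub>L ?L) (B \<inter> ?L) = subsphere_mean (indicator B) H"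
      if B: "B \<in> sets borel" "B \<subseteq> sphere 0 1" for B
      unfolding L_mean(2)[OF Lsets[OF B(1)]]
      using B(2) by (intro subsphere_mean_cong[OF H'(1)]) (auto simp: indicator_def great_circle_def)
    have sub: "B \<subseteq> sphere 0 1" if "B \<in> sets \<sigma>" for B
      using that assms(2) by (auto simp: rotation_invariant_prob_on_def sets_restrict_space)
    have "measure (\<sigma>\<^sub>L ?L) (N' \<inter> ?L) = 0"
      using mean[OF N'b sub[OF N'(1)]] H by (auto simp: Z_def)
    then have null: "N' \<inter> ?L \<in> null_sets (\<sigma>\<^sub>L ?L)"
      using Lsets[OF N'b] by (auto simp: null_sets_def L.emeasure_eq_measure)
    have "A \<inter> ?L = (S \<inter> ?L) \<union> (N \<inter> ?L)" "N \<inter> ?L \<subseteq> N' \<inter> ?L" using A by auto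
    then have "measure (completion (\<sigma>\<^sub>L ?L)) (A \<inter> ?L) = measure (\<sigma>\<^sub>L ?L) (S \<inter> ?L)"
      using measure_completion_Un_null(2)[OF Lsets[OF Sb] _ null, of "N \<inter> ?L"] by simp
    also have "\<dots> = subsphere_mean (indicator S) H" by (rule mean[OF Sb sub[OF A(4)]])
    finally show ?thesis
      using H by (simp add: E_def F_def assms(6) space_plane mult.commute)
  qed
  have "E = (F - Z) \<union> (E \<inter> Z)"
    using E_iff by (auto simp: E_def F_def space_plane[symmetric])
  moreover have "F - Z \<in> sets \<mu>" using F(1) Z by auto
  ultimately have "E \<in> sets (completion \<mu>)" "measure (completion \<mu>) E = measure \<mu> (F - Z)"
    using measure_completion_Un_null[of "F - Z" \<mu> "E \<inter> Z" Z] Z by auto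
  moreover have "measure \<mu> (F - Z) \<le> measure \<mu> F" using F(1) by (intro finite_measure_mono) auto
  ultimately show ?thesis using F(2) by simp
qed

end
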